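(* Let $G$ be a countable discrete group and let $T:G\to G$ be a group automorphism such that for every $g\in G$ the orbit $\{T^ng:n\in\mathbb{Z}\}$ is finite. Let $C=\mathfrak{L}(G)\subset\mathcal{B}(\ell^2(G))$ be the group von Neumann algebra of $G$, with trace $\sigma(c)=\langle\delta_1,c\delta_1\rangle$ and $*$-automorphism $\gamma(c)=U_\gamma cU_\gamma^*$, where $U_\gamma f=f\circ T$ for $f\in\ell^2(G)$. Let $(X,\mathcal{X},\rho)$ be a standard probability space with $X$ a compact Hausdorff space and $\rho$ a Borel measure, and let $S:X\to X$ be an invertible map with $S^{-1}\mathcal{X}\subset\mathcal{X}$, $S\mathcal{X}\subset\mathcal{X}$ and $\rho(S^{-1}(K))=\rho(K)$ for all $K\in\mathcal{X}$. Let $B=L^\infty(\rho)$, acting on $L^2(\rho)$ by multiplication. Let $k:X\to\mathbb{Z}$ be any measurable map. On $A:=B\bar\otimes C$, acting on $L^2(\rho)\otimes\ell^2(G)$, let $\mu(a)=\langle 1\otimes\delta_1,a(1\otimes\delta_1)\rangle$, and let $\alpha$ be the $*$-automorphism of $A$ given by $$\alpha(a)(p):=\gamma^{k(p)}(a(Sp)),\qquad p\in X,\ a\in A,$$ where elements of $A$ are represented as decomposable operators $p\mapsto a(p)\in C$. Then the system $(B\bar\otimes C,\mu,\alpha)$ has discrete spectrum relative to its subsystem $(B\otimes1,\mu|_{B\otimes1},\alpha|_{B\otimes1})$.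
   Context: Group von Neumann algebra: $\mathfrak{L}(G)$ is generated by the unitaries $l(g)$, $g\in G$, with $l(g)\delta_h=\delta_{gh}$, where $\delta_h\in\ell^2(G)$ is the indicator of $h$; $1\in G$ is the identity. Direct integral representation: $A=B\bar\otimes C$ is identified with $\int_X^\oplus C\,\mathrm{d}\rho(p)$ acting on $L^2(\rho;\ell^2(G))\cong L^2(\rho)\otimes\ell^2(G)$; each $a\in A$ is represented by a measurable, essentially bounded field $p\mapsto a(p)\in C$ with $(az)(p)=a(p)z(p)$ for $z\in L^2(\rho;\ell^2(G))$, and $b\otimes c$ corresponds to $p\mapsto b(p)c$. Inner products are linear in the second variable. A system $\mathbf{A}=(A,\mu,\alpha)$ consists of a von Neumann algebra $A$, a faithful normal trace $\mu$ on $A$ (a positive linear functional on $A$), and a $*$-automorphism $\alpha$ of $A$ with $\mu\circ\alpha=\mu$. $A$ is taken to act on a Hilbert space $H$ with a cyclic and separating vector $\Omega$ such that $\mu(a)=\langle\Omega,a\Omega\rangle$ (here $H=L^2(\rho)\otimes\ell^2(G)$, $\Omega=1\otimes\delta_1$). $U$ is the unitary on $H$ determined by $Ua\Omega=\alpha(a)\Omega$ for $a\in A$. A system $\mathbf{F}=(F,\lambda,\varphi)$ is a subsystem of $\mathbf{A}$ if $F$ is a von Neumann subalgebra of $A$ containing the unit of $A$, $\mu|_F=\lambda$ and $\alpha|_F=\varphi$. Put $H_F:=\overline{F\Omega}$ and let $e_F$ be the orthogonal projection of $H$ onto $H_F$. Let $J$ be the modular conjugation (the antiunitary extending $a\Omega\mapsto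 a^*\Omega$, $a\in A$) and $j(a):=Ja^*J$. The basic construction $\langle A,e_F\rangle$ is the von Neumann algebra on $H$ generated by $A$ and $e_F$; it carries the canonical faithful normal semifinite tracial weight $\bar\mu:\langle A,e_F\rangle^+\to[0,\infty]$ determined by $\bar\mu(ae_Fb)=\mu(ab)$ for $a,b\in A$ (extended linearly to $\operatorname{span}\{ae_Fb:a,b\in A\}$). $H$ is a right $A$-module by $xa:=j(a)x$. A closed subspace $V\subset H$ is a right-$F$-submodule if $xa\in V$ for all $x\in V$, $a\in F$ (equivalently, its orthogonal projection $P_V$ lies in $\langle A,e_F\rangle$), and is $U$-invariant if $UV=V$. A $U$-$\bar\mu$-module is a $U$-invariant right-$F$-submodule $V\subset H\ominus H_F$ with $\bar\mu(P_V)<\infty$. $\mathcal{E}_{A/F}$ is the closed subspace of $H\ominus H_F$ spanned by all $U$-$\bar\mu$-modules. $\mathbf{A}$ has discrete spectrum relative to $\mathbf{F}$ if $\mathcal{E}_{A/F}=H\ominus H_F$. *)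

theory Defs
  imports "HOL-Analysis.Analysis" "HOL-Probability.Probability" "HOL-Algebra.Group"
begin

section \<open>Complex inner product spaces on a carrier\<close>

text \<open>
  The Hilbert spaces below are spaces \<open>L\<^sup>2(M)\<close> depending on a measure \<open>M\<close>, hence they are given by
  a carrier and operations rather than by a type class. Inner products are linear in the second
  variable. Operators are extensional functions on the carrier, so that equality of operators
  is equality in HOL.
\<close>

record 'v inner_space =
  vecs :: "'v set"
  vadd :: "'v \<Rightarrow> 'v \<Rightarrow> 'v"
  vscale :: "complex \<Rightarrow> 'v \<Rightarrow> 'v"
  vinner :: "'v \<Rightarrow> 'v \<Rightarrow> complex"

definition vdiff :: "'v inner_space \<Rightarrow> 'v \<Rightarrow> 'v \<Rightarrow> 'v" where
  "vdiff H x y = vadd H x (vscale H (- 1) y)"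

definition vnorm :: "'v inner_space \<Rightarrow> 'v \<Rightarrow> real" where
  "vnorm H x = sqrt (Re (vinner H x x))"

definition vclosure :: "'v inner_space \<Rightarrow> 'v set \<Rightarrow> 'v set" where
  "vclosure H S = {x \<in> vecs H. \<forall>e>0. \<exists>y\<in>S. vnorm H (vdiff H x y) < e}"

definition lin_subspace :: "'v inner_space \<Rightarrow> 'v set \<Rightarrow> bool" where
  "lin_subspace H V \<longleftrightarrow> V \<subseteq> vecs H \<and> V \<noteq> {} \<and>
     (\<forall>x\<in>V. \<forall>y\<in>V. vadd H x y \<in> V) \<and> (\<forall>c. \<forall>x\<in>V. vscale H c x \<in> V)"

definition closed_subspace :: "'v inner_space \<Rightarrow> 'v set \<Rightarrow> bool" where
  "closed_subspace H V \<longleftrightarrow> lin_subspace H V \<and> vclosure H V = V"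

definition closed_span :: "'v inner_space \<Rightarrow> 'v set \<Rightarrow> 'v set" where
  "closed_span H S = \<Inter> {V. closed_subspace H V \<and> S \<subseteq> V}"

definition orth_compl :: "'v inner_space \<Rightarrow> 'v set \<Rightarrow> 'v set" where
  "orth_compl H V = {x \<in> vecs H. \<forall>v\<in>V. vinner H v x = 0}"


section \<open>Bounded operators and von Neumann algebras\<close>

definition linear_op :: "'v inner_space \<Rightarrow> ('v \<Rightarrow> 'v) \<Rightarrow> bool" where
  "linear_op H a \<longleftrightarrow> a \<in> vecs H \<rightarrow>\<^sub>E vecs H \<and>
     (\<forall>x\<in>vecs H. \<forall>y\<in>vecs H. a (vadd H x y) = vadd H (a x) (a y)) \<and>
     (\<forall>c. \<forall>x\<in>vecs H. a (vscale H c x) = vscale H c (a x))"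

definition bounded_ops :: "'v inner_space \<Rightarrow> ('v \<Rightarrow> 'v) set" where
  "bounded_ops H = {a. linear_op H a \<and> (\<exists>K. \<forall>x\<in>vecs H. vnorm H (a x) \<le> K * vnorm H x)}"

definition op_mult :: "'v inner_space \<Rightarrow> ('v \<Rightarrow> 'v) \<Rightarrow> ('v \<Rightarrow> 'v) \<Rightarrow> ('v \<Rightarrow> 'v)" where
  "op_mult H a b = (\<lambda>x\<in>vecs H. a (b x))"

definition op_add :: "'v inner_space \<Rightarrow> ('v \<Rightarrow> 'v) \<Rightarrow> ('v \<Rightarrow> 'v) \<Rightarrow> ('v \<Rightarrow> 'v)" where
  "op_add H a b = (\<lambda>x\<in>vecs H. vadd H (a x) (b x))"

definition op_scale :: "'v inner_space \<Rightarrow> complex \<Rightarrow> ('v \<Rightarrow> 'v) \<Rightarrow> ('v \<Rightarrow> 'v)" where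
  "op_scale H c a = (\<lambda>x\<in>vecs H. vscale H c (a x))"

definition op_zero :: "'v inner_space \<Rightarrow> ('v \<Rightarrow> 'v)" where
  "op_zero H = (\<lambda>x\<in>vecs H. vscale H 0 x)"

definition op_adj :: "'v inner_space \<Rightarrow> ('v \<Rightarrow> 'v) \<Rightarrow> ('v \<Rightarrow> 'v)" where
  "op_adj H a = (THE b. b \<in> bounded_ops H \<and>
     (\<forall>x\<in>vecs H. \<forall>y\<in>vecs H. vinner H (b x) y = vinner H x (a y)))"

definition unitary_op :: "'v inner_space \<Rightarrow> ('v \<Rightarrow> 'v) \<Rightarrow> bool" where
  "unitary_op H u \<longleftrightarrow> linear_op H u \<and> u ` vecs H = vecs H \<and>
     (\<forall>x\<in>vecs H. \<forall>y\<in>vecs H. vinner H (u x) (u y) = vinner H x y)"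

definition antiunitary_op :: "'v inner_space \<Rightarrow> ('v \<Rightarrow> 'v) \<Rightarrow> bool" where
  "antiunitary_op H u \<longleftrightarrow> u \<in> vecs H \<rightarrow>\<^sub>E vecs H \<and> u ` vecs H = vecs H \<and>
     (\<forall>x\<in>vecs H. \<forall>y\<in>vecs H. u (vadd H x y) = vadd H (u x) (u y)) \<and>
     (\<forall>c. \<forall>x\<in>vecs H. u (vscale H c x) = vscale H (cnj c) (u x)) \<and>
     (\<forall>x\<in>vecs H. \<forall>y\<in>vecs H. vinner H (u x) (u y) = vinner H y x)"

definition orth_proj :: "'v inner_space \<Rightarrow> 'v set \<Rightarrow> ('v \<Rightarrow> 'v)" where
  "orth_proj H V = (\<lambda>x\<in>vecs H. THE y. y \<in> V \<and> (\<forall>v\<in>V. vinner H v (vdiff H x y) = 0))"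

definition op_commutant :: "'v inner_space \<Rightarrow> ('v \<Rightarrow> 'v) set \<Rightarrow> ('v \<Rightarrow> 'v) set" where
  "op_commutant H S = {a \<in> bounded_ops H. \<forall>s\<in>S. op_mult H a s = op_mult H s a}"

definition vn_algebra :: "'v inner_space \<Rightarrow> ('v \<Rightarrow> 'v) set \<Rightarrow> bool" where
  "vn_algebra H M \<longleftrightarrow> M \<subseteq> bounded_ops H \<and> (\<forall>a\<in>M. op_adj H a \<in> M) \<and>
     op_commutant H (op_commutant H M) = M"

definition vn_generated :: "'v inner_space \<Rightarrow> ('v \<Rightarrow> 'v) set \<Rightarrow> ('v \<Rightarrow> 'v) set" where
  "vn_generated H S = \<Inter> {M. vn_algebra H M \<and> S \<subseteq> M}"

definition star_automorphism ::
    "'v inner_space \<Rightarrow> ('v \<Rightarrow> 'v) set \<Rightarrow> (('v \<Rightarrow> 'v) \<Rightarrow> ('v \<Rightarrow> 'v)) \<Rightarrow> bool" where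
  "star_automorphism H A \<alpha> \<longleftrightarrow> bij_betw \<alpha> A A \<and>
     (\<forall>a\<in>A. \<forall>b\<in>A. \<alpha> (op_add H a b) = op_add H (\<alpha> a) (\<alpha> b)) \<and>
     (\<forall>c. \<forall>a\<in>A. \<alpha> (op_scale H c a) = op_scale H c (\<alpha> a)) \<and>
     (\<forall>a\<in>A. \<forall>b\<in>A. \<alpha> (op_mult H a b) = op_mult H (\<alpha> a) (\<alpha> b)) \<and>
     (\<forall>a\<in>A. \<alpha> (op_adj H a) = op_adj H (\<alpha> a))"

definition vector_state :: "'v inner_space \<Rightarrow> 'v \<Rightarrow> ('v \<Rightarrow> 'v) \<Rightarrow> complex" where
  "vector_state H \<Omega> a = vinner H \<Omega> (a \<Omega>)"


section \<open>Tracial weights\<close>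

definition pos_part :: "'v inner_space \<Rightarrow> ('v \<Rightarrow> 'v) set \<Rightarrow> ('v \<Rightarrow> 'v) set" where
  "pos_part H M = {a \<in> M. \<forall>x\<in>vecs H. vinner H x (a x) \<in> \<real> \<and> 0 \<le> Re (vinner H x (a x))}"

definition op_le :: "'v inner_space \<Rightarrow> ('v \<Rightarrow> 'v) \<Rightarrow> ('v \<Rightarrow> 'v) \<Rightarrow> bool" where
  "op_le H a b \<longleftrightarrow> op_add H b (op_scale H (- 1) a) \<in> pos_part H (bounded_ops H)"

definition op_weight ::
    "'v inner_space \<Rightarrow> ('v \<Rightarrow> 'v) set \<Rightarrow> (('v \<Rightarrow> 'v) \<Rightarrow> ennreal) \<Rightarrow> bool" where
  "op_weight H M \<tau> \<longleftrightarrow>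
     (\<forall>x\<in>pos_part H M. \<forall>y\<in>pos_part H M. \<tau> (op_add H x y) = \<tau> x + \<tau> y) \<and>
     (\<forall>r\<ge>0. \<forall>x\<in>pos_part H M. \<tau> (op_scale H (complex_of_real r) x) = ennreal r * \<tau> x)"

definition op_tracial ::
    "'v inner_space \<Rightarrow> ('v \<Rightarrow> 'v) set \<Rightarrow> (('v \<Rightarrow> 'v) \<Rightarrow> ennreal) \<Rightarrow> bool" where
  "op_tracial H M \<tau> \<longleftrightarrow>
     (\<forall>x\<in>M. \<tau> (op_mult H (op_adj H x) x) = \<tau> (op_mult H x (op_adj H x)))"

definition op_faithful ::
    "'v inner_space \<Rightarrow> ('v \<Rightarrow> 'v) set \<Rightarrow> (('v \<Rightarrow> 'v) \<Rightarrow> ennreal) \<Rightarrow> bool" where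
  "op_faithful H M \<tau> \<longleftrightarrow> (\<forall>x\<in>pos_part H M. \<tau> x = 0 \<longrightarrow> x = op_zero H)"

definition op_normal ::
    "'v inner_space \<Rightarrow> ('v \<Rightarrow> 'v) set \<Rightarrow> (('v \<Rightarrow> 'v) \<Rightarrow> ennreal) \<Rightarrow> bool" where
  "op_normal H M \<tau> \<longleftrightarrow>
     (\<forall>D x. D \<noteq> {} \<and> D \<subseteq> pos_part H M \<and>
        (\<forall>a\<in>D. \<forall>b\<in>D. \<exists>c\<in>D. op_le H a c \<and> op_le H b c) \<and>
        x \<in> pos_part H M \<and> (\<forall>a\<in>D. op_le H a x) \<and>
        (\<forall>y\<in>pos_part H M. (\<forall>a\<in>D. op_le H a y) \<longrightarrow> op_le H x y)
        \<longrightarrow> \<tau> x = (SUP a\<in>D. \<tau> a))"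

definition op_semifinite ::
    "'v inner_space \<Rightarrow> ('v \<Rightarrow> 'v) set \<Rightarrow> (('v \<Rightarrow> 'v) \<Rightarrow> ennreal) \<Rightarrow> bool" where
  "op_semifinite H M \<tau> \<longleftrightarrow>
     (\<forall>x\<in>pos_part H M. x \<noteq> op_zero H \<longrightarrow>
        (\<exists>y\<in>pos_part H M. y \<noteq> op_zero H \<and> op_le H y x \<and> \<tau> y < \<infinity>))"


section \<open>Discrete spectrum relative to a subsystem\<close>

text \<open>
  For a system with cyclic and separating trace vector \<open>\<Omega>\<close>, the unitary \<open>U\<close>, the conjugation \<open>J\<close> and the
  trace \<open>\<tau>\<close> on the basic construction exist and are uniquely determined; the predicates
  \<open>implementing_unitary\<close>, \<open>modular_conjugation\<close> and \<open>canonical_trace\<close> are their defining conditions.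
\<close>

definition implementing_unitary ::
    "'v inner_space \<Rightarrow> 'v \<Rightarrow> ('v \<Rightarrow> 'v) set \<Rightarrow> (('v \<Rightarrow> 'v) \<Rightarrow> ('v \<Rightarrow> 'v)) \<Rightarrow> ('v \<Rightarrow> 'v) \<Rightarrow> bool" where
  "implementing_unitary H \<Omega> A \<alpha> U \<longleftrightarrow> unitary_op H U \<and> (\<forall>a\<in>A. U (a \<Omega>) = \<alpha> a \<Omega>)"

definition modular_conjugation ::
    "'v inner_space \<Rightarrow> 'v \<Rightarrow> ('v \<Rightarrow> 'v) set \<Rightarrow> ('v \<Rightarrow> 'v) \<Rightarrow> bool" where
  "modular_conjugation H \<Omega> A J \<longleftrightarrow>
     antiunitary_op H J \<and> (\<forall>a\<in>A. J (a \<Omega>) = op_adj H a \<Omega>)"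

definition sub_space :: "'v inner_space \<Rightarrow> 'v \<Rightarrow> ('v \<Rightarrow> 'v) set \<Rightarrow> 'v set" where
  "sub_space H \<Omega> F = vclosure H ((\<lambda>a. a \<Omega>) ` F)"

definition sub_proj :: "'v inner_space \<Rightarrow> 'v \<Rightarrow> ('v \<Rightarrow> 'v) set \<Rightarrow> ('v \<Rightarrow> 'v)" where
  "sub_proj H \<Omega> F = orth_proj H (sub_space H \<Omega> F)"

definition basic_construction ::
    "'v inner_space \<Rightarrow> 'v \<Rightarrow> ('v \<Rightarrow> 'v) set \<Rightarrow> ('v \<Rightarrow> 'v) set \<Rightarrow> ('v \<Rightarrow> 'v) set" where
  "basic_construction H \<Omega> A F = vn_generated H (insert (sub_proj H \<Omega> F) A)"

text \<open>The operator \<open>\<Sum>\<^sub>i a\<^sub>i e b\<^sub>i\<close> for a list of pairs \<open>(a\<^sub>i, b\<^sub>i)\<close>.\<close>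

definition sum_aeb :: "'v inner_space \<Rightarrow> ('v \<Rightarrow> 'v) \<Rightarrow> (('v \<Rightarrow> 'v) \<times> ('v \<Rightarrow> 'v)) list \<Rightarrow> ('v \<Rightarrow> 'v)" where
  "sum_aeb H e ps =
     foldr (\<lambda>(a, b). op_add H (op_mult H a (op_mult H e b))) ps (op_zero H)"

text \<open>
  A weight is defined on positive operators only, so the last clause states the linear extension of
  \<open>a e b \<mapsto> \<mu>(ab)\<close> on those elements of the span of \<open>A e A\<close> that are positive. Together with the other
  clauses it determines \<open>\<tau>\<close> on the positive part of the basic construction; values elsewhere
  are irrelevant.
\<close>

definition canonical_trace ::
    "'v inner_space \<Rightarrow> 'v \<Rightarrow> ('v \<Rightarrow> 'v) set \<Rightarrow> (('v \<Rightarrow> 'v) \<Rightarrow> complex) \<Rightarrow> ('v \<Rightarrow> 'v) set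
      \<Rightarrow> (('v \<Rightarrow> 'v) \<Rightarrow> ennreal) \<Rightarrow> bool" where
  "canonical_trace H \<Omega> A \<mu> F \<tau> \<longleftrightarrow>
     (let M = basic_construction H \<Omega> A F; e = sub_proj H \<Omega> F in
       op_weight H M \<tau> \<and> op_tracial H M \<tau> \<and> op_faithful H M \<tau> \<and>
       op_normal H M \<tau> \<and> op_semifinite H M \<tau> \<and>
       (\<forall>ps. set ps \<subseteq> A \<times> A \<and> sum_aeb H e ps \<in> pos_part H M \<longrightarrow>
          \<tau> (sum_aeb H e ps) < \<infinity> \<and>
          complex_of_real (enn2real (\<tau> (sum_aeb H e ps))) =
            (\<Sum>(a, b)\<leftarrow>ps. \<mu> (op_mult H a b))))"

definition right_submodule ::
    "'v inner_space \<Rightarrow> ('v \<Rightarrow> 'v) \<Rightarrow> ('v \<Rightarrow> 'v) set \<Rightarrow> 'v set \<Rightarrow> bool" where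
  "right_submodule H J F V \<longleftrightarrow> closed_subspace H V \<and>
     (\<forall>x\<in>V. \<forall>a\<in>F. op_mult H J (op_mult H (op_adj H a) J) x \<in> V)"

definition U_trace_module ::
    "'v inner_space \<Rightarrow> 'v \<Rightarrow> ('v \<Rightarrow> 'v) set \<Rightarrow> ('v \<Rightarrow> 'v) \<Rightarrow> ('v \<Rightarrow> 'v)
      \<Rightarrow> (('v \<Rightarrow> 'v) \<Rightarrow> ennreal) \<Rightarrow> 'v set \<Rightarrow> bool" where
  "U_trace_module H \<Omega> F U J \<tau> V \<longleftrightarrow>
     right_submodule H J F V \<and> U ` V = V \<and> V \<subseteq> orth_compl H (sub_space H \<Omega> F) \<and>
     \<tau> (orth_proj H V) < \<infinity>"

definition discrete_part ::
    "'v inner_space \<Rightarrow> 'v \<Rightarrow> ('v \<Rightarrow> 'v) set \<Rightarrow> ('v \<Rightarrow> 'v) \<Rightarrow> ('v \<Rightarrow> 'v)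
      \<Rightarrow> (('v \<Rightarrow> 'v) \<Rightarrow> ennreal) \<Rightarrow> 'v set" where
  "discrete_part H \<Omega> F U J \<tau> = closed_span H (\<Union> {V. U_trace_module H \<Omega> F U J \<tau> V})"

definition relative_discrete_spectrum ::
    "'v inner_space \<Rightarrow> 'v \<Rightarrow> ('v \<Rightarrow> 'v) set \<Rightarrow> ('v \<Rightarrow> 'v) \<Rightarrow> ('v \<Rightarrow> 'v)
      \<Rightarrow> (('v \<Rightarrow> 'v) \<Rightarrow> ennreal) \<Rightarrow> bool" where
  "relative_discrete_spectrum H \<Omega> F U J \<tau> \<longleftrightarrow>
     discrete_part H \<Omega> F U J \<tau> = orth_compl H (sub_space H \<Omega> F)"


section \<open>The Hilbert spaces \<open>L\<^sup>2(M)\<close>\<close>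

definition l2_functions :: "'i measure \<Rightarrow> ('i \<Rightarrow> complex) set" where
  "l2_functions M = {f \<in> borel_measurable M. integrable M (\<lambda>x. (cmod (f x))\<^sup>2)}"

definition l2_class :: "'i measure \<Rightarrow> ('i \<Rightarrow> complex) \<Rightarrow> ('i \<Rightarrow> complex) set" where
  "l2_class M f = {h \<in> l2_functions M. AE x in M. h x = f x}"

definition l2_rep :: "('i \<Rightarrow> complex) set \<Rightarrow> 'i \<Rightarrow> complex" where
  "l2_rep u = (SOME f. f \<in> u)"

definition L2 :: "'i measure \<Rightarrow> ('i \<Rightarrow> complex) set inner_space" where
  "L2 M = \<lparr> vecs = l2_class M ` l2_functions M,
     vadd = (\<lambda>u v. l2_class M (\<lambda>x. l2_rep u x + l2_rep v x)),
     vscale = (\<lambda>c u. l2_class M (\<lambda>x. c * l2_rep u x)),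
     vinner = (\<lambda>u v. LINT x|M. cnj (l2_rep u x) * l2_rep v x) \<rparr>"

definition mult_op :: "'i measure \<Rightarrow> ('i \<Rightarrow> complex) \<Rightarrow> ('i \<Rightarrow> complex) set \<Rightarrow> ('i \<Rightarrow> complex) set" where
  "mult_op M f = (\<lambda>u\<in>vecs (L2 M). l2_class M (\<lambda>x. f x * l2_rep u x))"

definition Linfty_algebra :: "'i measure \<Rightarrow> (('i \<Rightarrow> complex) set \<Rightarrow> ('i \<Rightarrow> complex) set) set" where
  "Linfty_algebra M =
     {mult_op M f | f. f \<in> borel_measurable M \<and> (\<exists>K. AE x in M. cmod (f x) \<le> K)}"

text \<open>
  For \<open>\<sigma>\<close>-finite measures, \<open>L\<^sup>2(M) \<otimes> L\<^sup>2(N)\<close> is identified with \<open>L\<^sup>2\<close> of the product measure.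
\<close>

definition tensor_vec ::
    "'i measure \<Rightarrow> 'j measure \<Rightarrow> ('i \<Rightarrow> complex) set \<Rightarrow> ('j \<Rightarrow> complex) set \<Rightarrow> ('i \<times> 'j \<Rightarrow> complex) set" where
  "tensor_vec M N u v = l2_class (M \<Otimes>\<^sub>M N) (\<lambda>(i, j). l2_rep u i * l2_rep v j)"

definition tensor_ops ::
    "'i measure \<Rightarrow> 'j measure \<Rightarrow> (('i \<Rightarrow> complex) set \<Rightarrow> ('i \<Rightarrow> complex) set) set
      \<Rightarrow> (('j \<Rightarrow> complex) set \<Rightarrow> ('j \<Rightarrow> complex) set) set
      \<Rightarrow> (('i \<times> 'j \<Rightarrow> complex) set \<Rightarrow> ('i \<times> 'j \<Rightarrow> complex) set) set" where
  "tensor_ops M N B C = {t \<in> bounded_ops (L2 (M \<Otimes>\<^sub>M N)). \<exists>b\<in>B. \<exists>c\<in>C.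
     \<forall>u\<in>vecs (L2 M). \<forall>v\<in>vecs (L2 N). t (tensor_vec M N u v) = tensor_vec M N (b u) (c v)}"

definition vn_tensor ::
    "'i measure \<Rightarrow> 'j measure \<Rightarrow> (('i \<Rightarrow> complex) set \<Rightarrow> ('i \<Rightarrow> complex) set) set
      \<Rightarrow> (('j \<Rightarrow> complex) set \<Rightarrow> ('j \<Rightarrow> complex) set) set
      \<Rightarrow> (('i \<times> 'j \<Rightarrow> complex) set \<Rightarrow> ('i \<times> 'j \<Rightarrow> complex) set) set" where
  "vn_tensor M N B C = vn_generated (L2 (M \<Otimes>\<^sub>M N)) (tensor_ops M N B C)"

text \<open>
  \<open>fiber N z p\<close> is the vector \<open>z(p)\<close> of \<open>L\<^sup>2(N)\<close> when \<open>z\<close> is viewed as an element of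
  \<open>L\<^sup>2(M; L\<^sup>2(N))\<close>; it is meaningful for almost every \<open>p\<close>.
\<close>

definition fiber :: "'j measure \<Rightarrow> ('i \<times> 'j \<Rightarrow> complex) set \<Rightarrow> 'i \<Rightarrow> ('j \<Rightarrow> complex) set" where
  "fiber N z p = l2_class N (\<lambda>j. l2_rep z (p, j))"

text \<open>
  The operator \<open>a\<close> is decomposable with the measurable, essentially bounded field
  \<open>p \<mapsto> c p\<close> in \<open>C\<close>.
\<close>

definition represented_by ::
    "'i measure \<Rightarrow> 'j measure \<Rightarrow> (('j \<Rightarrow> complex) set \<Rightarrow> ('j \<Rightarrow> complex) set) set
      \<Rightarrow> (('i \<times> 'j \<Rightarrow> complex) set \<Rightarrow> ('i \<times> 'j \<Rightarrow> complex) set)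
      \<Rightarrow> ('i \<Rightarrow> ('j \<Rightarrow> complex) set \<Rightarrow> ('j \<Rightarrow> complex) set) \<Rightarrow> bool" where
  "represented_by M N C a c \<longleftrightarrow> a \<in> bounded_ops (L2 (M \<Otimes>\<^sub>M N)) \<and>
     (\<forall>p\<in>space M. c p \<in> C) \<and>
     (\<forall>u\<in>vecs (L2 N). \<forall>v\<in>vecs (L2 N). (\<lambda>p. vinner (L2 N) u (c p v)) \<in> borel_measurable M) \<and>
     (\<exists>K. AE p in M. \<forall>u\<in>vecs (L2 N). vnorm (L2 N) (c p u) \<le> K * vnorm (L2 N) u) \<and>
     (\<forall>z\<in>vecs (L2 (M \<Otimes>\<^sub>M N)). AE p in M. fiber N (a z) p = c p (fiber N z p))"


section \<open>Group von Neumann algebras\<close>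

abbreviation group_measure :: "('g, 'm) monoid_scheme \<Rightarrow> 'g measure" where
  "group_measure G \<equiv> count_space (carrier G)"

definition delta :: "('g, 'm) monoid_scheme \<Rightarrow> 'g \<Rightarrow> ('g \<Rightarrow> complex) set" where
  "delta G h = l2_class (group_measure G) (indicator {h})"

text \<open>\<open>(l(g) f)(h) = f(g\<inverse> h)\<close>, so that \<open>l(g) \<delta>\<^sub>h\<close> is the indicator of \<open>g h\<close>.\<close>

definition left_translation ::
    "('g, 'm) monoid_scheme \<Rightarrow> 'g \<Rightarrow> ('g \<Rightarrow> complex) set \<Rightarrow> ('g \<Rightarrow> complex) set" where
  "left_translation G g = (\<lambda>u\<in>vecs (L2 (group_measure G)).
     l2_class (group_measure G) (\<lambda>h. l2_rep u (inv\<^bsub>G\<^esub> g \<otimes>\<^bsub>G\<^esub> h)))"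

definition group_vn ::
    "('g, 'm) monoid_scheme \<Rightarrow> (('g \<Rightarrow> complex) set \<Rightarrow> ('g \<Rightarrow> complex) set) set" where
  "group_vn G = vn_generated (L2 (group_measure G)) (left_translation G ` carrier G)"

definition U_gamma ::
    "('g, 'm) monoid_scheme \<Rightarrow> ('g \<Rightarrow> 'g) \<Rightarrow> ('g \<Rightarrow> complex) set \<Rightarrow> ('g \<Rightarrow> complex) set" where
  "U_gamma G T = (\<lambda>u\<in>vecs (L2 (group_measure G)).
     l2_class (group_measure G) (\<lambda>h. l2_rep u (T h)))"

definition gamma ::
    "('g, 'm) monoid_scheme \<Rightarrow> ('g \<Rightarrow> 'g)
      \<Rightarrow> (('g \<Rightarrow> complex) set \<Rightarrow> ('g \<Rightarrow> complex) set) \<Rightarrow> (('g \<Rightarrow> complex) set \<Rightarrow> ('g \<Rightarrow> complex) set)" where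
  "gamma G T c = (let H = L2 (group_measure G); u = U_gamma G T in
     op_mult H u (op_mult H c (op_adj H u)))"

text \<open>Integer powers of a bijection \<open>f\<close> of the set \<open>D\<close>.\<close>

definition int_pow_on :: "'d set \<Rightarrow> ('d \<Rightarrow> 'd) \<Rightarrow> int \<Rightarrow> 'd \<Rightarrow> 'd" where
  "int_pow_on D f n = (if 0 \<le> n then f ^^ nat n else inv_into D f ^^ nat (- n))"


section \<open>Standard probability spaces with a compact Hausdorff topology\<close>

definition borel_sets_of :: "'x topology \<Rightarrow> 'x set set" where
  "borel_sets_of X = sigma_sets (topspace X) {V. openin X V}"

definition standard_borel :: "'x measure \<Rightarrow> bool" where
  "standard_borel M \<longleftrightarrow> (\<exists>Y. completely_metrizable_space Y \<and> second_countable Y \<and>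
     topspace Y = space M \<and> sets M = borel_sets_of Y)"

definition measure_automorphism :: "'x measure \<Rightarrow> ('x \<Rightarrow> 'x) \<Rightarrow> bool" where
  "measure_automorphism M S \<longleftrightarrow> bij_betw S (space M) (space M) \<and>
     (\<forall>K\<in>sets M. S -` K \<inter> space M \<in> sets M \<and> S ` K \<in> sets M \<and>
        emeasure M (S -` K \<inter> space M) = emeasure M K)"

end

theory Submission
  imports Defs
begin

text \<open>
  For a subset \<open>E\<close> of \<open>G\<close> let \<open>V\<^sub>E\<close> be the space of vectors of \<open>L\<^sup>2(\<rho> \<otimes> G)\<close> that vanish off \<open>X \<times> E\<close>.
  The functions \<open>b \<otimes> \<delta>\<^sub>g = (b \<otimes> l(g))\<Omega>\<close> with \<open>b \<in> L\<^sup>\<infinity>(\<rho>)\<close> and \<open>g \<in> E\<close> span a dense subspace of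
  \<open>V\<^sub>E\<close>. Since \<open>\<gamma>(l(g)) = l(T\<^sup>-\<^sup>1 g)\<close>, the unitary \<open>U\<close> maps \<open>b \<otimes> \<delta>\<^sub>g\<close> to a function which at \<open>p\<close> is supported
  at \<open>T\<^bsup>-k(p)\<^esup> g\<close>; hence \<open>U\<close> preserves \<open>V\<^sub>E\<close> and \<open>V\<^bsub>G - E\<^esub>\<close>, and so \<open>U V\<^sub>E = V\<^sub>E\<close>, whenever \<open>E\<close> is \<open>T\<close>-invariant.
  As \<open>J\<close> maps \<open>V\<^sub>E\<close> to \<open>V\<^bsub>E'\<^esub>\<close> with \<open>E' = E\<^sup>-\<^sup>1\<close>, each \<open>V\<^sub>E\<close> is a right submodule. For a finite orbit \<open>E\<close>,
  the projection onto \<open>V\<^sub>E\<close> is \<open>\<Sum>\<^bsub>g\<in>E\<^esub> l(g) e l(g)\<^sup>*\<close> and has finite trace. The orbits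
  other than \<open>{1}\<close> then exhaust the complement of \<open>V\<^bsub>{1}\<^esub>\<close>, which is the closure of \<open>F\<Omega>\<close>.
\<close>

section \<open>Calculus in \<open>L\<^sup>2(M)\<close>\<close>

text \<open>The automorphism is known only through decomposable fields, and \<open>U\<close> and
  \<open>J\<close> only on the vectors a\<Omega>. Each is therefore evaluated on the operators b
  \<otimes> l(g), whose fields p \<mapsto> b(p) l(g) are explicit; the resulting inclusions pass to
  whole layers because the preimage of a closed subspace under a bounded linear or antilinear map is
  a closed subspace. A single layer V_{g} already has finite trace, but \<open>U\<close> moves it
  along the T-orbit of g by a power k(p) that varies with p and may be unbounded. A T-invariant E
  absorbs all powers at once, and finite orbits reconcile this invariance with finite trace. The
  obstacle on the operator side is negative powers of \<gamma>. They are formed with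
  \<open>inv_into\<close> on C, so \<gamma> has to be injective there, which rests on C consisting
  of bounded operators. Since C is defined as an intersection of von Neumann algebras, one member of
  the family must be exhibited, and this is where adjoints on \<open>\<ell>\<^sup>2(G)\<close> come
  in.\<close>

lemma borel_measurable_cnj [measurable]:
  "f \<in> borel_measurable M \<Longrightarrow> (\<lambda>x. cnj (f x)) \<in> borel_measurable M"
  by (rule measurable_compose[OF _ borel_measurable_continuous_onI]) (auto intro!: continuous_intros)

lemma AE_eq_cong:
  assumes "AE x in M. f x = g x"
  shows "(AE x in M. h x = f x) \<longleftrightarrow> (AE x in M. h x = g x)"
proof
  show "AE x in M. h x = g x" if "AE x in M. h x = f x"
    using assms that by eventually_elim simp
  show "AE x in M. h x = f x" if "AE x in M. h x = g x"
    using assms that by eventually_elim simp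
qed

section \<open>Square-integrable functions\<close>

lemma l2_functionsI:
  "f \<in> borel_measurable M \<Longrightarrow> integrable M (\<lambda>x. (cmod (f x))\<^sup>2) \<Longrightarrow> f \<in> l2_functions M"
  by (simp add: l2_functions_def)

lemma l2_functionsD:
  assumes "f \<in> l2_functions M"
  shows "f \<in> borel_measurable M" "integrable M (\<lambda>x. (cmod (f x))\<^sup>2)"
  using assms by (auto simp: l2_functions_def)

lemma l2_functions_bound:
  assumes f: "f \<in> l2_functions M" and g: "g \<in> borel_measurable M"
    and le: "AE x in M. cmod (g x) \<le> K * cmod (f x)"
  shows "g \<in> l2_functions M"
proof (rule l2_functionsI[OF g])
  have [measurable]: "g \<in> borel_measurable M" by fact
  show "integrable M (\<lambda>x. (cmod (g x))\<^sup>2)"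
  proof (rule Bochner_Integration.integrable_bound)
    show "integrable M (\<lambda>x. K\<^sup>2 * (cmod (f x))\<^sup>2)"
      using l2_functionsD(2)[OF f] by simp
    show "AE x in M. norm ((cmod (g x))\<^sup>2) \<le> norm (K\<^sup>2 * (cmod (f x))\<^sup>2)"
      using le
    proof eventually_elim
      case (elim x)
      from elim have "(cmod (g x))\<^sup>2 \<le> (K * cmod (f x))\<^sup>2" by (intro power_mono) auto
      then show ?case by (simp add: power_mult_distrib)
    qed
  qed measurable
qed

lemma cmod_add_square_le: "(cmod (a + b))\<^sup>2 \<le> 2 * (cmod a)\<^sup>2 + 2 * (cmod b)\<^sup>2"
proof -
  have "(cmod (a + b))\<^sup>2 \<le> (cmod a + cmod b)\<^sup>2"
    by (intro power_mono norm_triangle_ineq) auto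
  also have "\<dots> \<le> 2 * (cmod a)\<^sup>2 + 2 * (cmod b)\<^sup>2"
    using zero_le_power2[of "cmod a - cmod b"] by (simp add: power2_eq_square algebra_simps)
  finally show ?thesis .
qed

lemma l2_functions_add:
  assumes f: "f \<in> l2_functions M" and g: "g \<in> l2_functions M"
  shows "(\<lambda>x. f x + g x) \<in> l2_functions M"
proof (rule l2_functionsI)
  note [measurable] = l2_functionsD(1)[OF f] l2_functionsD(1)[OF g]
  show "(\<lambda>x. f x + g x) \<in> borel_measurable M" by measurable
  show "integrable M (\<lambda>x. (cmod (f x + g x))\<^sup>2)"
  proof (rule Bochner_Integration.integrable_bound)
    show "integrable M (\<lambda>x. 2 * (cmod (f x))\<^sup>2 + 2 * (cmod (g x))\<^sup>2)"
      using l2_functionsD(2)[OF f] l2_functionsD(2)[OF g] by simp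
    show "AE x in M. norm ((cmod (f x + g x))\<^sup>2)
        \<le> norm (2 * (cmod (f x))\<^sup>2 + 2 * (cmod (g x))\<^sup>2)"
      using cmod_add_square_le by (auto intro!: AE_I2)
  qed measurable
qed

lemma l2_functions_mult_bounded:
  assumes b: "b \<in> borel_measurable M" "AE x in M. cmod (b x) \<le> K"
    and f: "f \<in> l2_functions M"
  shows "(\<lambda>x. b x * f x) \<in> l2_functions M"
proof (rule l2_functions_bound[OF f])
  show "(\<lambda>x. b x * f x) \<in> borel_measurable M"
    using b(1) l2_functionsD(1)[OF f] by simp
  show "AE x in M. cmod (b x * f x) \<le> K * cmod (f x)"
    using b(2) by eventually_elim (simp add: norm_mult mult_right_mono)
qed

lemma l2_functions_scale: "f \<in> l2_functions M \<Longrightarrow> (\<lambda>x. c * f x) \<in> l2_functions M"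
  by (rule l2_functions_mult_bounded[where K = "cmod c"]) auto

lemma l2_functions_zero: "(\<lambda>x. 0) \<in> l2_functions M"
  by (simp add: l2_functions_def)

lemma l2_functions_diff:
  assumes f: "f \<in> l2_functions M" and g: "g \<in> l2_functions M"
  shows "(\<lambda>x. f x - g x) \<in> l2_functions M"
  using l2_functions_add[OF f l2_functions_scale[OF g, of "-1"]] by simp

section \<open>Classes modulo almost everywhere equality and their representatives\<close>

lemma l2_class_eq_iff:
  assumes f: "f \<in> l2_functions M" and g: "g \<in> l2_functions M"
  shows "l2_class M f = l2_class M g \<longleftrightarrow> (AE x in M. f x = g x)"
proof
  assume eq: "l2_class M f = l2_class M g"
  have "f \<in> l2_class M f" using f by (simp add: l2_class_def)
  then have "f \<in> l2_class M g" using eq by simp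
  then show "AE x in M. f x = g x" by (simp add: l2_class_def)
next
  assume ae: "AE x in M. f x = g x"
  show "l2_class M f = l2_class M g" using AE_eq_cong[OF ae] by (simp add: l2_class_def)
qed

text \<open>A class collects the square-integrable functions that agree almost everywhere with the
  given one, so arbitrary f and g are allowed: if f agrees with no square-integrable function, both
  classes are empty. Operators can thus be compared inside \<open>l2_class\<close> before membership
  is known.\<close>

lemma l2_class_cong_AE:
  assumes "AE x in M. f x = g x"
  shows "l2_class M f = l2_class M g"
proof -
  show ?thesis using AE_eq_cong[OF assms] by (simp add: l2_class_def)
qed

lemma l2_class_in_vecs [intro]: "f \<in> l2_functions M \<Longrightarrow> l2_class M f \<in> vecs (L2 M)"
  by (simp add: L2_def)

lemma l2_rep_class:
  assumes "f \<in> l2_functions M"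
  shows "l2_rep (l2_class M f) \<in> l2_functions M"
    and "AE x in M. l2_rep (l2_class M f) x = f x"
proof -
  have "f \<in> l2_class M f" using assms by (simp add: l2_class_def)
  then have "l2_rep (l2_class M f) \<in> l2_class M f"
    unfolding l2_rep_def by (rule someI[of "\<lambda>h. h \<in> l2_class M f"])
  then show "l2_rep (l2_class M f) \<in> l2_functions M"
    and "AE x in M. l2_rep (l2_class M f) x = f x" by (auto simp: l2_class_def)
qed

lemma vecs_rep:
  assumes "u \<in> vecs (L2 M)"
  shows "l2_rep u \<in> l2_functions M" and "l2_class M (l2_rep u) = u"
proof -
  obtain f where f: "f \<in> l2_functions M" and u: "u = l2_class M f"
    using assms by (auto simp: L2_def)
  show "l2_rep u \<in> l2_functions M" unfolding u by (rule l2_rep_class[OF f])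
  then show "l2_class M (l2_rep u) = u"
    using l2_class_eq_iff[OF _ f] l2_rep_class(2)[OF f] u by blast
qed

text \<open>The source of the vector space laws below: each operation is almost everywhere the
  pointwise one on representatives, so an identity of vectors reduces to an identity of complex
  numbers.\<close>

lemma vecs_eqI:
  assumes "u \<in> vecs (L2 M)" "v \<in> vecs (L2 M)" "AE x in M. l2_rep u x = l2_rep v x"
  shows "u = v"
  using l2_class_eq_iff[OF vecs_rep(1)[OF assms(1)] vecs_rep(1)[OF assms(2)]]
    vecs_rep(2)[OF assms(1)] vecs_rep(2)[OF assms(2)] assms(3) by simp

lemma vadd_class:
  assumes f: "f \<in> l2_functions M" and g: "g \<in> l2_functions M"
  shows "vadd (L2 M) (l2_class M f) (l2_class M g) = l2_class M (\<lambda>x. f x + g x)"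
  unfolding L2_def inner_space.simps
proof (rule l2_class_cong_AE)
  show "AE x in M. l2_rep (l2_class M f) x + l2_rep (l2_class M g) x = f x + g x"
    using l2_rep_class(2)[OF f] l2_rep_class(2)[OF g] by eventually_elim simp
qed

lemma vscale_class:
  assumes f: "f \<in> l2_functions M"
  shows "vscale (L2 M) c (l2_class M f) = l2_class M (\<lambda>x. c * f x)"
  unfolding L2_def inner_space.simps
proof (rule l2_class_cong_AE)
  show "AE x in M. c * l2_rep (l2_class M f) x = c * f x"
    using l2_rep_class(2)[OF f] by eventually_elim simp
qed

lemma vdiff_class:
  assumes f: "f \<in> l2_functions M" and g: "g \<in> l2_functions M"
  shows "vdiff (L2 M) (l2_class M f) (l2_class M g) = l2_class M (\<lambda>x. f x - g x)"
  unfolding vdiff_def vscale_class[OF g] vadd_class[OF f l2_functions_scale[OF g]] by simp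

lemma vadd_vecs [intro]:
  "u \<in> vecs (L2 M) \<Longrightarrow> v \<in> vecs (L2 M) \<Longrightarrow> vadd (L2 M) u v \<in> vecs (L2 M)"
  and vscale_vecs [intro]: "u \<in> vecs (L2 M) \<Longrightarrow> vscale (L2 M) c u \<in> vecs (L2 M)"
  by (auto simp: L2_def intro!: imageI l2_functions_add l2_functions_scale l2_rep_class)

lemma vdiff_vecs [intro]:
  "u \<in> vecs (L2 M) \<Longrightarrow> v \<in> vecs (L2 M) \<Longrightarrow> vdiff (L2 M) u v \<in> vecs (L2 M)"
  unfolding vdiff_def by blast

lemma rep_vadd:
  assumes "u \<in> vecs (L2 M)" "v \<in> vecs (L2 M)"
  shows "AE x in M. l2_rep (vadd (L2 M) u v) x = l2_rep u x + l2_rep v x"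
  using l2_rep_class(2)[OF l2_functions_add[OF assms[THEN vecs_rep(1)]]] by (simp add: L2_def)

lemma rep_vscale:
  assumes "u \<in> vecs (L2 M)"
  shows "AE x in M. l2_rep (vscale (L2 M) c u) x = c * l2_rep u x"
  using l2_rep_class(2)[OF l2_functions_scale[OF assms[THEN vecs_rep(1)]]] by (simp add: L2_def)

lemma rep_vdiff:
  assumes "u \<in> vecs (L2 M)" "v \<in> vecs (L2 M)"
  shows "AE x in M. l2_rep (vdiff (L2 M) u v) x = l2_rep u x - l2_rep v x"
  unfolding vdiff_def
  using rep_vadd[OF assms(1) vscale_vecs[OF assms(2)], of "-1"] rep_vscale[OF assms(2), of "-1"]
  by eventually_elim simp

section \<open>Inner product, norm and the Cauchy-Schwarz inequality\<close>

lemma vinner_rep: "vinner (L2 M) u v = (LINT x|M. cnj (l2_rep u x) * l2_rep v x)"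
  by (simp add: L2_def)

lemma vinner_class:
  assumes f: "f \<in> l2_functions M" and g: "g \<in> l2_functions M"
  shows "vinner (L2 M) (l2_class M f) (l2_class M g) = (LINT x|M. cnj (f x) * g x)"
proof -
  note [measurable] = l2_functionsD(1)[OF f] l2_functionsD(1)[OF g]
    l2_functionsD(1)[OF l2_rep_class(1)[OF f]] l2_functionsD(1)[OF l2_rep_class(1)[OF g]]
  show ?thesis unfolding vinner_rep
  proof (rule integral_cong_AE)
    show "AE x in M. cnj (l2_rep (l2_class M f) x) * l2_rep (l2_class M g) x = cnj (f x) * g x"
      using l2_rep_class(2)[OF f] l2_rep_class(2)[OF g] by eventually_elim simp
  qed measurable
qed

lemma cmod_prod_le_squares: "cmod a * cmod b \<le> (cmod a)\<^sup>2 + (cmod b)\<^sup>2"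
proof -
  have "2 * (cmod a * cmod b) \<le> (cmod a)\<^sup>2 + (cmod b)\<^sup>2"
    using zero_le_power2[of "cmod a - cmod b"] by (simp add: power2_eq_square algebra_simps)
  moreover have "0 \<le> cmod a * cmod b" by simp
  ultimately show ?thesis by linarith
qed

lemma l2_prod_integrable:
  assumes f: "f \<in> l2_functions M" and g: "g \<in> l2_functions M"
  shows "integrable M (\<lambda>x. cnj (f x) * g x)"
proof (rule Bochner_Integration.integrable_bound)
  note [measurable] = l2_functionsD(1)[OF f] l2_functionsD(1)[OF g]
  show "integrable M (\<lambda>x. (cmod (f x))\<^sup>2 + (cmod (g x))\<^sup>2)"
    using l2_functionsD(2)[OF f] l2_functionsD(2)[OF g] by simp
  show "(\<lambda>x. cnj (f x) * g x) \<in> borel_measurable M" by measurable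
  show "AE x in M. norm (cnj (f x) * g x) \<le> norm ((cmod (f x))\<^sup>2 + (cmod (g x))\<^sup>2)"
    using cmod_prod_le_squares by (auto simp: norm_mult intro!: AE_I2)
qed

lemma l2_inner_self:
  "(LINT x|M. cnj (f x) * f x) = complex_of_real (LINT x|M. (cmod (f x))\<^sup>2)"
  unfolding integral_complex_of_real[symmetric]
  by (intro Bochner_Integration.integral_cong refl) (metis complex_norm_square mult.commute)

lemma vinner_self: "vinner (L2 M) u u = complex_of_real ((vnorm (L2 M) u)\<^sup>2)"
  unfolding vnorm_def vinner_rep l2_inner_self by simp

lemma vnorm_rep: "vnorm (L2 M) u = sqrt (LINT x|M. (cmod (l2_rep u x))\<^sup>2)"
  unfolding vnorm_def vinner_rep l2_inner_self by simp

lemma vnorm_nonneg: "0 \<le> vnorm (L2 M) u"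
  unfolding vnorm_rep by simp

lemma vnorm_class:
  assumes f: "f \<in> l2_functions M"
  shows "vnorm (L2 M) (l2_class M f) = sqrt (LINT x|M. (cmod (f x))\<^sup>2)"
  unfolding vnorm_def vinner_class[OF f f] l2_inner_self by simp

lemma vinner_cnj: "vinner (L2 M) v u = cnj (vinner (L2 M) u v)"
  unfolding vinner_rep complex_cnj_mult[symmetric]
  using Bochner_Integration.integral_cnj[of M "\<lambda>x. cnj (l2_rep u x) * l2_rep v x"] by (simp add: mult.commute)

lemma vinner_cong_AE:
  assumes "u \<in> vecs (L2 M)" "v \<in> vecs (L2 M)"
    and "g \<in> borel_measurable M" "AE x in M. cnj (l2_rep u x) * l2_rep v x = g x"
  shows "vinner (L2 M) u v = (LINT x|M. g x)"
proof -
  note [measurable] = assms(3) assms(1)[THEN vecs_rep(1), THEN l2_functionsD(1)]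
    assms(2)[THEN vecs_rep(1), THEN l2_functionsD(1)]
  show ?thesis unfolding vinner_rep using assms(4) by (intro integral_cong_AE) measurable
qed

lemma vinner_vadd_right:
  assumes u: "u \<in> vecs (L2 M)" and v: "v \<in> vecs (L2 M)" and w: "w \<in> vecs (L2 M)"
  shows "vinner (L2 M) u (vadd (L2 M) v w) = vinner (L2 M) u v + vinner (L2 M) u w"
proof -
  note [measurable] = u[THEN vecs_rep(1), THEN l2_functionsD(1)]
    v[THEN vecs_rep(1), THEN l2_functionsD(1)] w[THEN vecs_rep(1), THEN l2_functionsD(1)]
  have "vinner (L2 M) u (vadd (L2 M) v w)
      = (LINT x|M. cnj (l2_rep u x) * l2_rep v x + cnj (l2_rep u x) * l2_rep w x)"
  proof (rule vinner_cong_AE[OF u vadd_vecs[OF v w]])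
    show "AE x in M. cnj (l2_rep u x) * l2_rep (vadd (L2 M) v w) x
        = cnj (l2_rep u x) * l2_rep v x + cnj (l2_rep u x) * l2_rep w x"
      using rep_vadd[OF v w] by eventually_elim (simp add: algebra_simps)
  qed measurable
  then show ?thesis
    unfolding vinner_rep
    by (simp add: Bochner_Integration.integral_add l2_prod_integrable vecs_rep u v w)
qed

lemma vinner_vscale_right:
  assumes u: "u \<in> vecs (L2 M)" and v: "v \<in> vecs (L2 M)"
  shows "vinner (L2 M) u (vscale (L2 M) c v) = c * vinner (L2 M) u v"
proof -
  note [measurable] = u[THEN vecs_rep(1), THEN l2_functionsD(1)]
    v[THEN vecs_rep(1), THEN l2_functionsD(1)]
  have "vinner (L2 M) u (vscale (L2 M) c v) = (LINT x|M. c * (cnj (l2_rep u x) * l2_rep v x))"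
  proof (rule vinner_cong_AE[OF u vscale_vecs[OF v]])
    show "AE x in M. cnj (l2_rep u x) * l2_rep (vscale (L2 M) c v) x
        = c * (cnj (l2_rep u x) * l2_rep v x)"
      using rep_vscale[OF v, of c] by eventually_elim simp
  qed measurable
  then show ?thesis unfolding vinner_rep by simp
qed

lemma vinner_vdiff_right:
  assumes "u \<in> vecs (L2 M)" "v \<in> vecs (L2 M)" "w \<in> vecs (L2 M)"
  shows "vinner (L2 M) u (vdiff (L2 M) v w) = vinner (L2 M) u v - vinner (L2 M) u w"
  unfolding vdiff_def using assms by (simp add: vinner_vadd_right vinner_vscale_right vscale_vecs)

lemma vnorm_eq_0_iff:
  assumes u: "u \<in> vecs (L2 M)"
  shows "vnorm (L2 M) u = 0 \<longleftrightarrow> (AE x in M. l2_rep u x = 0)"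
  unfolding vnorm_rep real_sqrt_eq_0_iff
  using integral_nonneg_eq_0_iff_AE[OF l2_functionsD(2)[OF vecs_rep(1)[OF u]]] by simp

text \<open>The inequality for nonnegative extended integrals is applied to the moduli. All
  integrals involved are finite, so it can be read in the reals, and the modulus of the inner
  product is at most the integral of the product of the moduli.\<close>

lemma cauchy_schwarz_l2:
  assumes u: "u \<in> vecs (L2 M)" and v: "v \<in> vecs (L2 M)"
  shows "cmod (vinner (L2 M) u v) \<le> vnorm (L2 M) u * vnorm (L2 M) v"
proof -
  let ?f = "\<lambda>x. cmod (l2_rep u x)" and ?g = "\<lambda>x. cmod (l2_rep v x)"
  note [measurable] = u[THEN vecs_rep(1), THEN l2_functionsD(1)]
    v[THEN vecs_rep(1), THEN l2_functionsD(1)]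
  have if2: "integrable M (\<lambda>x. (?f x)\<^sup>2)" and ig2: "integrable M (\<lambda>x. (?g x)\<^sup>2)"
    using u v by (simp_all add: l2_functionsD(2) vecs_rep)
  have ifg: "integrable M (\<lambda>x. ?f x * ?g x)"
    using integrable_norm[OF l2_prod_integrable[OF u[THEN vecs_rep(1)] v[THEN vecs_rep(1)]]]
    by (simp add: norm_mult)
  have "(\<integral>\<^sup>+x. ennreal (?f x) * ennreal (?g x) \<partial>M) = ennreal (LINT x|M. ?f x * ?g x)"
    using nn_integral_eq_integral[OF ifg] by (simp add: ennreal_mult)
  then have "ennreal ((LINT x|M. ?f x * ?g x)\<^sup>2) = (\<integral>\<^sup>+x. ennreal (?f x) * ennreal (?g x) \<partial>M)\<^sup>2"
    by (simp add: ennreal_power)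
  also have "\<dots> \<le> (\<integral>\<^sup>+x. (ennreal (?f x))\<^sup>2 \<partial>M) * (\<integral>\<^sup>+x. (ennreal (?g x))\<^sup>2 \<partial>M)"
    by (rule Cauchy_Schwarz_nn_integral) measurable
  also have "\<dots> = ennreal ((LINT x|M. (?f x)\<^sup>2) * (LINT x|M. (?g x)\<^sup>2))"
    using if2 ig2 by (simp add: ennreal_power nn_integral_eq_integral ennreal_mult)
  finally have "(LINT x|M. ?f x * ?g x)\<^sup>2 \<le> (LINT x|M. (?f x)\<^sup>2) * (LINT x|M. (?g x)\<^sup>2)"
    by (subst (asm) ennreal_le_iff) auto
  then have "(LINT x|M. ?f x * ?g x) \<le> vnorm (L2 M) u * vnorm (L2 M) v"
    unfolding vnorm_rep real_sqrt_mult[symmetric] by (rule real_le_rsqrt)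
  moreover have "cmod (vinner (L2 M) u v) \<le> (LINT x|M. ?f x * ?g x)"
    unfolding vinner_rep using integral_norm_bound[of M "\<lambda>x. cnj (l2_rep u x) * l2_rep v x"]
    by (simp add: norm_mult)
  ultimately show ?thesis by simp
qed

lemma vnorm_vscale:
  assumes "u \<in> vecs (L2 M)"
  shows "vnorm (L2 M) (vscale (L2 M) c u) = cmod c * vnorm (L2 M) u"
proof -
  have "vscale (L2 M) c u = l2_class M (\<lambda>x. c * l2_rep u x)" by (simp add: L2_def)
  then show ?thesis
    using vnorm_class[OF l2_functions_scale[OF vecs_rep(1)[OF assms]]]
    by (simp add: vnorm_rep norm_mult power_mult_distrib real_sqrt_mult)
qed

lemma vnorm_triangle:
  assumes u: "u \<in> vecs (L2 M)" and v: "v \<in> vecs (L2 M)"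
  shows "vnorm (L2 M) (vadd (L2 M) u v) \<le> vnorm (L2 M) u + vnorm (L2 M) v"
proof -
  have uv: "vadd (L2 M) u v \<in> vecs (L2 M)" using u v by blast
  let ?H = "L2 M"
  have *: "vinner ?H (vadd ?H u v) w = vinner ?H u w + vinner ?H v w" if w: "w \<in> vecs ?H" for w
    using arg_cong[OF vinner_vadd_right[OF w u v], of cnj]
    unfolding complex_cnj_add vinner_cnj[symmetric] .
  have "vinner ?H (vadd ?H u v) (vadd ?H u v)
      = vinner ?H u u + vinner ?H v v + vinner ?H u v + cnj (vinner ?H u v)"
    unfolding vinner_vadd_right[OF uv u v] *[OF u] *[OF v] vinner_cnj[of M v u] by simp
  then have "complex_of_real ((vnorm ?H (vadd ?H u v))\<^sup>2)
      = complex_of_real ((vnorm ?H u)\<^sup>2 + (vnorm ?H v)\<^sup>2 + 2 * Re (vinner ?H u v))"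
    unfolding vinner_self by (simp add: complex_eq_iff)
  then have "(vnorm ?H (vadd ?H u v))\<^sup>2 = (vnorm ?H u)\<^sup>2 + (vnorm ?H v)\<^sup>2 + 2 * Re (vinner ?H u v)"
    by (simp only: of_real_eq_iff)
  also have "\<dots> \<le> (vnorm ?H u + vnorm ?H v)\<^sup>2"
    using order_trans[OF complex_Re_le_cmod cauchy_schwarz_l2[OF u v]]
    by (simp add: power2_eq_square algebra_simps)
  finally show ?thesis
    using vnorm_nonneg by (intro power2_le_imp_le[OF _ add_nonneg_nonneg])
qed

lemma vdiff_add_add:
  assumes "u \<in> vecs (L2 M)" "v \<in> vecs (L2 M)" "u' \<in> vecs (L2 M)" "v' \<in> vecs (L2 M)"
  shows "vdiff (L2 M) (vadd (L2 M) u v) (vadd (L2 M) u' v')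
    = vadd (L2 M) (vdiff (L2 M) u u') (vdiff (L2 M) v v')"
proof (rule vecs_eqI)
  show "AE x in M. l2_rep (vdiff (L2 M) (vadd (L2 M) u v) (vadd (L2 M) u' v')) x =
      l2_rep (vadd (L2 M) (vdiff (L2 M) u u') (vdiff (L2 M) v v')) x"
    using rep_vdiff[OF vadd_vecs[OF assms(1,2)] vadd_vecs[OF assms(3,4)]]
      rep_vadd[OF vdiff_vecs[OF assms(1,3)] vdiff_vecs[OF assms(2,4)]]
      rep_vadd[OF assms(1,2)] rep_vadd[OF assms(3,4)] rep_vdiff[OF assms(1,3)]
      rep_vdiff[OF assms(2,4)]
    by eventually_elim (simp only: right_diff_distrib add_diff_eq diff_add_eq diff_diff_eq2 diff_diff_eq)
qed (use assms in blast)+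

lemma vdiff_vscale:
  assumes "u \<in> vecs (L2 M)" "v \<in> vecs (L2 M)"
  shows "vdiff (L2 M) (vscale (L2 M) c u) (vscale (L2 M) c v) = vscale (L2 M) c (vdiff (L2 M) u v)"
proof (rule vecs_eqI)
  show "AE x in M. l2_rep (vdiff (L2 M) (vscale (L2 M) c u) (vscale (L2 M) c v)) x =
      l2_rep (vscale (L2 M) c (vdiff (L2 M) u v)) x"
    using rep_vdiff[OF vscale_vecs[OF assms(1)] vscale_vecs[OF assms(2)], of c c]
      rep_vscale[OF vdiff_vecs[OF assms], of c]
      rep_vscale[OF assms(1), of c] rep_vscale[OF assms(2), of c] rep_vdiff[OF assms]
    by eventually_elim (simp only: right_diff_distrib add_diff_eq diff_add_eq diff_diff_eq2 diff_diff_eq)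
qed (use assms in blast)+

lemma vadd_vdiff:
  assumes "u \<in> vecs (L2 M)" "v \<in> vecs (L2 M)" "w \<in> vecs (L2 M)"
  shows "vadd (L2 M) (vdiff (L2 M) u v) (vdiff (L2 M) v w) = vdiff (L2 M) u w"
proof (rule vecs_eqI)
  show "AE x in M. l2_rep (vadd (L2 M) (vdiff (L2 M) u v) (vdiff (L2 M) v w)) x =
      l2_rep (vdiff (L2 M) u w) x"
    using rep_vadd[OF vdiff_vecs[OF assms(1,2)] vdiff_vecs[OF assms(2,3)]]
      rep_vdiff[OF assms(1,2)] rep_vdiff[OF assms(2,3)] rep_vdiff[OF assms(1,3)]
    by eventually_elim simp
qed (use assms in blast)+

section \<open>Closed subspaces\<close>

lemma vdiff_self_norm:
  assumes "u \<in> vecs (L2 M)" shows "vnorm (L2 M) (vdiff (L2 M) u u) = 0"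
  using rep_vdiff[OF assms assms] vnorm_eq_0_iff[OF vdiff_vecs[OF assms assms]] by simp

lemma subset_vclosure: "S \<subseteq> vecs (L2 M) \<Longrightarrow> S \<subseteq> vclosure (L2 M) S"
proof
  fix x assume "S \<subseteq> vecs (L2 M)" "x \<in> S"
  then have "x \<in> vecs (L2 M)" "vnorm (L2 M) (vdiff (L2 M) x x) = 0" using vdiff_self_norm by auto
  then show "x \<in> vclosure (L2 M) S" using \<open>x \<in> S\<close> by (auto simp: vclosure_def intro!: bexI[of _ x])
qed

lemma vclosureE:
  assumes "x \<in> vclosure H S" "e > 0"
  obtains y where "y \<in> S" "vnorm H (vdiff H x y) < e"
  using assms unfolding vclosure_def by blast

lemma vclosure_mono: "S \<subseteq> S' \<Longrightarrow> vclosure H S \<subseteq> vclosure H S'"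
  unfolding vclosure_def by blast

lemma closed_subspaceI:
  assumes V: "lin_subspace (L2 M) V"
    and cl: "\<And>x. x \<in> vclosure (L2 M) V \<Longrightarrow> x \<in> V"
  shows "closed_subspace (L2 M) V"
proof -
  have "V \<subseteq> vecs (L2 M)" using V by (simp add: lin_subspace_def)
  then show ?thesis
    unfolding closed_subspace_def using V cl subset_vclosure by blast
qed

lemma closed_subspace_vclosure:
  assumes V: "lin_subspace (L2 M) V"
  shows "closed_subspace (L2 M) (vclosure (L2 M) V)"
proof (rule closed_subspaceI)
  let ?H = "L2 M"
  have VH: "V \<subseteq> vecs ?H" and ne: "V \<noteq> {}"
    and add: "\<And>x y. x \<in> V \<Longrightarrow> y \<in> V \<Longrightarrow> vadd ?H x y \<in> V"
    and sc: "\<And>c x. x \<in> V \<Longrightarrow> vscale ?H c x \<in> V"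
    using V by (auto simp: lin_subspace_def)
  show "lin_subspace ?H (vclosure ?H V)"
    unfolding lin_subspace_def
  proof (intro conjI ballI allI)
    show "vclosure ?H V \<subseteq> vecs ?H" by (auto simp: vclosure_def)
    show "vclosure ?H V \<noteq> {}" using subset_vclosure[OF VH] ne by blast
    show "vadd ?H x y \<in> vclosure ?H V" if "x \<in> vclosure ?H V" "y \<in> vclosure ?H V" for x y
    proof -
      have xy: "x \<in> vecs ?H" "y \<in> vecs ?H" using that by (auto simp: vclosure_def)
      have "\<exists>z\<in>V. vnorm ?H (vdiff ?H (vadd ?H x y) z) < e" if "e > 0" for e
      proof -
        obtain x' where x': "x' \<in> V" "vnorm ?H (vdiff ?H x x') < e/2"
          using vclosureE[OF \<open>x \<in> vclosure ?H V\<close> half_gt_zero[OF \<open>e > 0\<close>]] .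
        obtain y' where y': "y' \<in> V" "vnorm ?H (vdiff ?H y y') < e/2"
          using vclosureE[OF \<open>y \<in> vclosure ?H V\<close> half_gt_zero[OF \<open>e > 0\<close>]] .
        have H': "x' \<in> vecs ?H" "y' \<in> vecs ?H" using x' y' VH by auto
        have "vnorm ?H (vdiff ?H (vadd ?H x y) (vadd ?H x' y')) < e"
          using vnorm_triangle[OF vdiff_vecs[OF xy(1) H'(1)] vdiff_vecs[OF xy(2) H'(2)]] x'(2) y'(2)
          unfolding vdiff_add_add[OF xy H'] by simp
        with add[OF x'(1) y'(1)] show ?thesis by blast
      qed
      then show ?thesis using xy by (auto simp: vclosure_def)
    qed
    show "vscale ?H c x \<in> vclosure ?H V" if "x \<in> vclosure ?H V" for c x
    proof -
      have x: "x \<in> vecs ?H" using that by (auto simp: vclosure_def)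
      have "\<exists>z\<in>V. vnorm ?H (vdiff ?H (vscale ?H c x) z) < e" if "e > 0" for e
      proof -
        \<comment> \<open>The added 1 keeps the radius finite and positive for c = 0 and makes |c| e
          / (|c| + 1) strictly smaller than e.\<close>
        have pos: "e / (cmod c + 1) > 0" using \<open>e > 0\<close> by (simp add: add_nonneg_pos)
        then obtain x' where x': "x' \<in> V" "vnorm ?H (vdiff ?H x x') < e / (cmod c + 1)"
          using vclosureE[OF \<open>x \<in> vclosure ?H V\<close>] by blast
        have x'H: "x' \<in> vecs ?H" using x' VH by blast
        have "cmod c * vnorm ?H (vdiff ?H x x') \<le> cmod c * (e / (cmod c + 1))"
          using x' by (intro mult_left_mono) auto
        also have "\<dots> < e"
          using \<open>e > 0\<close> by (simp add: field_simps add_pos_nonneg)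
        finally have "vnorm ?H (vdiff ?H (vscale ?H c x) (vscale ?H c x')) < e"
          using vdiff_vscale[OF x x'H, of c] vnorm_vscale[OF vdiff_vecs[OF x x'H], of c] by simp
        with sc[OF x'(1)] show ?thesis by blast
      qed
      then show ?thesis using x by (auto simp: vclosure_def)
    qed
  qed
  show "x \<in> vclosure ?H V" if x: "x \<in> vclosure ?H (vclosure ?H V)" for x
  proof -
    have xH: "x \<in> vecs ?H" using x by (simp add: vclosure_def)
    have "\<exists>z\<in>V. vnorm ?H (vdiff ?H x z) < e" if "e > 0" for e
    proof -
      obtain y where y: "y \<in> vclosure ?H V" "vnorm ?H (vdiff ?H x y) < e/2"
        using vclosureE[OF x half_gt_zero[OF \<open>e > 0\<close>]] .
      obtain z where z: "z \<in> V" "vnorm ?H (vdiff ?H y z) < e/2"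
        using vclosureE[OF y(1) half_gt_zero[OF \<open>e > 0\<close>]] .
      have yz: "y \<in> vecs ?H" "z \<in> vecs ?H" using y z VH by (auto simp: vclosure_def)
      have "vnorm ?H (vdiff ?H x z) < e"
        using vnorm_triangle[OF vdiff_vecs[OF xH yz(1)] vdiff_vecs[OF yz]] y(2) z(2)
        unfolding vadd_vdiff[OF xH yz] by simp
      with z(1) show ?thesis by blast
    qed
    then show ?thesis using xH by (simp add: vclosure_def)
  qed
qed

lemma zero_in_subspace:
  assumes "lin_subspace (L2 M) V"
  shows "l2_class M (\<lambda>x. 0) \<in> V"
proof -
  obtain u where u: "u \<in> V" "u \<in> vecs (L2 M)" using assms by (auto simp: lin_subspace_def)
  have "vscale (L2 M) 0 u \<in> V" using assms u by (auto simp: lin_subspace_def)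
  then show ?thesis by (simp add: L2_def)
qed

text \<open>The label cuts the space into countably many measurable pieces. The restriction of f to
  labels below n is a finite sum of pieces, and these restrictions tend to f in norm by dominated
  convergence with majorant \<open>|f|\<^sup>2\<close>. The two density results, for
  \<open>\<ell>\<^sup>2\<close> of a countable set and for layers, differ only in the choice of
  label.\<close>

lemma closed_subspace_level_sets:
  fixes lab :: "'i \<Rightarrow> nat"
  assumes W: "closed_subspace (L2 M) W" and f: "f \<in> l2_functions M"
    and lab [measurable]: "lab \<in> measurable M (count_space UNIV)"
    and pieces: "\<And>n. l2_class M (\<lambda>x. f x * of_bool (lab x = n)) \<in> W"
  shows "l2_class M f \<in> W"
proof -
  note [measurable] = l2_functionsD(1)[OF f]
  have lin: "lin_subspace (L2 M) W" and cl: "vclosure (L2 M) W = W"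
    using W by (auto simp: closed_subspace_def)
  have l2: "(\<lambda>x. f x * of_bool (P (lab x))) \<in> l2_functions M" for P :: "nat \<Rightarrow> bool"
    by (rule l2_functions_bound[OF f, where K = 1]) (auto simp: norm_mult)
  define g where "g n x = f x * of_bool (lab x < n)" for n x
  have gl2: "g n \<in> l2_functions M" for n unfolding g_def by (rule l2)
  have gW: "l2_class M (g n) \<in> W" for n
  proof (induction n)
    case 0
    show ?case unfolding g_def using zero_in_subspace[OF lin] by simp
  next
    case (Suc n)
    have "vadd (L2 M) (l2_class M (g n)) (l2_class M (\<lambda>x. f x * of_bool (lab x = n))) \<in> W"
      using lin Suc pieces unfolding lin_subspace_def by blast
    moreover have "(\<lambda>x. g n x + f x * of_bool (lab x = n)) = g (Suc n)"
      by (auto simp: g_def less_Suc_eq)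
    ultimately show ?case
      by (subst (asm) vadd_class[OF gl2 l2]) simp
  qed
  have lim: "(\<lambda>n. LINT x|M. (cmod (f x - g n x))\<^sup>2) \<longlonglongrightarrow> (LINT x|M. 0)"
  proof (rule integral_dominated_convergence[where w = "\<lambda>x. (cmod (f x))\<^sup>2"])
    show "integrable M (\<lambda>x. (cmod (f x))\<^sup>2)" by (rule l2_functionsD(2)[OF f])
    show "(\<lambda>x. (cmod (f x - g n x))\<^sup>2) \<in> borel_measurable M" for n
      using l2_functionsD(1)[OF gl2] by measurable
    show "AE x in M. norm ((cmod (f x - g n x))\<^sup>2) \<le> (cmod (f x))\<^sup>2" for n
      by (auto simp: g_def)
    show "AE x in M. (\<lambda>n. (cmod (f x - g n x))\<^sup>2) \<longlonglongrightarrow> 0"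
    proof (rule AE_I2)
      fix x
      \<comment> \<open>At a fixed point the error is exactly zero as soon as n exceeds the label of
        that point.\<close>
      have "eventually (\<lambda>n. (cmod (f x - g n x))\<^sup>2 = 0) sequentially"
        using eventually_gt_at_top[of "lab x"] by eventually_elim (simp add: g_def)
      then show "(\<lambda>n. (cmod (f x - g n x))\<^sup>2) \<longlonglongrightarrow> 0" by (rule tendsto_eventually)
    qed
  qed simp
  have "l2_class M f \<in> vclosure (L2 M) W"
    unfolding vclosure_def
  proof (intro CollectI conjI allI impI)
    show "l2_class M f \<in> vecs (L2 M)" using f by blast
    fix e :: real assume "e > 0"
    then have "\<forall>\<^sub>F n in sequentially. (LINT x|M. (cmod (f x - g n x))\<^sup>2) < e\<^sup>2"
      using lim by (intro order_tendstoD) auto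
    then obtain n where "(LINT x|M. (cmod (f x - g n x))\<^sup>2) < e\<^sup>2"
      by (auto simp: eventually_sequentially)
    then have "vnorm (L2 M) (vdiff (L2 M) (l2_class M f) (l2_class M (g n))) < e"
      using \<open>e > 0\<close> unfolding vdiff_class[OF f gl2] vnorm_class[OF l2_functions_diff[OF f gl2]]
      by (intro real_less_lsqrt) auto
    then show "\<exists>y\<in>W. vnorm (L2 M) (vdiff (L2 M) (l2_class M f) y) < e" using gW by blast
  qed
  then show ?thesis using cl by simp
qed

section \<open>Operators on \<open>L\<^sup>2(M)\<close>\<close>

lemma bounded_opsI:
  assumes "linear_op H a" "\<And>x. x \<in> vecs H \<Longrightarrow> vnorm H (a x) \<le> K * vnorm H x"
  shows "a \<in> bounded_ops H"
  using assms by (auto simp: bounded_ops_def)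

lemma bounded_opsD:
  assumes "a \<in> bounded_ops H"
  shows "a \<in> vecs H \<rightarrow>\<^sub>E vecs H" "\<And>x. x \<in> vecs H \<Longrightarrow> a x \<in> vecs H"
    "\<And>x y. x \<in> vecs H \<Longrightarrow> y \<in> vecs H \<Longrightarrow> a (vadd H x y) = vadd H (a x) (a y)"
    "\<And>c x. x \<in> vecs H \<Longrightarrow> a (vscale H c x) = vscale H c (a x)"
  using assms by (auto simp: bounded_ops_def linear_op_def)

lemma bounded_ops_bound:
  assumes "a \<in> bounded_ops (L2 M)"
  obtains K where "K > 0" "\<And>x. x \<in> vecs (L2 M) \<Longrightarrow> vnorm (L2 M) (a x) \<le> K * vnorm (L2 M) x"
proof -
  obtain K where K: "\<And>x. x \<in> vecs (L2 M) \<Longrightarrow> vnorm (L2 M) (a x) \<le> K * vnorm (L2 M) x"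
    using assms by (auto simp: bounded_ops_def)
  show thesis
  \<comment> \<open>The constant in \<open>bounded_ops\<close> may be zero or negative; the shift
    makes it positive, so that later estimates can multiply by it.\<close>
  proof (rule that[of "\<bar>K\<bar> + 1"])
    fix x assume "x \<in> vecs (L2 M)"
    have "K * vnorm (L2 M) x \<le> (\<bar>K\<bar> + 1) * vnorm (L2 M) x"
      by (intro mult_right_mono vnorm_nonneg) auto
    with K[OF \<open>x \<in> vecs (L2 M)\<close>] show "vnorm (L2 M) (a x) \<le> (\<bar>K\<bar> + 1) * vnorm (L2 M) x" by simp
  qed simp
qed

lemma op_eqI:
  assumes "a \<in> vecs H \<rightarrow>\<^sub>E vecs H" "b \<in> vecs H \<rightarrow>\<^sub>E vecs H" "\<And>x. x \<in> vecs H \<Longrightarrow> a x = b x"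
  shows "a = b"
  using assms by (intro PiE_ext[of a "vecs H" "\<lambda>_. vecs H"]) auto

text \<open>Testing with y = u - v shows that u - v has norm zero.\<close>

lemma vinner_eqI:
  assumes u: "u \<in> vecs (L2 M)" and v: "v \<in> vecs (L2 M)"
    and eq: "\<And>y. y \<in> vecs (L2 M) \<Longrightarrow> vinner (L2 M) u y = vinner (L2 M) v y"
  shows "u = v"
proof (rule vecs_eqI[OF u v])
  let ?d = "vdiff (L2 M) u v"
  have d: "?d \<in> vecs (L2 M)" using u v by blast
  have "vinner (L2 M) ?d u = vinner (L2 M) ?d v"
    using eq[OF d] vinner_cnj[of M ?d u] vinner_cnj[of M ?d v] by simp
  then have "vinner (L2 M) ?d ?d = 0" using vinner_vdiff_right[OF d u v] by simp
  then have "vnorm (L2 M) ?d = 0" by (simp add: vinner_self)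
  then have "AE x in M. l2_rep ?d x = 0" using vnorm_eq_0_iff[OF d] by simp
  with rep_vdiff[OF u v] show "AE x in M. l2_rep u x = l2_rep v x" by eventually_elim simp
qed

text \<open>\<open>op_adj\<close> is a definite description and acquires a value only once a
  candidate is exhibited. Uniqueness is \<open>vinner_eqI\<close> on the carrier together with
  extensionality off it.\<close>

lemma op_adj_eqI:
  assumes b: "b \<in> bounded_ops (L2 M)"
    and adj: "\<And>x y. x \<in> vecs (L2 M) \<Longrightarrow> y \<in> vecs (L2 M)
      \<Longrightarrow> vinner (L2 M) (b x) y = vinner (L2 M) x (a y)"
  shows "op_adj (L2 M) a = b"
  unfolding op_adj_def
proof (rule the_equality)
  show "b \<in> bounded_ops (L2 M) \<and>
      (\<forall>x\<in>vecs (L2 M). \<forall>y\<in>vecs (L2 M). vinner (L2 M) (b x) y = vinner (L2 M) x (a y))"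
    using b adj by blast
next
  fix b' assume b': "b' \<in> bounded_ops (L2 M) \<and>
      (\<forall>x\<in>vecs (L2 M). \<forall>y\<in>vecs (L2 M). vinner (L2 M) (b' x) y = vinner (L2 M) x (a y))"
  show "b' = b"
  proof (rule op_eqI[where H = "L2 M"])
    fix x assume x: "x \<in> vecs (L2 M)"
    show "b' x = b x"
    proof (rule vinner_eqI)
      show "b' x \<in> vecs (L2 M)" "b x \<in> vecs (L2 M)" using b b' x by (auto intro: bounded_opsD(2))
      show "vinner (L2 M) (b' x) y = vinner (L2 M) (b x) y" if "y \<in> vecs (L2 M)" for y
        unfolding adj[OF x that] using b' x that by blast
    qed
  qed (use b b' bounded_opsD(1) in blast)+
qed

lemma op_mult_bounded:
  assumes a: "a \<in> bounded_ops (L2 M)" and b: "b \<in> bounded_ops (L2 M)"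
  shows "op_mult (L2 M) a b \<in> bounded_ops (L2 M)"
proof -
  obtain K where K: "K > 0" "\<And>x. x \<in> vecs (L2 M) \<Longrightarrow> vnorm (L2 M) (a x) \<le> K * vnorm (L2 M) x"
    using bounded_ops_bound[OF a] by blast
  obtain L where L: "L > 0" "\<And>x. x \<in> vecs (L2 M) \<Longrightarrow> vnorm (L2 M) (b x) \<le> L * vnorm (L2 M) x"
    using bounded_ops_bound[OF b] by blast
  show ?thesis
  proof (rule bounded_opsI[where K = "K * L"])
    show "linear_op (L2 M) (op_mult (L2 M) a b)"
      using bounded_opsD[OF a] bounded_opsD[OF b]
      by (auto simp: linear_op_def op_mult_def vadd_vecs vscale_vecs)
    fix x assume x: "x \<in> vecs (L2 M)"
    then have "b x \<in> vecs (L2 M)" using bounded_opsD[OF b] by simp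
    then have "vnorm (L2 M) (a (b x)) \<le> K * vnorm (L2 M) (b x)" by (rule K)
    also have "\<dots> \<le> K * (L * vnorm (L2 M) x)" using K L x by (intro mult_left_mono) auto
    finally show "vnorm (L2 M) (op_mult (L2 M) a b x) \<le> K * L * vnorm (L2 M) x"
      using x by (simp add: op_mult_def mult.assoc)
  qed
qed

lemma vadd_ac:
  assumes "u \<in> vecs (L2 M)" "v \<in> vecs (L2 M)" "u' \<in> vecs (L2 M)" "v' \<in> vecs (L2 M)"
  shows "vadd (L2 M) (vadd (L2 M) u v) (vadd (L2 M) u' v')
    = vadd (L2 M) (vadd (L2 M) u u') (vadd (L2 M) v v')"
proof (rule vecs_eqI)
  show "AE x in M. l2_rep (vadd (L2 M) (vadd (L2 M) u v) (vadd (L2 M) u' v')) x =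
      l2_rep (vadd (L2 M) (vadd (L2 M) u u') (vadd (L2 M) v v')) x"
    using rep_vadd[OF vadd_vecs[OF assms(1,2)] vadd_vecs[OF assms(3,4)]]
      rep_vadd[OF vadd_vecs[OF assms(1,3)] vadd_vecs[OF assms(2,4)]]
      rep_vadd[OF assms(1,2)] rep_vadd[OF assms(3,4)] rep_vadd[OF assms(1,3)]
      rep_vadd[OF assms(2,4)]
    by eventually_elim (simp only: ac_simps)
qed (use assms in blast)+

lemma vscale_vadd:
  assumes "u \<in> vecs (L2 M)" "v \<in> vecs (L2 M)"
  shows "vscale (L2 M) c (vadd (L2 M) u v) = vadd (L2 M) (vscale (L2 M) c u) (vscale (L2 M) c v)"
proof (rule vecs_eqI)
  show "AE x in M. l2_rep (vscale (L2 M) c (vadd (L2 M) u v)) x =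
      l2_rep (vadd (L2 M) (vscale (L2 M) c u) (vscale (L2 M) c v)) x"
    using rep_vadd[OF vscale_vecs[OF assms(1)] vscale_vecs[OF assms(2)], of c c]
      rep_vscale[OF vadd_vecs[OF assms], of c]
      rep_vscale[OF assms(1), of c] rep_vscale[OF assms(2), of c] rep_vadd[OF assms]
    by eventually_elim (simp only: distrib_left)
qed (use assms in blast)+

lemma vscale_vscale:
  assumes "u \<in> vecs (L2 M)"
  shows "vscale (L2 M) c (vscale (L2 M) d u) = vscale (L2 M) (c * d) u"
proof (rule vecs_eqI)
  show "AE x in M. l2_rep (vscale (L2 M) c (vscale (L2 M) d u)) x
      = l2_rep (vscale (L2 M) (c * d) u) x"
    using rep_vscale[OF vscale_vecs[OF assms], of c d] rep_vscale[OF assms, of d]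
      rep_vscale[OF assms, of "c * d"]
    by eventually_elim (simp only: mult.assoc)
qed (use assms in blast)+

lemma op_add_bounded:
  assumes a: "a \<in> bounded_ops (L2 M)" and b: "b \<in> bounded_ops (L2 M)"
  shows "op_add (L2 M) a b \<in> bounded_ops (L2 M)"
proof -
  obtain K where K: "K > 0" "\<And>x. x \<in> vecs (L2 M) \<Longrightarrow> vnorm (L2 M) (a x) \<le> K * vnorm (L2 M) x"
    using bounded_ops_bound[OF a] by blast
  obtain L where L: "L > 0" "\<And>x. x \<in> vecs (L2 M) \<Longrightarrow> vnorm (L2 M) (b x) \<le> L * vnorm (L2 M) x"
    using bounded_ops_bound[OF b] by blast
  show ?thesis
  proof (rule bounded_opsI[where K = "K + L"])
    show "linear_op (L2 M) (op_add (L2 M) a b)"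
      using bounded_opsD[OF a] bounded_opsD[OF b]
      by (auto simp: linear_op_def op_add_def vadd_vecs vscale_vecs vadd_ac vscale_vadd)
    fix x assume x: "x \<in> vecs (L2 M)"
    show "vnorm (L2 M) (op_add (L2 M) a b x) \<le> (K + L) * vnorm (L2 M) x"
      using x K(2)[OF x] L(2)[OF x] vnorm_triangle[of "a x" M "b x"]
        bounded_opsD(2)[OF a x] bounded_opsD(2)[OF b x]
      by (simp add: op_add_def distrib_right)
  qed
qed

lemma op_scale_bounded:
  assumes a: "a \<in> bounded_ops (L2 M)"
  shows "op_scale (L2 M) c a \<in> bounded_ops (L2 M)"
proof -
  obtain K where K: "K > 0" "\<And>x. x \<in> vecs (L2 M) \<Longrightarrow> vnorm (L2 M) (a x) \<le> K * vnorm (L2 M) x"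
    using bounded_ops_bound[OF a] by blast
  show ?thesis
  proof (rule bounded_opsI[where K = "cmod c * K"])
    show "linear_op (L2 M) (op_scale (L2 M) c a)"
      using bounded_opsD[OF a]
      by (auto simp: linear_op_def op_scale_def vadd_vecs vscale_vecs vscale_vadd vscale_vscale
          mult.commute)
    fix x assume x: "x \<in> vecs (L2 M)"
    show "vnorm (L2 M) (op_scale (L2 M) c a x) \<le> cmod c * K * vnorm (L2 M) x"
      using x mult_left_mono[OF K(2)[OF x], of "cmod c"] bounded_opsD(2)[OF a x]
      by (simp add: op_scale_def vnorm_vscale mult.assoc)
  qed
qed

text \<open>The algebra equals its double commutant, and products, sums and multiples of bounded
  operators that commute with the commutant commute with it again.\<close>

lemma vn_algebra_closed:
  assumes M: "vn_algebra (L2 N) M" and a: "a \<in> M" and b: "b \<in> M"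
  shows "op_mult (L2 N) a b \<in> M" "op_add (L2 N) a b \<in> M" "op_scale (L2 N) c a \<in> M"
proof -
  let ?H = "L2 N" and ?S = "op_commutant (L2 N) M"
  have MB: "M \<subseteq> bounded_ops ?H" and cc: "op_commutant ?H ?S = M"
    using M by (auto simp: vn_algebra_def)
  have aB: "a \<in> bounded_ops ?H" and bB: "b \<in> bounded_ops ?H" using a b MB by auto
  have comm: "d (s x) = s (d x)" if "d \<in> M" "s \<in> ?S" "x \<in> vecs ?H" for d s x
  proof -
    have "d \<in> op_commutant ?H ?S" using \<open>d \<in> M\<close> cc by simp
    then have "op_mult ?H d s = op_mult ?H s d"
      using \<open>s \<in> ?S\<close> by (simp add: op_commutant_def[of _ ?S])
    from fun_cong[OF this, of x] show ?thesis using that(3) by (simp add: op_mult_def)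
  qed
  have *: "d \<in> M" if d: "d \<in> bounded_ops ?H"
    and *: "\<And>s x. s \<in> bounded_ops ?H \<Longrightarrow> s \<in> ?S \<Longrightarrow> x \<in> vecs ?H \<Longrightarrow> d (s x) = s (d x)" for d
  proof -
    have "op_mult ?H d s = op_mult ?H s d" if "s \<in> ?S" for s
      unfolding op_mult_def using * that by (intro restrict_ext) (simp add: op_commutant_def)
    then have "d \<in> op_commutant ?H ?S" using d by (simp add: op_commutant_def[of _ ?S])
    then show ?thesis using cc by simp
  qed
  note ab = bounded_opsD[OF aB] bounded_opsD[OF bB]
  show "op_mult ?H a b \<in> M"
    by (rule *[OF op_mult_bounded[OF aB bB]])
      (simp add: op_mult_def comm[OF a] comm[OF b] ab bounded_opsD)
  show "op_add ?H a b \<in> M"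
    by (rule *[OF op_add_bounded[OF aB bB]])
      (simp add: op_add_def comm[OF a] comm[OF b] ab bounded_opsD)
  show "op_scale ?H c a \<in> M"
    by (rule *[OF op_scale_bounded[OF aB]])
      (simp add: op_scale_def comm[OF a] ab bounded_opsD)
qed

lemma op_scale_zero: "op_scale (L2 N) 0 a = op_zero (L2 N)"
  unfolding op_scale_def op_zero_def
  by (rule restrict_ext) (simp add: L2_def)

text \<open>Every algebra in the family is closed under the operations, hence so is the
  intersection; over an empty family the intersection is \<open>UNIV\<close> and the claims are
  trivially true. The zero operator is obtained as 0 times the given element
  \<open>a\<close>.\<close>

lemma vn_generated_closed:
  assumes a: "a \<in> vn_generated (L2 N) S" and b: "b \<in> vn_generated (L2 N) S"
  shows "op_mult (L2 N) a b \<in> vn_generated (L2 N) S" "op_add (L2 N) a b \<in> vn_generated (L2 N) S"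
    "op_scale (L2 N) c a \<in> vn_generated (L2 N) S" "op_zero (L2 N) \<in> vn_generated (L2 N) S"
proof -
  have "op_mult (L2 N) a b \<in> M \<and> op_add (L2 N) a b \<in> M \<and> op_scale (L2 N) c a \<in> M"
    if M: "vn_algebra (L2 N) M" "S \<subseteq> M" for M
  proof -
    have "a \<in> M" "b \<in> M" using a b M by (auto simp: vn_generated_def)
    then show ?thesis using vn_algebra_closed[OF M(1)] by simp
  qed
  then show "op_mult (L2 N) a b \<in> vn_generated (L2 N) S" "op_add (L2 N) a b \<in> vn_generated (L2 N) S"
    "op_scale (L2 N) c a \<in> vn_generated (L2 N) S"
    by (auto simp: vn_generated_def)
  have "op_zero (L2 N) \<in> M" if M: "vn_algebra (L2 N) M" "S \<subseteq> M" for M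
  proof -
    have "a \<in> M" using a M by (auto simp: vn_generated_def)
    then show ?thesis using vn_algebra_closed(3)[OF M(1), of a a 0] op_scale_zero by metis
  qed
  then show "op_zero (L2 N) \<in> vn_generated (L2 N) S" by (auto simp: vn_generated_def)
qed

lemma vn_generated_superset: "S \<subseteq> vn_generated H S"
  by (auto simp: vn_generated_def)

section \<open>Weighted composition operators\<close>

definition Linfty :: "'i measure \<Rightarrow> ('i \<Rightarrow> complex) set" where
  "Linfty M = {b \<in> borel_measurable M. \<exists>K. AE x in M. cmod (b x) \<le> K}"

definition preserves_measure :: "'i measure \<Rightarrow> ('i \<Rightarrow> 'i) \<Rightarrow> bool" where
  "preserves_measure M \<phi> \<longleftrightarrow> \<phi> \<in> measurable M M \<and> distr M M \<phi> = M"

text \<open>One family containing the explicit operators of the proof: multiplications,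
  translations, the unitary of T and b \<otimes> l(g). It is closed under products and, for
  invertible maps, under adjoints, so operator identities become identities of weights and point
  maps.\<close>

definition comp_op :: "'i measure \<Rightarrow> ('i \<Rightarrow> complex) \<Rightarrow> ('i \<Rightarrow> 'i) \<Rightarrow> ('i \<Rightarrow> complex) set
    \<Rightarrow> ('i \<Rightarrow> complex) set" where
  "comp_op M f \<phi> = (\<lambda>u\<in>vecs (L2 M). l2_class M (\<lambda>x. f x * l2_rep u (\<phi> x)))"

lemma mult_op_eq_comp_op: "mult_op M f = comp_op M f (\<lambda>x. x)"
  by (simp add: mult_op_def comp_op_def)

lemma preserves_measure_id [simp]: "preserves_measure M (\<lambda>x. x)"
  by (simp add: preserves_measure_def)

lemma preserves_measure_comp:
  assumes "preserves_measure M \<phi>" "preserves_measure M \<psi>"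
  shows "preserves_measure M (\<lambda>x. \<phi> (\<psi> x))"
proof -
  have [measurable]: "\<phi> \<in> measurable M M" "\<psi> \<in> measurable M M"
    using assms by (auto simp: preserves_measure_def)
  have "distr M M (\<lambda>x. \<phi> (\<psi> x)) = distr (distr M M \<psi>) M \<phi>"
    by (subst distr_distr) (auto simp: comp_def)
  then show ?thesis using assms by (simp add: preserves_measure_def)
qed

lemma AE_preserves_measure:
  assumes "preserves_measure M \<phi>" "AE x in M. P x"
  shows "AE x in M. P (\<phi> x)"
  using assms AE_distrD[of \<phi> M M P] unfolding preserves_measure_def by metis

lemma integral_preserves_measure:
  fixes g :: "'i \<Rightarrow> 'b::{banach, second_countable_topology}"
  assumes "preserves_measure M \<phi>" "g \<in> borel_measurable M"
  shows "(LINT x|M. g (\<phi> x)) = (LINT x|M. g x)"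
  using assms integral_distr[of \<phi> M M g] unfolding preserves_measure_def by metis

lemma l2_functions_comp:
  assumes \<phi>: "preserves_measure M \<phi>" and f: "f \<in> l2_functions M"
  shows "(\<lambda>x. f (\<phi> x)) \<in> l2_functions M"
proof (rule l2_functionsI)
  have [measurable]: "\<phi> \<in> measurable M M" "f \<in> borel_measurable M"
    using \<phi> l2_functionsD[OF f] by (auto simp: preserves_measure_def)
  show "(\<lambda>x. f (\<phi> x)) \<in> borel_measurable M" by measurable
  have "integrable (distr M M \<phi>) (\<lambda>x. (cmod (f x))\<^sup>2)"
    using \<phi> l2_functionsD[OF f] by (simp add: preserves_measure_def)
  then show "integrable M (\<lambda>x. (cmod (f (\<phi> x)))\<^sup>2)"
    by (subst (asm) integrable_distr_eq) auto
qed

lemma Linfty_const [simp]: "(\<lambda>x. c) \<in> Linfty M"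
  by (auto simp: Linfty_def)

lemma Linfty_cnj: "b \<in> Linfty M \<Longrightarrow> (\<lambda>x. cnj (b x)) \<in> Linfty M"
  by (auto simp: Linfty_def intro: borel_measurable_cnj)

lemma Linfty_mult:
  assumes "b \<in> Linfty M" "b' \<in> Linfty M"
  shows "(\<lambda>x. b x * b' x) \<in> Linfty M"
proof -
  obtain K K' where K: "AE x in M. cmod (b x) \<le> K" "AE x in M. cmod (b' x) \<le> K'"
    using assms by (auto simp: Linfty_def)
  have "AE x in M. cmod (b x * b' x) \<le> K * K'"
    using K by eventually_elim
      (auto simp: norm_mult intro!: mult_mono intro: order_trans[OF norm_ge_zero])
  then show ?thesis using assms by (auto simp: Linfty_def)
qed

lemma Linfty_add:
  assumes "b \<in> Linfty M" "b' \<in> Linfty M"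
  shows "(\<lambda>x. b x + b' x) \<in> Linfty M"
proof -
  obtain K K' where K: "AE x in M. cmod (b x) \<le> K" "AE x in M. cmod (b' x) \<le> K'"
    using assms by (auto simp: Linfty_def)
  have "AE x in M. cmod (b x + b' x) \<le> K + K'"
    using K by eventually_elim (auto intro: order_trans[OF norm_triangle_ineq])
  then show ?thesis using assms by (auto simp: Linfty_def)
qed

lemma Linfty_comp:
  assumes \<phi>: "preserves_measure M \<phi>" and b: "b \<in> Linfty M"
  shows "(\<lambda>x. b (\<phi> x)) \<in> Linfty M"
proof -
  obtain K where K: "AE x in M. cmod (b x) \<le> K" using b by (auto simp: Linfty_def)
  have "(\<lambda>x. b (\<phi> x)) \<in> borel_measurable M"
    using \<phi> b by (auto simp: Linfty_def preserves_measure_def intro: measurable_compose)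
  then show ?thesis using AE_preserves_measure[OF \<phi> K] by (auto simp: Linfty_def)
qed

lemma Linfty_indicator:
  "Measurable.pred M (\<lambda>x. x \<in> Y) \<Longrightarrow> (indicator Y :: _ \<Rightarrow> complex) \<in> Linfty M"
  unfolding Linfty_def by (auto intro!: exI[of _ 1] AE_I2 split: split_indicator)

lemma l2_weighted_comp:
  assumes b: "b \<in> Linfty M" and \<phi>: "preserves_measure M \<phi>" and f: "f \<in> l2_functions M"
  shows "(\<lambda>x. b x * f (\<phi> x)) \<in> l2_functions M"
  using b l2_functions_comp[OF \<phi> f] by (auto simp: Linfty_def intro: l2_functions_mult_bounded)

lemma comp_op_vecs:
  assumes "b \<in> Linfty M" "preserves_measure M \<phi>" "u \<in> vecs (L2 M)"
  shows "comp_op M b \<phi> u \<in> vecs (L2 M)"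
  using assms l2_weighted_comp[OF assms(1,2) vecs_rep(1)[OF assms(3)]]
  by (auto simp: comp_op_def)

lemma rep_comp_op:
  assumes "b \<in> Linfty M" "preserves_measure M \<phi>" "u \<in> vecs (L2 M)"
  shows "AE x in M. l2_rep (comp_op M b \<phi> u) x = b x * l2_rep u (\<phi> x)"
  using l2_rep_class(2)[OF l2_weighted_comp[OF assms(1,2) vecs_rep(1)[OF assms(3)]]] assms(3)
  by (simp add: comp_op_def)

text \<open>A measure-preserving map pulls null sets back to null sets, so the result does not
  depend on the representative chosen by \<open>l2_rep\<close>.\<close>

lemma comp_op_class:
  assumes "b \<in> Linfty M" "preserves_measure M \<phi>" and f: "f \<in> l2_functions M"
  shows "comp_op M b \<phi> (l2_class M f) = l2_class M (\<lambda>x. b x * f (\<phi> x))"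
proof -
  have "AE x in M. b x * l2_rep (l2_class M f) (\<phi> x) = b x * f (\<phi> x)"
    using AE_preserves_measure[OF assms(2) l2_rep_class(2)[OF f]] by eventually_elim simp
  then show ?thesis
    using l2_class_in_vecs[OF f] by (simp add: comp_op_def l2_class_cong_AE)
qed

lemma comp_op_bounded:
  assumes b: "b \<in> Linfty M" and \<phi>: "preserves_measure M \<phi>"
  shows "comp_op M b \<phi> \<in> bounded_ops (L2 M)"
proof -
  obtain K where K: "AE x in M. cmod (b x) \<le> K" using b by (auto simp: Linfty_def)
  have [measurable]: "b \<in> borel_measurable M" using b by (simp add: Linfty_def)
  show ?thesis
  proof (rule bounded_opsI[where K = "\<bar>K\<bar>"])
    show "linear_op (L2 M) (comp_op M b \<phi>)"
      unfolding linear_op_def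
    proof (intro conjI ballI allI)
      show "comp_op M b \<phi> \<in> vecs (L2 M) \<rightarrow>\<^sub>E vecs (L2 M)"
        using comp_op_vecs[OF b \<phi>] by (auto simp: comp_op_def)
      fix u v assume u: "u \<in> vecs (L2 M)" and v: "v \<in> vecs (L2 M)"
      show "comp_op M b \<phi> (vadd (L2 M) u v)
          = vadd (L2 M) (comp_op M b \<phi> u) (comp_op M b \<phi> v)"
      proof (rule vecs_eqI)
        show "AE x in M. l2_rep (comp_op M b \<phi> (vadd (L2 M) u v)) x
            = l2_rep (vadd (L2 M) (comp_op M b \<phi> u) (comp_op M b \<phi> v)) x"
          using rep_comp_op[OF b \<phi> vadd_vecs[OF u v]] rep_comp_op[OF b \<phi> u] rep_comp_op[OF b \<phi> v]
            rep_vadd[OF comp_op_vecs[OF b \<phi> u] comp_op_vecs[OF b \<phi> v]]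
            AE_preserves_measure[OF \<phi> rep_vadd[OF u v]]
          by eventually_elim (simp only: distrib_left)
      qed (use u v comp_op_vecs[OF b \<phi>] in blast)+
    next
      fix c u assume u: "u \<in> vecs (L2 M)"
      show "comp_op M b \<phi> (vscale (L2 M) c u) = vscale (L2 M) c (comp_op M b \<phi> u)"
      proof (rule vecs_eqI)
        show "AE x in M. l2_rep (comp_op M b \<phi> (vscale (L2 M) c u)) x
            = l2_rep (vscale (L2 M) c (comp_op M b \<phi> u)) x"
          using rep_comp_op[OF b \<phi> vscale_vecs[OF u], of c] rep_comp_op[OF b \<phi> u]
            rep_vscale[OF comp_op_vecs[OF b \<phi> u], of c]
            AE_preserves_measure[OF \<phi> rep_vscale[OF u, of c]]
          by eventually_elim (simp only: mult.left_commute)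
      qed (use u comp_op_vecs[OF b \<phi>] in blast)+
    qed
    fix u assume u: "u \<in> vecs (L2 M)"
    let ?f = "l2_rep u"
    have f: "?f \<in> l2_functions M" by (rule vecs_rep[OF u])
    have [measurable]: "?f \<in> borel_measurable M" "\<phi> \<in> measurable M M"
      using \<phi> l2_functionsD(1)[OF f] by (auto simp: preserves_measure_def)
    have "vnorm (L2 M) (comp_op M b \<phi> u) = sqrt (LINT x|M. (cmod (b x * ?f (\<phi> x)))\<^sup>2)"
      using vnorm_class[OF l2_weighted_comp[OF b \<phi> f]] u by (simp add: comp_op_def)
    also have "\<dots> \<le> sqrt (LINT x|M. K\<^sup>2 * (cmod (?f (\<phi> x)))\<^sup>2)"
    proof (intro real_sqrt_le_mono integral_mono_AE)
      show "integrable M (\<lambda>x. (cmod (b x * ?f (\<phi> x)))\<^sup>2)"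
        by (rule l2_functionsD(2)[OF l2_weighted_comp[OF b \<phi> f]])
      show "integrable M (\<lambda>x. K\<^sup>2 * (cmod (?f (\<phi> x)))\<^sup>2)"
        using l2_functionsD(2)[OF l2_functions_comp[OF \<phi> f]] by simp
      show "AE x in M. (cmod (b x * ?f (\<phi> x)))\<^sup>2 \<le> K\<^sup>2 * (cmod (?f (\<phi> x)))\<^sup>2"
        using K by eventually_elim
          (simp add: norm_mult power_mult_distrib mult_right_mono power_mono)
    qed
    also have "\<dots> = \<bar>K\<bar> * vnorm (L2 M) u"
      using integral_preserves_measure[OF \<phi>, of "\<lambda>x. (cmod (?f x))\<^sup>2"]
      by (simp add: real_sqrt_mult vnorm_rep)
    finally show "vnorm (L2 M) (comp_op M b \<phi> u) \<le> \<bar>K\<bar> * vnorm (L2 M) u" .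
  qed
qed

lemma comp_op_cong:
  assumes "preserves_measure M \<phi>" "AE x in M. b x = b' x" "\<And>x. x \<in> space M \<Longrightarrow> \<phi> x = \<phi>' x"
  shows "comp_op M b \<phi> = comp_op M b' \<phi>'"
  unfolding comp_op_def
proof (rule restrict_ext)
  fix u
  have "AE x in M. b x * l2_rep u (\<phi> x) = b' x * l2_rep u (\<phi>' x)"
    using assms(2) AE_space[of M] by eventually_elim (simp add: assms(3))
  then show "l2_class M (\<lambda>x. b x * l2_rep u (\<phi> x)) = l2_class M (\<lambda>x. b' x * l2_rep u (\<phi>' x))"
    by (rule l2_class_cong_AE)
qed

lemma op_mult_comp_op:
  assumes b: "b \<in> Linfty M" and \<phi>: "preserves_measure M \<phi>"
    and b': "b' \<in> Linfty M" and \<psi>: "preserves_measure M \<psi>"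
  shows "op_mult (L2 M) (comp_op M b \<phi>) (comp_op M b' \<psi>)
    = comp_op M (\<lambda>x. b x * b' (\<phi> x)) (\<lambda>x. \<psi> (\<phi> x))"
  unfolding op_mult_def comp_op_def[of M "\<lambda>x. b x * b' (\<phi> x)"]
proof (rule restrict_ext)
  fix u assume u: "u \<in> vecs (L2 M)"
  note l2 = l2_weighted_comp[OF b' \<psi> vecs_rep(1)[OF u]]
  have "comp_op M b' \<psi> u = l2_class M (\<lambda>x. b' x * l2_rep u (\<psi> x))"
    using u by (simp add: comp_op_def)
  then show "comp_op M b \<phi> (comp_op M b' \<psi> u)
      = l2_class M (\<lambda>x. b x * b' (\<phi> x) * l2_rep u (\<psi> (\<phi> x)))"
    using comp_op_class[OF b \<phi> l2] by (simp add: mult.assoc)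
qed

lemma op_add_mult_op:
  assumes b: "b \<in> Linfty M" and b': "b' \<in> Linfty M"
  shows "op_add (L2 M) (mult_op M b) (mult_op M b') = mult_op M (\<lambda>x. b x + b' x)"
  unfolding op_add_def mult_op_def[of M "\<lambda>x. b x + b' x"]
proof (rule restrict_ext)
  fix u assume u: "u \<in> vecs (L2 M)"
  have l2: "(\<lambda>x. b x * l2_rep u x) \<in> l2_functions M" if "b \<in> Linfty M" for b
    by (rule l2_weighted_comp[OF that preserves_measure_id vecs_rep(1)[OF u]])
  show "vadd (L2 M) (mult_op M b u) (mult_op M b' u) = l2_class M (\<lambda>x. (b x + b' x) * l2_rep u x)"
    using u vadd_class[OF l2[OF b] l2[OF b']] by (simp add: mult_op_def distrib_right)
qed

text \<open>Substituting \<phi>(x) for x in the integral of the left inner product turns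
  \<psi>(\<phi>(x)) into x and places \<phi> and the weight b on the second factor.\<close>

lemma op_adj_comp_op:
  assumes b: "b \<in> Linfty M" and \<phi>: "preserves_measure M \<phi>" and \<psi>: "preserves_measure M \<psi>"
    and inv: "\<And>x. x \<in> space M \<Longrightarrow> \<psi> (\<phi> x) = x"
  shows "op_adj (L2 M) (comp_op M b \<phi>) = comp_op M (\<lambda>x. cnj (b (\<psi> x))) \<psi>"
proof (rule op_adj_eqI)
  have b': "(\<lambda>x. cnj (b (\<psi> x))) \<in> Linfty M" by (rule Linfty_cnj[OF Linfty_comp[OF \<psi> b]])
  show "comp_op M (\<lambda>x. cnj (b (\<psi> x))) \<psi> \<in> bounded_ops (L2 M)" by (rule comp_op_bounded[OF b' \<psi>])
  fix u v assume u: "u \<in> vecs (L2 M)" and v: "v \<in> vecs (L2 M)"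
  note [measurable] = u[THEN vecs_rep(1), THEN l2_functionsD(1)]
    v[THEN vecs_rep(1), THEN l2_functionsD(1)]
  have [measurable]: "b \<in> borel_measurable M" "\<phi> \<in> measurable M M" "\<psi> \<in> measurable M M"
    using b \<phi> \<psi> by (auto simp: Linfty_def preserves_measure_def)
  have "vinner (L2 M) (comp_op M (\<lambda>x. cnj (b (\<psi> x))) \<psi> u) v
      = (LINT x|M. b (\<psi> x) * cnj (l2_rep u (\<psi> x)) * l2_rep v x)"
  proof (rule vinner_cong_AE[OF comp_op_vecs[OF b' \<psi> u] v])
    show "AE x in M. cnj (l2_rep (comp_op M (\<lambda>x. cnj (b (\<psi> x))) \<psi> u) x) * l2_rep v x
        = b (\<psi> x) * cnj (l2_rep u (\<psi> x)) * l2_rep v x"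
      using rep_comp_op[OF b' \<psi> u] by eventually_elim simp
  qed measurable
  also have "\<dots> = (LINT x|M. b (\<psi> (\<phi> x)) * cnj (l2_rep u (\<psi> (\<phi> x))) * l2_rep v (\<phi> x))"
    by (rule integral_preserves_measure[OF \<phi>, symmetric]) measurable
  also have "\<dots> = (LINT x|M. cnj (l2_rep u x) * (b x * l2_rep v (\<phi> x)))"
    by (intro Bochner_Integration.integral_cong refl) (simp add: inv mult.left_commute mult.assoc)
  also have "\<dots> = vinner (L2 M) u (comp_op M b \<phi> v)"
  proof (rule vinner_cong_AE[OF u comp_op_vecs[OF b \<phi> v], symmetric])
    show "AE x in M. cnj (l2_rep u x) * l2_rep (comp_op M b \<phi> v) x
        = cnj (l2_rep u x) * (b x * l2_rep v (\<phi> x))"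
      using rep_comp_op[OF b \<phi> v] by eventually_elim simp
  qed measurable
  finally show "vinner (L2 M) (comp_op M (\<lambda>x. cnj (b (\<psi> x))) \<psi> u) v
      = vinner (L2 M) u (comp_op M b \<phi> v)" .
qed

section \<open>Vectors supported on a measurable set\<close>

definition supp_space :: "'i measure \<Rightarrow> 'i set \<Rightarrow> ('i \<Rightarrow> complex) set set" where
  "supp_space M Y = {u \<in> vecs (L2 M). AE x in M. x \<notin> Y \<longrightarrow> l2_rep u x = 0}"

lemma class_in_supp_space:
  assumes f: "f \<in> l2_functions M" and "AE x in M. x \<notin> Y \<longrightarrow> f x = 0"
  shows "l2_class M f \<in> supp_space M Y"
proof -
  have "AE x in M. x \<notin> Y \<longrightarrow> l2_rep (l2_class M f) x = 0"
    using assms(2) l2_rep_class(2)[OF f] by eventually_elim simp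
  then show ?thesis using f by (auto simp: supp_space_def)
qed

lemma closed_subspace_supp_space:
  assumes [measurable]: "Measurable.pred M (\<lambda>x. x \<in> Y)"
  shows "closed_subspace (L2 M) (supp_space M Y)"
proof (rule closed_subspaceI)
  show "lin_subspace (L2 M) (supp_space M Y)"
    unfolding lin_subspace_def
  proof (intro conjI ballI allI)
    show "supp_space M Y \<subseteq> vecs (L2 M)" by (auto simp: supp_space_def)
    show "supp_space M Y \<noteq> {}" using class_in_supp_space[OF l2_functions_zero[of M], of Y] by auto
    fix u v assume "u \<in> supp_space M Y" "v \<in> supp_space M Y"
    then have uv: "u \<in> vecs (L2 M)" "v \<in> vecs (L2 M)" "AE x in M. x \<notin> Y \<longrightarrow> l2_rep u x = 0"
      "AE x in M. x \<notin> Y \<longrightarrow> l2_rep v x = 0" by (auto simp: supp_space_def)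
    have "AE x in M. x \<notin> Y \<longrightarrow> l2_rep (vadd (L2 M) u v) x = 0"
      using uv(3,4) rep_vadd[OF uv(1,2)] by eventually_elim simp
    then show "vadd (L2 M) u v \<in> supp_space M Y" using uv by (auto simp: supp_space_def)
  next
    fix c u assume "u \<in> supp_space M Y"
    then have u: "u \<in> vecs (L2 M)" "AE x in M. x \<notin> Y \<longrightarrow> l2_rep u x = 0"
      by (auto simp: supp_space_def)
    have "AE x in M. x \<notin> Y \<longrightarrow> l2_rep (vscale (L2 M) c u) x = 0"
      using u(2) rep_vscale[OF u(1), of c] by eventually_elim simp
    then show "vscale (L2 M) c u \<in> supp_space M Y" using u by (auto simp: supp_space_def)
  qed
  fix u assume cl: "u \<in> vclosure (L2 M) (supp_space M Y)"
  then have u: "u \<in> vecs (L2 M)" by (simp add: vclosure_def)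
  \<comment> \<open>Cutting off to the complement of Y annihilates every v in the subspace, so the
    cut-off of u has norm at most |u - v|, which can be made arbitrarily small.\<close>
  let ?b = "indicator (- Y) :: _ \<Rightarrow> complex"
  have b: "?b \<in> Linfty M" by (intro Linfty_indicator) simp
  let ?w = "comp_op M ?b (\<lambda>x. x) u"
  have w: "?w \<in> vecs (L2 M)" by (rule comp_op_vecs[OF b preserves_measure_id u])
  have "vnorm (L2 M) ?w \<le> e" if "e > 0" for e
  proof -
    obtain v where "v \<in> supp_space M Y" and less: "vnorm (L2 M) (vdiff (L2 M) u v) < e"
      using vclosureE[OF cl \<open>e > 0\<close>] .
    then have v: "v \<in> vecs (L2 M)" "AE x in M. x \<notin> Y \<longrightarrow> l2_rep v x = 0"
      by (auto simp: supp_space_def)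
    have d: "vdiff (L2 M) u v \<in> vecs (L2 M)" using u v by blast
    have "vnorm (L2 M) ?w \<le> vnorm (L2 M) (vdiff (L2 M) u v)"
      unfolding vnorm_rep
    proof (intro real_sqrt_le_mono integral_mono_AE)
      show "AE x in M. (cmod (l2_rep ?w x))\<^sup>2 \<le> (cmod (l2_rep (vdiff (L2 M) u v) x))\<^sup>2"
        using rep_comp_op[OF b preserves_measure_id u] v(2) rep_vdiff[OF u v(1)]
        by eventually_elim (auto split: split_indicator)
    qed (use l2_functionsD(2)[OF vecs_rep(1)[OF w]] l2_functionsD(2)[OF vecs_rep(1)[OF d]] in simp)+
    with less show ?thesis by simp
  qed
  then have "vnorm (L2 M) ?w \<le> 0" by (rule field_le_epsilon) simp
  then have "vnorm (L2 M) ?w = 0" using vnorm_nonneg[of M ?w] by simp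
  then have "AE x in M. l2_rep ?w x = 0" using vnorm_eq_0_iff[OF w] by simp
  then have "AE x in M. x \<notin> Y \<longrightarrow> l2_rep u x = 0"
    using rep_comp_op[OF b preserves_measure_id u]
    by eventually_elim (auto split: split_indicator_asm)
  then show "u \<in> supp_space M Y" using u by (simp add: supp_space_def)
qed

lemma supp_space_disjoint_orth:
  assumes "u \<in> supp_space M Y" "v \<in> supp_space M (- Y)"
  shows "vinner (L2 M) u v = 0"
proof -
  have uv: "u \<in> vecs (L2 M)" "v \<in> vecs (L2 M)" "AE x in M. x \<notin> Y \<longrightarrow> l2_rep u x = 0"
    "AE x in M. x \<notin> - Y \<longrightarrow> l2_rep v x = 0" using assms by (auto simp: supp_space_def)
  have "AE x in M. cnj (l2_rep u x) * l2_rep v x = 0"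
    using uv(3,4) by eventually_elim auto
  then show ?thesis using vinner_cong_AE[OF uv(1,2), of "\<lambda>x. 0"] by simp
qed

lemma mult_op_in_supp_space:
  assumes "Measurable.pred M (\<lambda>x. x \<in> Y)" and u: "u \<in> vecs (L2 M)"
  shows "mult_op M (indicator Y) u \<in> supp_space M Y"
proof -
  have b: "(indicator Y :: _ \<Rightarrow> complex) \<in> Linfty M" by (rule Linfty_indicator[OF assms(1)])
  have "AE x in M. x \<notin> Y \<longrightarrow> l2_rep (mult_op M (indicator Y) u) x = 0"
    using rep_comp_op[OF b preserves_measure_id u]
    unfolding mult_op_eq_comp_op by eventually_elim simp
  then show ?thesis
    using comp_op_vecs[OF b preserves_measure_id u] by (simp add: supp_space_def mult_op_eq_comp_op)
qed

text \<open>An indicator takes only the values 0 and 1 and is therefore idempotent. This gives both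
  the orthogonality test below and the positivity of the projection onto a layer.\<close>

lemma vinner_mult_op_indicator:
  assumes Y [measurable]: "Measurable.pred M (\<lambda>x. x \<in> Y)" and u: "u \<in> vecs (L2 M)"
  shows "vinner (L2 M) (mult_op M (indicator Y) u) u
    = vinner (L2 M) (mult_op M (indicator Y) u) (mult_op M (indicator Y) u)"
proof -
  let ?w = "mult_op M (indicator Y) u"
  have b: "(indicator Y :: _ \<Rightarrow> complex) \<in> Linfty M" by (rule Linfty_indicator[OF Y])
  have w: "?w \<in> vecs (L2 M)" using mult_op_in_supp_space[OF Y u] by (simp add: supp_space_def)
  show ?thesis
    unfolding vinner_rep[of M ?w ?w]
  proof (rule vinner_cong_AE[OF w u])
    show "(\<lambda>x. cnj (l2_rep ?w x) * l2_rep ?w x) \<in> borel_measurable M"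
      using l2_functionsD(1)[OF vecs_rep(1)[OF w]] by measurable
    show "AE x in M. cnj (l2_rep ?w x) * l2_rep u x = cnj (l2_rep ?w x) * l2_rep ?w x"
      using rep_comp_op[OF b preserves_measure_id u, folded mult_op_eq_comp_op]
      by eventually_elim (auto split: split_indicator)
  qed
qed

text \<open>The cut-off of u to Y is itself an admissible test vector, and its inner product with u
  is its squared norm.\<close>

lemma orth_supp_spaceD:
  assumes Y [measurable]: "Measurable.pred M (\<lambda>x. x \<in> Y)" and u: "u \<in> vecs (L2 M)"
    and orth: "\<And>v. v \<in> supp_space M Y \<Longrightarrow> vinner (L2 M) v u = 0"
  shows "u \<in> supp_space M (- Y)"
proof -
  let ?w = "mult_op M (indicator Y) u"
  have b: "(indicator Y :: _ \<Rightarrow> complex) \<in> Linfty M" by (rule Linfty_indicator[OF Y])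
  have w: "?w \<in> vecs (L2 M)" using mult_op_in_supp_space[OF Y u] by (simp add: supp_space_def)
  note rep = rep_comp_op[OF b preserves_measure_id u, folded mult_op_eq_comp_op]
  have "vnorm (L2 M) ?w = 0"
    using orth[OF mult_op_in_supp_space[OF Y u]] vinner_mult_op_indicator[OF Y u]
    by (simp add: vinner_self)
  then have "AE x in M. l2_rep ?w x = 0" using vnorm_eq_0_iff[OF w] by simp
  then have "AE x in M. x \<notin> - Y \<longrightarrow> l2_rep u x = 0"
    using rep by eventually_elim (auto split: split_indicator_asm)
  then show ?thesis using u by (simp add: supp_space_def)
qed

lemma orth_compl_supp_space:
  assumes "Measurable.pred M (\<lambda>x. x \<in> Y)"
  shows "orth_compl (L2 M) (supp_space M Y) = supp_space M (- Y)"
proof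
  show "orth_compl (L2 M) (supp_space M Y) \<subseteq> supp_space M (- Y)"
    using orth_supp_spaceD[OF assms] by (auto simp: orth_compl_def)
  show "supp_space M (- Y) \<subseteq> orth_compl (L2 M) (supp_space M Y)"
  proof
    fix u assume u: "u \<in> supp_space M (- Y)"
    then have "u \<in> vecs (L2 M)" by (simp add: supp_space_def)
    then show "u \<in> orth_compl (L2 M) (supp_space M Y)"
      using supp_space_disjoint_orth[OF _ u] by (simp add: orth_compl_def)
  qed
qed

text \<open>Since \<open>orth_proj\<close> is a definite description, uniqueness has to be shown as
  well: a competitor vanishes off Y by its support and agrees with u on Y because the difference is
  orthogonal to everything supported there.\<close>

lemma orth_proj_supp_space:
  assumes Y [measurable]: "Measurable.pred M (\<lambda>x. x \<in> Y)"
  shows "orth_proj (L2 M) (supp_space M Y) = mult_op M (indicator Y)"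
  unfolding orth_proj_def mult_op_def[of M "indicator Y"]
proof (rule restrict_ext)
  fix u assume u: "u \<in> vecs (L2 M)"
  let ?w = "mult_op M (indicator Y) u"
  have b: "(indicator Y :: _ \<Rightarrow> complex) \<in> Linfty M" by (rule Linfty_indicator[OF Y])
  note rep = rep_comp_op[OF b preserves_measure_id u, folded mult_op_eq_comp_op]
  have wY: "?w \<in> supp_space M Y" by (rule mult_op_in_supp_space[OF Y u])
  then have w: "?w \<in> vecs (L2 M)" by (simp add: supp_space_def)
  have "(THE y. y \<in> supp_space M Y \<and> (\<forall>v\<in>supp_space M Y. vinner (L2 M) v (vdiff (L2 M) u y) = 0)) = ?w"
  proof (rule the_equality)
    have "AE x in M. x \<notin> - Y \<longrightarrow> l2_rep (vdiff (L2 M) u ?w) x = 0"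
      using rep rep_vdiff[OF u w] by eventually_elim simp
    then have "vdiff (L2 M) u ?w \<in> supp_space M (- Y)"
      using u w by (auto simp: supp_space_def)
    then show "?w \<in> supp_space M Y \<and> (\<forall>v\<in>supp_space M Y. vinner (L2 M) v (vdiff (L2 M) u ?w) = 0)"
      using wY supp_space_disjoint_orth by blast
  next
    fix y assume y: "y \<in> supp_space M Y \<and> (\<forall>v\<in>supp_space M Y. vinner (L2 M) v (vdiff (L2 M) u y) = 0)"
    then have yH: "y \<in> vecs (L2 M)" "AE x in M. x \<notin> Y \<longrightarrow> l2_rep y x = 0"
      by (auto simp: supp_space_def)
    have "vdiff (L2 M) u y \<in> supp_space M (- Y)"
      using y vdiff_vecs[OF u yH(1)] by (intro orth_supp_spaceD[OF Y]) auto
    then have "AE x in M. x \<notin> - Y \<longrightarrow> l2_rep (vdiff (L2 M) u y) x = 0"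
      by (simp add: supp_space_def)
    with yH(2) rep rep_vdiff[OF u yH(1)] have "AE x in M. l2_rep y x = l2_rep ?w x"
      by eventually_elim (auto split: split_indicator)
    then show "y = ?w" by (rule vecs_eqI[OF yH(1) w])
  qed
  then show "(THE y. y \<in> supp_space M Y \<and> (\<forall>v\<in>supp_space M Y. vinner (L2 M) v (vdiff (L2 M) u y) = 0))
      = l2_class M (\<lambda>x. indicator Y x * l2_rep u x)"
    using u by (simp add: mult_op_def)
qed

text \<open>With \<open>\<kappa>\<close> the identity or \<open>cnj\<close> this covers linear and
  antilinear maps, hence both \<open>U\<close> and \<open>J\<close>. The condition at -1 makes
  \<open>a\<close> compatible with differences, which is how the norm bound becomes
  continuity.\<close>

lemma closed_subspace_preimage:
  assumes maps: "\<And>x. x \<in> vecs (L2 M) \<Longrightarrow> a x \<in> vecs (L2 M)"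
    and add: "\<And>x y. x \<in> vecs (L2 M) \<Longrightarrow> y \<in> vecs (L2 M)
      \<Longrightarrow> a (vadd (L2 M) x y) = vadd (L2 M) (a x) (a y)"
    and scale: "\<And>c x. x \<in> vecs (L2 M) \<Longrightarrow> a (vscale (L2 M) c x) = vscale (L2 M) (\<kappa> c) (a x)"
    and \<kappa>: "\<kappa> (- 1) = - 1"
    and bound: "\<And>x. x \<in> vecs (L2 M) \<Longrightarrow> vnorm (L2 M) (a x) \<le> K * vnorm (L2 M) x"
    and W: "closed_subspace (L2 M) W"
  shows "closed_subspace (L2 M) {x \<in> vecs (L2 M). a x \<in> W}"
proof (rule closed_subspaceI)
  let ?H = "L2 M"
  have lin: "lin_subspace ?H W" and cl: "vclosure ?H W = W"
    using W by (auto simp: closed_subspace_def)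
  have WH: "W \<subseteq> vecs ?H" and Wadd: "\<And>x y. x \<in> W \<Longrightarrow> y \<in> W \<Longrightarrow> vadd ?H x y \<in> W"
    and Wsc: "\<And>c x. x \<in> W \<Longrightarrow> vscale ?H c x \<in> W"
    using lin by (auto simp: lin_subspace_def)
  have zero: "vnorm ?H (l2_class M (\<lambda>x. 0)) = 0"
    by (subst vnorm_class[OF l2_functions_zero]) simp
  have adiff: "a (vdiff ?H x y) = vdiff ?H (a x) (a y)" if "x \<in> vecs ?H" "y \<in> vecs ?H" for x y
    unfolding vdiff_def using that \<kappa> by (simp add: add scale vscale_vecs)
  show "lin_subspace ?H {x \<in> vecs ?H. a x \<in> W}"
    unfolding lin_subspace_def
  proof (intro conjI ballI allI)
    have z: "l2_class M (\<lambda>x. 0) \<in> vecs ?H" using l2_functions_zero by blast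
    \<comment> \<open>\<open>\<kappa>\<close> is constrained only at -1, so the norm bound is what
      shows that \<open>a\<close> maps zero to zero.\<close>
    have "vnorm ?H (a (l2_class M (\<lambda>x. 0))) \<le> 0"
      using bound[OF z] zero by simp
    then have "AE x in M. l2_rep (a (l2_class M (\<lambda>x. 0))) x = 0"
      using vnorm_eq_0_iff[OF maps[OF z]] vnorm_nonneg[of M "a (l2_class M (\<lambda>x. 0))"] by simp
    then have "a (l2_class M (\<lambda>x. 0)) = l2_class M (\<lambda>x. 0)"
      using vecs_rep[OF maps[OF z]] l2_class_cong_AE[where M = M and g = "\<lambda>x. 0"] by metis
    then show "{x \<in> vecs ?H. a x \<in> W} \<noteq> {}" using z zero_in_subspace[OF lin] by auto
  qed (auto simp: add scale Wadd Wsc vadd_vecs vscale_vecs)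
  fix x assume x: "x \<in> vclosure ?H {x \<in> vecs ?H. a x \<in> W}"
  then have xH: "x \<in> vecs ?H" by (simp add: vclosure_def)
  have "a x \<in> vclosure ?H W"
    unfolding vclosure_def
  proof (intro CollectI conjI allI impI)
    show "a x \<in> vecs ?H" by (rule maps[OF xH])
    fix e :: real assume "e > 0"
    then have "e / (\<bar>K\<bar> + 1) > 0" by simp
    then obtain y where y: "y \<in> vecs ?H" "a y \<in> W" "vnorm ?H (vdiff ?H x y) < e / (\<bar>K\<bar> + 1)"
      using vclosureE[OF x] by blast
    have "vnorm ?H (vdiff ?H (a x) (a y)) \<le> K * vnorm ?H (vdiff ?H x y)"
      using bound[OF vdiff_vecs[OF xH y(1)]] adiff[OF xH y(1)] by simp
    also have "\<dots> \<le> (\<bar>K\<bar> + 1) * vnorm ?H (vdiff ?H x y)"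
      by (intro mult_right_mono vnorm_nonneg) auto
    also have "\<dots> < (\<bar>K\<bar> + 1) * (e / (\<bar>K\<bar> + 1))"
      using y(3) by (intro mult_strict_left_mono) auto
    finally show "\<exists>y\<in>W. vnorm ?H (vdiff ?H (a x) y) < e" using y(2) by auto
  qed
  then show "x \<in> {x \<in> vecs ?H. a x \<in> W}" using xH cl by simp
qed

text \<open>The equalizer is the preimage of the zero subspace under a - b, and the zero subspace is
  \<open>supp_space M {}\<close>.\<close>

lemma closed_subspace_equalizer:
  assumes a: "a \<in> bounded_ops (L2 M)" and b: "b \<in> bounded_ops (L2 M)"
  shows "closed_subspace (L2 M) {x \<in> vecs (L2 M). a x = b x}"
proof -
  let ?d = "op_add (L2 M) a (op_scale (L2 M) (- 1) b)"
  have d: "?d \<in> bounded_ops (L2 M)" by (intro op_add_bounded op_scale_bounded a b)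
  obtain K where K: "\<And>x. x \<in> vecs (L2 M) \<Longrightarrow> vnorm (L2 M) (?d x) \<le> K * vnorm (L2 M) x"
    using bounded_ops_bound[OF d] by blast
  have "closed_subspace (L2 M) {x \<in> vecs (L2 M). ?d x \<in> supp_space M {}}"
    by (rule closed_subspace_preimage[where \<kappa> = "\<lambda>c. c" and K = K])
      (use bounded_opsD[OF d] K in \<open>auto intro!: closed_subspace_supp_space\<close>)
  moreover have "?d x \<in> supp_space M {} \<longleftrightarrow> a x = b x" if x: "x \<in> vecs (L2 M)" for x
  proof -
    have ab: "a x \<in> vecs (L2 M)" "b x \<in> vecs (L2 M)" using x a b by (auto intro: bounded_opsD)
    have dx: "?d x = vdiff (L2 M) (a x) (b x)"
      using x by (simp add: op_add_def op_scale_def vdiff_def)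
    have "?d x \<in> supp_space M {} \<longleftrightarrow> (AE y in M. l2_rep (vdiff (L2 M) (a x) (b x)) y = 0)"
      unfolding dx supp_space_def using ab by (simp add: vdiff_vecs)
    also have "\<dots> \<longleftrightarrow> (AE y in M. l2_rep (a x) y = l2_rep (b x) y)"
      using rep_vdiff[OF ab] by (intro eventually_subst) (auto elim: eventually_mono)
    also have "\<dots> \<longleftrightarrow> a x = b x"
      using vecs_eqI[OF ab] by auto
    finally show ?thesis .
  qed
  ultimately show ?thesis by (simp cong: conj_cong)
qed

section \<open>Bounded operators on \<open>\<ell>\<^sup>2\<close> of a countable set\<close>

lemma integrable_count_spaceI:
  fixes f :: "'a \<Rightarrow> real"
  assumes "\<And>x. x \<in> A \<Longrightarrow> 0 \<le> f x" "\<And>K. finite K \<Longrightarrow> K \<subseteq> A \<Longrightarrow> sum f K \<le> B"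
  shows "integrable (count_space A) f"
proof -
  have "f summable_on A"
    using assms by (intro nonneg_bdd_above_summable_on bdd_aboveI[of _ B]) auto
  then have "(\<lambda>x. norm (f x)) summable_on A"
    by (rule summable_on_cong[THEN iffD1, rotated]) (use assms in auto)
  then show ?thesis
    using abs_summable_equivalent[of f A] by (simp add: Infinite_Set_Sum.abs_summable_on_def)
qed

lemma count_space_indicator_l2: "h \<in> A \<Longrightarrow> (indicator {h} :: _ \<Rightarrow> complex) \<in> l2_functions (count_space A)"
proof (rule l2_functionsI)
  assume "h \<in> A"
  show "integrable (count_space A) (\<lambda>x. (cmod (indicator {h} x :: complex))\<^sup>2)"
  proof (rule integrable_count_spaceI[where B = 1])
    fix K :: "'a set" assume "finite K"
    have "(\<Sum>x\<in>K. (cmod (indicator {h} x :: complex))\<^sup>2) = (\<Sum>x\<in>K. if x = h then 1 else 0)"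
      by (intro sum.cong refl) (auto split: split_indicator)
    then show "(\<Sum>x\<in>K. (cmod (indicator {h} x :: complex))\<^sup>2) \<le> 1" using \<open>finite K\<close> by simp
  qed simp
qed simp

lemma count_space_class_eq_iff:
  assumes "f \<in> l2_functions (count_space A)" "g \<in> l2_functions (count_space A)"
  shows "l2_class (count_space A) f = l2_class (count_space A) g \<longleftrightarrow> (\<forall>x\<in>A. f x = g x)"
  using l2_class_eq_iff[OF assms] by (simp add: AE_count_space)

text \<open>An injective enumeration of A serves as label: each value singles out at most one point
  h, so each piece is a multiple of the indicator of h or zero.\<close>

lemma l2_count_space_spanned:
  assumes A: "countable A" and W: "closed_subspace (L2 (count_space A)) W"
    and \<delta>: "\<And>h. h \<in> A \<Longrightarrow> l2_class (count_space A) (indicator {h}) \<in> W"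
  shows "vecs (L2 (count_space A)) \<subseteq> W"
proof
  let ?N = "count_space A"
  have lin: "lin_subspace (L2 ?N) W" using W by (simp add: closed_subspace_def)
  fix u assume u: "u \<in> vecs (L2 ?N)"
  let ?f = "l2_rep u"
  have "l2_class ?N ?f \<in> W"
  proof (rule closed_subspace_level_sets[OF W vecs_rep(1)[OF u], of "to_nat_on A"])
    fix n
    show "l2_class ?N (\<lambda>x. ?f x * of_bool (to_nat_on A x = n)) \<in> W"
    proof (cases "\<exists>h\<in>A. to_nat_on A h = n")
      case True
      then obtain h where h: "h \<in> A" "to_nat_on A h = n" by blast
      have "l2_class ?N (\<lambda>x. ?f x * of_bool (to_nat_on A x = n))
          = l2_class ?N (\<lambda>x. ?f h * indicator {h} x)"
        using h A inj_on_to_nat_on[OF A]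
        by (intro l2_class_cong_AE) (auto simp: AE_count_space inj_on_def)
      also have "\<dots> = vscale (L2 ?N) (?f h) (l2_class ?N (indicator {h}))"
        by (rule vscale_class[symmetric, OF count_space_indicator_l2[OF h(1)]])
      also have "\<dots> \<in> W" using lin \<delta>[OF h(1)] by (simp add: lin_subspace_def)
      finally show ?thesis .
    next
      case False
      then have "l2_class ?N (\<lambda>x. ?f x * of_bool (to_nat_on A x = n)) = l2_class ?N (\<lambda>x. 0)"
        by (intro l2_class_cong_AE) (auto simp: AE_count_space)
      then show ?thesis using zero_in_subspace[OF lin] by simp
    qed
  qed simp
  then show "u \<in> W" using vecs_rep(2)[OF u] by simp
qed

text \<open>
  The adjoint is given by its matrix entries \<open>(a\<^sup>* x)(h) = \<langle>a \<delta>\<^sub>h, x\<rangle>\<close>, so that no completeness of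
  \<open>\<ell>\<^sup>2\<close> is needed.
\<close>

lemma l2_count_space_adjoint:
  assumes A: "countable A" and a: "a \<in> bounded_ops (L2 (count_space A))"
  obtains b where "b \<in> bounded_ops (L2 (count_space A))"
    "\<And>x y. x \<in> vecs (L2 (count_space A)) \<Longrightarrow> y \<in> vecs (L2 (count_space A)) \<Longrightarrow>
      vinner (L2 (count_space A)) (b x) y = vinner (L2 (count_space A)) x (a y)"
proof -
  let ?N = "count_space A"
  let ?H = "L2 ?N"
  define \<delta> :: "'a \<Rightarrow> ('a \<Rightarrow> complex) set" where "\<delta> h = l2_class ?N (indicator {h})" for h
  define c where "c x h = vinner ?H (a (\<delta> h)) x" for x h
  have \<delta>: "\<delta> h \<in> vecs ?H" if "h \<in> A" for h
    unfolding \<delta>_def using count_space_indicator_l2[OF that] by blast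
  note av = bounded_opsD(2)[OF a] and aadd = bounded_opsD(3)[OF a] and asc = bounded_opsD(4)[OF a]
  obtain L where L: "L > 0" "\<And>x. x \<in> vecs ?H \<Longrightarrow> vnorm ?H (a x) \<le> L * vnorm ?H x"
    using bounded_ops_bound[OF a] by blast
  \<comment> \<open>A Bessel-type bound. If y is the truncation of \<open>c x\<close> to K and s its
    norm, then \<open>s\<^sup>2\<close> equals \<langle>x, a y\<rangle>, which is at most |x| L s by
    Cauchy-Schwarz; one factor s cancels.\<close>
  have fin: "(\<Sum>h\<in>K. (cmod (c x h))\<^sup>2) \<le> (L * vnorm ?H x)\<^sup>2"
    if x: "x \<in> vecs ?H" and K: "finite K" "K \<subseteq> A" for x K
  proof -
    define y where "y K = l2_class ?N (\<lambda>h. c x h * of_bool (h \<in> K))" for K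
    have l2: "(\<lambda>h. c x h * of_bool (h \<in> K)) \<in> l2_functions ?N"
      if "finite K" "K \<subseteq> A" for K
    proof (rule l2_functionsI)
      show "integrable ?N (\<lambda>h. (cmod (c x h * of_bool (h \<in> K)))\<^sup>2)"
      proof (rule integrable_count_spaceI[where B = "\<Sum>h\<in>K. (cmod (c x h))\<^sup>2"])
        fix K' assume "finite K'" "K' \<subseteq> A"
        have "(\<Sum>h\<in>K'. (cmod (c x h * of_bool (h \<in> K)))\<^sup>2) = (\<Sum>h\<in>K' \<inter> K. (cmod (c x h))\<^sup>2)"
          using \<open>finite K'\<close> by (intro sum.mono_neutral_cong_right) auto
        also have "\<dots> \<le> (\<Sum>h\<in>K. (cmod (c x h))\<^sup>2)" using that by (intro sum_mono2) auto
        finally show "(\<Sum>h\<in>K'. (cmod (c x h * of_bool (h \<in> K)))\<^sup>2) \<le> (\<Sum>h\<in>K. (cmod (c x h))\<^sup>2)" .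
      qed simp
    qed simp
    \<comment> \<open>Linearity of \<open>a\<close> is available for two summands at a time, so the
      truncation is built up by one basis vector per step; orthonormality of the basis vectors gives
      the norm.\<close>
    have "y K \<in> vecs ?H \<and> vinner ?H x (a (y K)) = of_real (\<Sum>h\<in>K. (cmod (c x h))\<^sup>2)
        \<and> vinner ?H (y K) (y K) = of_real (\<Sum>h\<in>K. (cmod (c x h))\<^sup>2)"
      if "finite K" "K \<subseteq> A" for K
      using that
    proof (induction K)
      case empty
      have z: "l2_class ?N (\<lambda>h. 0) \<in> vecs ?H" using l2_functions_zero by blast
      have "vscale ?H 0 (l2_class ?N (\<lambda>h. 0)) = l2_class ?N (\<lambda>h. 0)"
        by (subst vscale_class[OF l2_functions_zero]) simp
      then have "vinner ?H x (a (l2_class ?N (\<lambda>h. 0))) = 0"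
        using asc[OF z, of 0] vinner_vscale_right[OF x av[OF z], of 0] by simp
      then show ?case using z by (simp add: y_def vinner_class l2_functions_zero)
    next
      case (insert h K)
      have h: "h \<in> A" and KA: "K \<subseteq> A" using insert.prems by auto
      note IH = insert.IH[OF KA]
      have cx: "vscale ?H (c x h) (\<delta> h) \<in> vecs ?H" using \<delta>[OF h] by blast
      have "y (insert h K) = l2_class ?N (\<lambda>i. c x i * of_bool (i \<in> K) + c x h * indicator {h} i)"
        unfolding y_def using insert.hyps
        by (intro l2_class_cong_AE AE_I2) (auto split: split_indicator)
      also have "\<dots> = vadd ?H (y K) (vscale ?H (c x h) (\<delta> h))"
        unfolding y_def \<delta>_def vscale_class[OF count_space_indicator_l2[OF h]]
        by (rule vadd_class[symmetric, OF l2[OF insert.hyps(1) KA]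
            l2_functions_scale[OF count_space_indicator_l2[OF h]]])
      finally have y: "y (insert h K) = vadd ?H (y K) (vscale ?H (c x h) (\<delta> h))" .
      have "vinner ?H x (a (y (insert h K)))
          = vinner ?H x (a (y K)) + c x h * vinner ?H x (a (\<delta> h))"
        unfolding y using IH \<delta>[OF h] x cx av
        by (simp add: aadd asc vinner_vadd_right vinner_vscale_right vscale_vecs)
      also have "vinner ?H x (a (\<delta> h)) = cnj (c x h)"
        unfolding c_def by (rule vinner_cnj)
      finally have 1: "vinner ?H x (a (y (insert h K)))
          = of_real (\<Sum>h\<in>insert h K. (cmod (c x h))\<^sup>2)"
        using IH insert.hyps by (simp add: complex_norm_square[symmetric] del: of_real_power)
      have orth: "vinner ?H (y K) (\<delta> h) = 0"
      proof -
        have "vinner ?H (y K) (\<delta> h)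
            = (LINT i|?N. cnj (c x i * of_bool (i \<in> K)) * indicator {h} i)"
          unfolding y_def \<delta>_def
          by (rule vinner_class[OF l2[OF insert.hyps(1) KA] count_space_indicator_l2[OF h]])
        also have "\<dots> = (LINT i|?N. 0)"
          using insert.hyps by (intro Bochner_Integration.integral_cong) (auto split: split_indicator)
        finally show ?thesis by simp
      qed
      have one: "vinner ?H (\<delta> h) (\<delta> h) = 1"
      proof -
        have "vinner ?H (\<delta> h) (\<delta> h) = (LINT i|?N. indicator {h} i)"
          unfolding \<delta>_def
          by (subst vinner_class[OF count_space_indicator_l2[OF h] count_space_indicator_l2[OF h]])
            (auto intro!: Bochner_Integration.integral_cong split: split_indicator)
        also have "\<dots> = (LINT i|?N. complex_of_real (indicator {h} i))"
          by (intro Bochner_Integration.integral_cong) (auto split: split_indicator)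
        also have "\<dots> = 1" using h by simp
        finally show ?thesis .
      qed
      let ?cd = "vscale ?H (c x h) (\<delta> h)"
      have yK: "y K \<in> vecs ?H" using IH by blast
      have yv: "y (insert h K) \<in> vecs ?H" unfolding y using yK cx by blast
      have i1: "vinner ?H (y K) (y (insert h K)) = vinner ?H (y K) (y K)"
        unfolding y vinner_vadd_right[OF yK yK cx] vinner_vscale_right[OF yK \<delta>[OF h]] orth by simp
      have i2: "vinner ?H (\<delta> h) (y (insert h K)) = c x h"
        unfolding y vinner_vadd_right[OF \<delta>[OF h] yK cx] vinner_vscale_right[OF \<delta>[OF h] \<delta>[OF h]] one
        using vinner_cnj[of ?N "\<delta> h" "y K"] orth by simp
      have "vinner ?H (y (insert h K)) (y (insert h K))
          = vinner ?H (y (insert h K)) (y K) + c x h * vinner ?H (y (insert h K)) (\<delta> h)"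
        by (subst (2) y) (simp only: vinner_vadd_right[OF yv yK cx] vinner_vscale_right[OF yv \<delta>[OF h]])
      also have "\<dots> = cnj (vinner ?H (y K) (y K)) + c x h * cnj (c x h)"
        using vinner_cnj[of ?N "y (insert h K)" "y K"] vinner_cnj[of ?N "y (insert h K)" "\<delta> h"] i1 i2
        by simp
      finally have 2: "vinner ?H (y (insert h K)) (y (insert h K))
          = of_real (\<Sum>h\<in>insert h K. (cmod (c x h))\<^sup>2)"
        using IH insert.hyps by (simp add: complex_norm_square[symmetric] del: of_real_power)
      show ?case using 1 2 yv by blast
    qed
    from this[OF K] have y: "y K \<in> vecs ?H"
      "vinner ?H x (a (y K)) = of_real (\<Sum>h\<in>K. (cmod (c x h))\<^sup>2)"
      "vinner ?H (y K) (y K) = of_real (\<Sum>h\<in>K. (cmod (c x h))\<^sup>2)" by auto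
    define s where "s = vnorm ?H (y K)"
    have s2: "(\<Sum>h\<in>K. (cmod (c x h))\<^sup>2) = s\<^sup>2"
      using y(3) unfolding vinner_self s_def of_real_eq_iff by simp
    have s0: "0 \<le> s" unfolding s_def by (rule vnorm_nonneg)
    have "s\<^sup>2 \<le> vnorm ?H x * vnorm ?H (a (y K))"
      using cauchy_schwarz_l2[OF x av[OF y(1)]] unfolding y(2) s2 norm_of_real by simp
    also have "\<dots> \<le> vnorm ?H x * (L * s)"
      unfolding s_def using L(2)[OF y(1)] by (intro mult_left_mono vnorm_nonneg)
    finally have "s * s \<le> s * (L * vnorm ?H x)" by (simp add: power2_eq_square mult_ac)
    then have "s \<le> L * vnorm ?H x"
      using s0 L(1) vnorm_nonneg[of ?N x] by (cases "s = 0") auto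
    then show ?thesis unfolding s2 using s0 by (intro power_mono)
  qed
  have cl2: "c x \<in> l2_functions ?N" if "x \<in> vecs ?H" for x
    using fin[OF that] by (intro l2_functionsI integrable_count_spaceI) auto
  define b where "b = (\<lambda>x\<in>vecs ?H. l2_class ?N (c x))"
  have bx: "b x = l2_class ?N (c x)" "b x \<in> vecs ?H" if "x \<in> vecs ?H" for x
    unfolding b_def using that cl2[OF that] by auto
  have adj: "vinner ?H (b x) y = vinner ?H x (a y)" if x: "x \<in> vecs ?H" and "y \<in> vecs ?H" for x y
  proof -
    \<comment> \<open>Both sides are continuous in y, so the identity holds on a closed subspace; on
      a basis vector it is the definition of \<open>c\<close>.\<close>
    define W where "W = {y \<in> vecs ?H. vinner ?H (b x) y = vinner ?H x (a y)}"
    note b = bx(2)[OF x]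
    have "closed_subspace ?H W"
    proof (rule closed_subspaceI)
      have "vinner ?H (b x) (l2_class ?N (\<lambda>h. 0)) = vinner ?H x (a (l2_class ?N (\<lambda>h. 0)))"
      proof -
        have z: "l2_class ?N (\<lambda>h. 0) \<in> vecs ?H" using l2_functions_zero by blast
        have s: "vscale ?H 0 (l2_class ?N (\<lambda>h. 0)) = l2_class ?N (\<lambda>h. 0)"
          by (subst vscale_class[OF l2_functions_zero]) simp
        show ?thesis
          using asc[OF z, of 0] vinner_vscale_right[OF x av[OF z], of 0]
            vinner_vscale_right[OF b z, of 0] s by simp
      qed
      then have "l2_class ?N (\<lambda>h. 0) \<in> W" using l2_functions_zero by (auto simp: W_def)
      then show "lin_subspace ?H W"
        unfolding lin_subspace_def W_def using b x av
        by (auto simp: vinner_vadd_right vinner_vscale_right aadd asc vadd_vecs vscale_vecs)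
      fix y assume y: "y \<in> vclosure ?H W"
      then have yv: "y \<in> vecs ?H" by (simp add: vclosure_def)
      \<comment> \<open>A Lipschitz constant in y for the difference of the two sides. Dividing by
        \<open>?C + 1\<close> below avoids a zero denominator.\<close>
      let ?C = "vnorm ?H (b x) + vnorm ?H x * L"
      have "cmod (vinner ?H (b x) y - vinner ?H x (a y)) \<le> e" if "e > 0" for e
      proof -
        have C: "?C \<ge> 0" 
          using L(1) vnorm_nonneg[of ?N "b x"] vnorm_nonneg[of ?N x] by simp
        then have "e / (?C + 1) > 0" using \<open>e > 0\<close> by simp
        then obtain z where z: "z \<in> W" "vnorm ?H (vdiff ?H y z) < e / (?C + 1)"
          using vclosureE[OF y] by blast
        then have zv: "z \<in> vecs ?H" and eq: "vinner ?H (b x) z = vinner ?H x (a z)"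
          by (auto simp: W_def)
        let ?d = "vdiff ?H y z"
        have d: "?d \<in> vecs ?H" using yv zv by blast
        have ad: "a ?d = vdiff ?H (a y) (a z)"
          unfolding vdiff_def using yv zv by (simp add: aadd asc vscale_vecs)
        have "vinner ?H (b x) y - vinner ?H x (a y) = vinner ?H (b x) ?d - vinner ?H x (a ?d)"
          unfolding ad vinner_vdiff_right[OF b yv zv] vinner_vdiff_right[OF x av[OF yv] av[OF zv]] eq
          by simp
        also have "cmod \<dots> \<le> vnorm ?H (b x) * vnorm ?H ?d + vnorm ?H x * (L * vnorm ?H ?d)"
          using cauchy_schwarz_l2[OF b d] cauchy_schwarz_l2[OF x av[OF d]]
            mult_left_mono[OF L(2)[OF d] vnorm_nonneg[of ?N x]]
            norm_triangle_ineq4[of "vinner ?H (b x) ?d" "vinner ?H x (a ?d)"] by linarith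
        also have "\<dots> = ?C * vnorm ?H ?d" by (simp add: algebra_simps)
        also have "\<dots> \<le> ?C * (e / (?C + 1))" using z(2) C by (intro mult_left_mono) auto
        also have "\<dots> \<le> e" using C \<open>e > 0\<close> by (simp add: field_simps)
        finally show ?thesis .
      qed
      then have "cmod (vinner ?H (b x) y - vinner ?H x (a y)) \<le> 0"
        by (rule field_le_epsilon) simp
      then show "y \<in> W" using yv by (simp add: W_def)
    qed
    then have "vecs ?H \<subseteq> W"
    proof (rule l2_count_space_spanned[OF A])
      fix h assume h: "h \<in> A"
      have "vinner ?H (b x) (\<delta> h) = (LINT i|?N. cnj (c x i) * indicator {h} i)"
        unfolding bx(1)[OF x] \<delta>_def
        by (rule vinner_class[OF cl2[OF x] count_space_indicator_l2[OF h]])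
      also have "\<dots> = (LINT i|?N. cnj (c x h) * complex_of_real (indicator {h} i))"
        by (intro Bochner_Integration.integral_cong) (auto split: split_indicator)
      also have "\<dots> = cnj (c x h)" using h by simp
      also have "\<dots> = vinner ?H x (a (\<delta> h))" unfolding c_def by (rule vinner_cnj[symmetric])
      finally show "l2_class ?N (indicator {h}) \<in> W"
        using \<delta>[OF h] by (simp add: W_def \<delta>_def)
    qed
    then show ?thesis using \<open>y \<in> vecs ?H\<close> by (auto simp: W_def)
  qed
  have "b \<in> bounded_ops ?H"
  proof (rule bounded_opsI[where K = L])
    show "linear_op ?H b"
      unfolding linear_op_def
    proof (intro conjI ballI allI)
      show "b \<in> vecs ?H \<rightarrow>\<^sub>E vecs ?H" using bx by (auto simp: b_def)
      have cadd: "c (vadd ?H x y) h = c x h + c y h" if "x \<in> vecs ?H" "y \<in> vecs ?H" "h \<in> A" for x y h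
        unfolding c_def by (rule vinner_vadd_right[OF av[OF \<delta>[OF that(3)]] that(1,2)])
      have csc: "c (vscale ?H r x) h = r * c x h" if "x \<in> vecs ?H" "h \<in> A" for x r h
        unfolding c_def by (rule vinner_vscale_right[OF av[OF \<delta>[OF that(2)]] that(1)])
      show "b (vadd ?H x y) = vadd ?H (b x) (b y)" if "x \<in> vecs ?H" "y \<in> vecs ?H" for x y
        using that bx[of x] bx[of y] bx[of "vadd ?H x y"] vadd_class[OF cl2 cl2, of x y]
        by (auto simp: vadd_vecs cadd AE_count_space intro!: l2_class_cong_AE)
      show "b (vscale ?H r x) = vscale ?H r (b x)" if "x \<in> vecs ?H" for x r
        using that bx[of x] bx[of "vscale ?H r x"] vscale_class[OF cl2, of x r]
        by (auto simp: vscale_vecs csc AE_count_space intro!: l2_class_cong_AE)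
    qed
    fix x assume x: "x \<in> vecs ?H"
    note b = bx(2)[OF x]
    \<comment> \<open>The adjoint identity at y = b x expresses the squared norm of b x as
      \<langle>x, a (b x)\<rangle>, and one factor \<open>?n\<close> cancels from the
      estimate.\<close>
    let ?n = "vnorm ?H (b x)"
    have "?n\<^sup>2 = cmod (vinner ?H x (a (b x)))"
      unfolding adj[OF x b, symmetric] vinner_self by (simp only: norm_of_real abs_power2)
    also have "\<dots> \<le> vnorm ?H x * (L * ?n)"
      using cauchy_schwarz_l2[OF x av[OF b]] mult_left_mono[OF L(2)[OF b] vnorm_nonneg[of ?N x]]
      by linarith
    finally have "?n * ?n \<le> ?n * (L * vnorm ?H x)" by (simp add: power2_eq_square mult_ac)
    then show "?n \<le> L * vnorm ?H x"
      using vnorm_nonneg[of ?N "b x"] vnorm_nonneg[of ?N x] L(1) by (cases "?n = 0") auto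
  qed
  with adj that show thesis by blast
qed

text \<open>The substance is closure under adjoints. The double commutant condition is immediate: a
  bounded operator commutes with whatever commutes with all bounded operators.\<close>

lemma vn_algebra_bounded_ops:
  assumes A: "countable A"
  shows "vn_algebra (L2 (count_space A)) (bounded_ops (L2 (count_space A)))"
  unfolding vn_algebra_def
proof (intro conjI ballI)
  let ?H = "L2 (count_space A)"
  fix a assume a: "a \<in> bounded_ops ?H"
  obtain b where b: "b \<in> bounded_ops ?H"
    "\<And>x y. x \<in> vecs ?H \<Longrightarrow> y \<in> vecs ?H \<Longrightarrow> vinner ?H (b x) y = vinner ?H x (a y)"
    using l2_count_space_adjoint[OF A a] by blast
  show "op_adj ?H a \<in> bounded_ops ?H" using op_adj_eqI[OF b] b(1) by simp
qed (auto simp: op_commutant_def)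

section \<open>Translations and the automorphism of the group von Neumann algebra\<close>

lemma preserves_measure_count_space:
  assumes "bij_betw \<sigma> A A"
  shows "preserves_measure (count_space A) \<sigma>"
  using assms distr_bij_count_space[OF assms]
  by (auto simp: preserves_measure_def bij_betw_def)

locale countable_group_aut = group G for G :: "('g, 'm) monoid_scheme" (structure) +
  fixes T :: "'g \<Rightarrow> 'g"
  assumes countable_carrier: "countable (carrier G)"
    and T_iso: "T \<in> iso G G"
begin

abbreviation "N \<equiv> count_space (carrier G)"

text \<open>The operator z l(g). The scalar is built in because the fibres of b \<otimes> l(g) are
  the operators b(p) l(g), and positive and negative powers of \<gamma> are evaluated directly on
  these.\<close>

definition trans_op :: "complex \<Rightarrow> 'g \<Rightarrow> ('g \<Rightarrow> complex) set \<Rightarrow> ('g \<Rightarrow> complex) set" where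
  "trans_op z g = comp_op N (\<lambda>_. z) (\<lambda>h. inv g \<otimes> h)"

abbreviation "T_inv \<equiv> inv_into (carrier G) T"

lemma bij_T: "bij_betw T (carrier G) (carrier G)"
  using T_iso by (simp add: iso_def)

lemma T_closed: "g \<in> carrier G \<Longrightarrow> T g \<in> carrier G"
  using bij_T by (auto simp: bij_betw_def)

lemma T_inv_closed: "g \<in> carrier G \<Longrightarrow> T_inv g \<in> carrier G"
  using bij_betw_inv_into[OF bij_T] by (auto simp: bij_betw_def)

lemma T_T_inv: "g \<in> carrier G \<Longrightarrow> T (T_inv g) = g"
  using bij_T by (simp add: bij_betw_inv_into_right)

lemma T_inv_T: "g \<in> carrier G \<Longrightarrow> T_inv (T g) = g"
  using bij_T by (simp add: bij_betw_inv_into_left)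

lemma T_mult: "g \<in> carrier G \<Longrightarrow> h \<in> carrier G \<Longrightarrow> T (g \<otimes> h) = T g \<otimes> T h"
  using T_iso by (simp add: iso_def hom_mult)

lemma group_hom_T: "group_hom G G T"
  using T_iso is_group by (simp add: group_hom_def group_hom_axioms_def iso_def)

lemma T_invers: "g \<in> carrier G \<Longrightarrow> T (inv g) = inv (T g)"
  using group_hom.hom_inv[OF group_hom_T] .

lemma T_one: "T \<one> = \<one>"
  using group_hom.hom_one[OF group_hom_T] .

lemma bij_translation: "g \<in> carrier G \<Longrightarrow> bij_betw (\<lambda>h. inv g \<otimes> h) (carrier G) (carrier G)"
  by (rule bij_betwI[where g = "\<lambda>h. g \<otimes> h"]) (auto simp: m_assoc[symmetric])

lemma pm_translation: "g \<in> carrier G \<Longrightarrow> preserves_measure N (\<lambda>h. inv g \<otimes> h)"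
  by (intro preserves_measure_count_space bij_translation)

lemma pm_T: "preserves_measure N T" and pm_T_inv: "preserves_measure N T_inv"
  using bij_T bij_betw_inv_into[OF bij_T] by (auto intro: preserves_measure_count_space)

lemma left_translation_eq: "left_translation G g = trans_op 1 g"
  by (simp add: left_translation_def trans_op_def comp_op_def)

lemma trans_op_bounded: "g \<in> carrier G \<Longrightarrow> trans_op z g \<in> bounded_ops (L2 N)"
  unfolding trans_op_def by (intro comp_op_bounded Linfty_const pm_translation)

lemma trans_op_scale:
  assumes "g \<in> carrier G"
  shows "trans_op z g = op_scale (L2 N) z (trans_op 1 g)"
  unfolding op_scale_def trans_op_def[of z] comp_op_def[of N "\<lambda>_. z"]
proof (rule restrict_ext)
  fix u assume u: "u \<in> vecs (L2 N)"
  note l2 = l2_functions_comp[OF pm_translation[OF assms] vecs_rep(1)[OF u]]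
  have "trans_op 1 g u = l2_class N (\<lambda>h. l2_rep u (inv g \<otimes> h))"
    using u by (simp add: trans_op_def comp_op_def)
  then show "l2_class N (\<lambda>h. z * l2_rep u (inv g \<otimes> h)) = vscale (L2 N) z (trans_op 1 g u)"
    using vscale_class[OF l2] by simp
qed

lemma trans_op_in_group_vn:
  assumes g: "g \<in> carrier G"
  shows "trans_op z g \<in> group_vn G"
proof -
  have "trans_op 1 g \<in> group_vn G"
    unfolding group_vn_def left_translation_eq[symmetric]
    using vn_generated_superset g by blast
  then show ?thesis
    unfolding trans_op_scale[OF g, of z] group_vn_def using vn_generated_closed(3) by blast
qed

text \<open>
  An intersection over no von Neumann algebra at all would be \<open>UNIV\<close>; the algebra of all bounded
  operators rules this out.
\<close>

lemma group_vn_bounded: "group_vn G \<subseteq> bounded_ops (L2 N)"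
proof -
  have "left_translation G ` carrier G \<subseteq> bounded_ops (L2 N)"
    using trans_op_bounded by (auto simp: left_translation_eq)
  then show ?thesis
    unfolding group_vn_def vn_generated_def
    using vn_algebra_bounded_ops[OF countable_carrier] by blast
qed

abbreviation "u_T \<equiv> comp_op N (\<lambda>_. 1) T"
abbreviation "u_T_inv \<equiv> comp_op N (\<lambda>_. 1) T_inv"

lemma gamma_eq: "gamma G T c = op_mult (L2 N) u_T (op_mult (L2 N) c u_T_inv)"
proof -
  have u: "U_gamma G T = u_T" by (simp add: U_gamma_def comp_op_def)
  have "op_adj (L2 N) u_T = u_T_inv"
    using op_adj_comp_op[OF Linfty_const pm_T pm_T_inv, of 1] T_inv_T by simp
  then show ?thesis by (simp add: gamma_def Let_def u)
qed

lemma u_T_closed: "x \<in> vecs (L2 N) \<Longrightarrow> u_T x \<in> vecs (L2 N)"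
  by (rule comp_op_vecs[OF Linfty_const pm_T])

lemma comp_op_one_id: "x \<in> vecs (L2 N) \<Longrightarrow> comp_op N (\<lambda>_. 1) (\<lambda>h. h) x = x"
  by (simp add: comp_op_def vecs_rep)

lemma u_T_inverse:
  assumes "x \<in> vecs (L2 N)"
  shows "u_T_inv (u_T x) = x" "u_T (u_T_inv x) = x"
proof -
  have "op_mult (L2 N) u_T_inv u_T = comp_op N (\<lambda>_. 1) (\<lambda>h. h)"
    unfolding op_mult_comp_op[OF Linfty_const pm_T_inv Linfty_const pm_T] mult_1
    by (rule comp_op_cong[OF preserves_measure_comp[OF pm_T pm_T_inv]]) (simp_all add: T_T_inv)
  from fun_cong[OF this, of x] show "u_T_inv (u_T x) = x"
    using assms comp_op_one_id[OF assms] by (simp add: op_mult_def)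
  have "op_mult (L2 N) u_T u_T_inv = comp_op N (\<lambda>_. 1) (\<lambda>h. h)"
    unfolding op_mult_comp_op[OF Linfty_const pm_T Linfty_const pm_T_inv] mult_1
    by (rule comp_op_cong[OF preserves_measure_comp[OF pm_T_inv pm_T]]) (simp_all add: T_inv_T)
  from fun_cong[OF this, of x] show "u_T (u_T_inv x) = x"
    using assms comp_op_one_id[OF assms] by (simp add: op_mult_def)
qed

text \<open>Negative powers of \<gamma> use \<open>inv_into\<close>, which inverts only where
  \<gamma> is injective. Undoing the conjugation by the unitary recovers an operator on the carrier;
  membership in \<open>bounded_ops\<close> makes it extensional, so that it is recovered as a
  function.\<close>

lemma inj_gamma: "inj_on (gamma G T) (group_vn G)"
proof (rule inj_onI)
  fix c d assume "c \<in> group_vn G" "d \<in> group_vn G" and eq: "gamma G T c = gamma G T d"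
  then have c: "c \<in> bounded_ops (L2 N)" and d: "d \<in> bounded_ops (L2 N)"
    using group_vn_bounded by auto
  show "c = d"
  proof (rule op_eqI[OF bounded_opsD(1)[OF c] bounded_opsD(1)[OF d]])
    fix x assume x: "x \<in> vecs (L2 N)"
    have "u_T (c (u_T_inv (u_T x))) = u_T (d (u_T_inv (u_T x)))"
      using fun_cong[OF eq, of "u_T x"] u_T_closed[OF x]
      by (simp add: gamma_eq op_mult_def)
    then have "u_T_inv (u_T (c x)) = u_T_inv (u_T (d x))" using u_T_inverse(1)[OF x] by simp
    then show "c x = d x" using u_T_inverse(1) bounded_opsD(2)[OF c x] bounded_opsD(2)[OF d x] by simp
  qed
qed

text \<open>\<open>U_gamma\<close> is f \<mapsto> f \<circ> T and so moves the indicator of h to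
  that of T^{-1} h, which is the source of the inverse. On points the conjugated translation is h
  \<mapsto> T^{-1}(g^{-1} T(h)), equal to (T^{-1} g)^{-1} h because T is a homomorphism.\<close>

lemma gamma_trans_op:
  assumes g: "g \<in> carrier G"
  shows "gamma G T (trans_op z g) = trans_op z (T_inv g)"
proof -
  have "gamma G T (trans_op z g) = comp_op N (\<lambda>_. z) (\<lambda>h. T_inv (inv g \<otimes> T h))"
    unfolding gamma_eq trans_op_def
    by (simp add: op_mult_comp_op Linfty_const pm_T pm_T_inv pm_translation[OF g]
        preserves_measure_comp[OF pm_T_inv pm_translation[OF g]])
  also have "\<dots> = trans_op z (T_inv g)"
    unfolding trans_op_def
  proof (rule comp_op_cong)
    show "preserves_measure N (\<lambda>h. T_inv (inv g \<otimes> T h))"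
      by (rule preserves_measure_comp[OF pm_T_inv preserves_measure_comp[OF pm_translation[OF g] pm_T]])
    fix h assume "h \<in> space N"
    then have h: "h \<in> carrier G" by simp
    have "inv g \<otimes> T h = T (inv (T_inv g) \<otimes> h)"
      using g h by (simp add: T_mult T_invers T_inv_closed T_T_inv)
    then show "T_inv (inv g \<otimes> T h) = inv (T_inv g) \<otimes> h"
      using g h by (simp add: T_inv_T T_inv_closed)
  qed simp
  finally show ?thesis .
qed

lemma inv_gamma_trans_op:
  assumes g: "g \<in> carrier G"
  shows "inv_into (group_vn G) (gamma G T) (trans_op z g) = trans_op z (T g)"
  using gamma_trans_op[OF T_closed[OF g], of z] T_inv_T[OF g]
    inv_into_f_f[OF inj_gamma trans_op_in_group_vn[OF T_closed[OF g]], of z] by simp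

section \<open>Integer powers of T, invariant sets and orbits\<close>

lemma funpow_T_closed:
  assumes "g \<in> carrier G"
  shows "(T ^^ n) g \<in> carrier G" "(T_inv ^^ n) g \<in> carrier G"
  using assms by (induction n) (auto simp: T_closed T_inv_closed)

lemma int_pow_T_closed: "g \<in> carrier G \<Longrightarrow> int_pow_on (carrier G) T n g \<in> carrier G"
  by (simp add: int_pow_on_def funpow_T_closed)

lemma int_pow_gamma_trans_op:
  assumes g: "g \<in> carrier G"
  shows "int_pow_on (group_vn G) (gamma G T) n (trans_op z g)
    = trans_op z (int_pow_on (carrier G) T (- n) g)"
proof -
  have "(gamma G T ^^ m) (trans_op z g) = trans_op z ((T_inv ^^ m) g)" for m
    by (induction m) (simp_all add: gamma_trans_op funpow_T_closed g)
  moreover have "(inv_into (group_vn G) (gamma G T) ^^ m) (trans_op z g) = trans_op z ((T ^^ m) g)" for m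
    by (induction m) (simp_all add: inv_gamma_trans_op funpow_T_closed g)
  ultimately show ?thesis by (auto simp: int_pow_on_def)
qed

text \<open>An equivalence rather than an implication, so that invariance passes to complements and
  to negative powers. Only points of the carrier are tested, hence the complement may be taken in
  the whole type.\<close>

definition T_invariant :: "'g set \<Rightarrow> bool" where
  "T_invariant E \<longleftrightarrow> (\<forall>g\<in>carrier G. T g \<in> E \<longleftrightarrow> g \<in> E)"

lemma T_invariant_Compl: "T_invariant E \<Longrightarrow> T_invariant (- E)"
  by (auto simp: T_invariant_def)

lemma T_invariant_int_pow:
  assumes E: "T_invariant E" and g: "g \<in> carrier G"
  shows "int_pow_on (carrier G) T n g \<in> E \<longleftrightarrow> g \<in> E"
proof -
  have "(T ^^ m) g \<in> E \<longleftrightarrow> g \<in> E" for m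
    using E funpow_T_closed(1)[OF g] by (induction m) (auto simp: T_invariant_def)
  moreover have "(T_inv ^^ m) g \<in> E \<longleftrightarrow> g \<in> E" for m
  proof (induction m)
    case (Suc m)
    have "T ((T_inv ^^ Suc m) g) = (T_inv ^^ m) g"
      using funpow_T_closed(2)[OF g, of m] by (simp add: T_T_inv)
    then show ?case using E Suc funpow_T_closed(2)[OF g, of "Suc m"] by (metis T_invariant_def)
  qed simp
  ultimately show ?thesis by (simp add: int_pow_on_def)
qed

lemma T_invariant_one: "T_invariant {\<one>}"
  unfolding T_invariant_def using T_one T_inv_T one_closed by (metis singletonD singletonI)

definition T_orbit :: "'g \<Rightarrow> 'g set" where
  "T_orbit g = range (\<lambda>n. int_pow_on (carrier G) T n g)"

lemma T_orbit_self: "g \<in> T_orbit g"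
  unfolding T_orbit_def by (rule range_eqI[of _ _ 0]) (simp add: int_pow_on_def)

lemma T_orbit_carrier: "g \<in> carrier G \<Longrightarrow> T_orbit g \<subseteq> carrier G"
  by (auto simp: T_orbit_def int_pow_T_closed)

lemma int_pow_T_Suc:
  assumes g: "g \<in> carrier G"
  shows "int_pow_on (carrier G) T (n + 1) g = T (int_pow_on (carrier G) T n g)"
proof (cases "n \<ge> 0")
  case True
  then have "nat (n + 1) = Suc (nat n)" by simp
  then show ?thesis using True by (simp add: int_pow_on_def)
next
  case False
  define m where "m = nat (- n - 1)"
  have n: "nat (- n) = Suc m" using False by (simp add: m_def)
  have "int_pow_on (carrier G) T (n + 1) g = (T_inv ^^ m) g"
  \<comment> \<open>At n = -1 the exponent n + 1 = 0 falls into the nonnegative branch of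
    \<open>int_pow_on\<close>; for smaller n both exponents are negative and one application of
    \<open>T_inv\<close> is cancelled.\<close>
  proof (cases "n = - 1")
    case False
    moreover have "- (n + 1) = - n - 1" by simp
    ultimately show ?thesis using \<open>\<not> n \<ge> 0\<close> unfolding int_pow_on_def m_def by simp
  qed (simp add: int_pow_on_def m_def)
  then show ?thesis
    using False n T_T_inv[OF funpow_T_closed(2)[OF g, of m]] by (simp add: int_pow_on_def)
qed

lemma T_invariant_orbit:
  assumes g: "g \<in> carrier G"
  shows "T_invariant (T_orbit g)"
  unfolding T_invariant_def
proof (intro ballI iffI)
  fix h assume h: "h \<in> carrier G"
  {
    assume "h \<in> T_orbit g"
    then obtain n where "h = int_pow_on (carrier G) T n g" by (auto simp: T_orbit_def)
    then have "T h = int_pow_on (carrier G) T (n + 1) g" using int_pow_T_Suc[OF g] by simp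
    then show "T h \<in> T_orbit g" by (simp add: T_orbit_def)
  next
    assume "T h \<in> T_orbit g"
    then obtain n where n: "T h = int_pow_on (carrier G) T n g" by (auto simp: T_orbit_def)
    then have "T h = T (int_pow_on (carrier G) T (n - 1) g)"
      using int_pow_T_Suc[OF g, of "n - 1"] by simp
    then have "h = int_pow_on (carrier G) T (n - 1) g"
      using T_inv_T h int_pow_T_closed[OF g] by metis
    then show "h \<in> T_orbit g" by (simp add: T_orbit_def)
  }
qed

end

section \<open>The product space\<close>

locale fibered_group_system = countable_group_aut G T for G :: "('g, 'm) monoid_scheme" (structure)
    and T :: "'g \<Rightarrow> 'g" +
  fixes \<rho> :: "'x measure"
  assumes prob_space_\<rho>: "prob_space \<rho>"
begin

sublocale \<rho>: prob_space \<rho> by (rule prob_space_\<rho>)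

sublocale N: sigma_finite_measure N
  by (rule sigma_finite_measure_count_space_countable[OF countable_carrier])

sublocale pair: pair_sigma_finite \<rho> N ..

abbreviation "P \<equiv> \<rho> \<Otimes>\<^sub>M N"

text \<open>A nonempty set is never null for counting measure, so almost everywhere on a fibre means
  at every group element.\<close>

lemma AE_fiber:
  assumes "AE x in P. Q x"
  shows "AE p in \<rho>. \<forall>h\<in>carrier G. Q (p, h)"
  using pair.AE_pair[OF assms] by (simp add: AE_count_space)

lemma AE_productI:
  assumes "Measurable.pred P Q" "AE p in \<rho>. \<forall>h\<in>carrier G. Q (p, h)"
  shows "AE x in P. Q x"
  using assms by (intro pair.AE_pair_measure) (auto simp: AE_count_space)

lemma measurable_snd_pred [measurable]: "Measurable.pred P (\<lambda>x. Q (snd x))"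
  by (rule measurable_compose[OF measurable_snd]) simp

lemma Linfty_fst:
  assumes "b \<in> Linfty \<rho>"
  shows "(\<lambda>x. b (fst x)) \<in> Linfty P"
proof -
  have [measurable]: "b \<in> borel_measurable \<rho>" using assms by (simp add: Linfty_def)
  obtain K where K: "AE p in \<rho>. cmod (b p) \<le> K" using assms by (auto simp: Linfty_def)
  have "AE x in P. cmod (b (fst x)) \<le> K"
    using K by (intro AE_productI) auto
  then show ?thesis by (auto simp: Linfty_def)
qed

text \<open>A product map pushes a product measure to the product of the push-forwards, and a
  bijection preserves counting measure; \<sigma>-finiteness comes from countability of G.\<close>

lemma preserves_measure_product:
  assumes \<sigma>: "bij_betw \<sigma> (carrier G) (carrier G)"
  shows "preserves_measure P (\<lambda>x. (fst x, \<sigma> (snd x)))"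
proof -
  have \<sigma>N: "\<sigma> \<in> measurable N N" "distr N N \<sigma> = N"
    using preserves_measure_count_space[OF \<sigma>] unfolding preserves_measure_def by blast+
  have "distr \<rho> \<rho> (\<lambda>x. x) \<Otimes>\<^sub>M distr N N \<sigma> = distr P P (\<lambda>(x, y). (x, \<sigma> y))"
    by (rule pair_measure_distr) (use \<sigma>N in \<open>simp_all add: N.sigma_finite_measure_axioms\<close>)
  then have "distr P P (\<lambda>x. (fst x, \<sigma> (snd x))) = P"
    by (simp add: \<sigma>N case_prod_unfold)
  moreover have "(\<lambda>x. (fst x, \<sigma> (snd x))) \<in> measurable P P"
    by (rule measurable_Pair[OF measurable_fst measurable_compose[OF measurable_snd \<sigma>N(1)]])
  ultimately show ?thesis by (simp add: preserves_measure_def)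
qed

section \<open>Elementary vectors b \<otimes> \<delta>(g) and layers\<close>

definition elem_fun :: "('x \<Rightarrow> complex) \<Rightarrow> 'g \<Rightarrow> 'x \<times> 'g \<Rightarrow> complex" where
  "elem_fun b g = (\<lambda>x. b (fst x) * indicator {g} (snd x))"

definition elem_vec :: "('x \<Rightarrow> complex) \<Rightarrow> 'g \<Rightarrow> ('x \<times> 'g \<Rightarrow> complex) set" where
  "elem_vec b g = l2_class P (elem_fun b g)"

text \<open>The slice over g has measure 1 because \<rho> is a probability measure, so its indicator
  is square-integrable, and b acts on it by bounded multiplication.\<close>

lemma elem_fun_l2:
  assumes b: "b \<in> Linfty \<rho>" and g: "g \<in> carrier G"
  shows "elem_fun b g \<in> l2_functions P"
proof -
  let ?A = "space \<rho> \<times> {g}"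
  have A: "?A \<in> sets P" using g by (intro pair_measureI) auto
  have "emeasure P ?A = 1"
    using g N.emeasure_pair_measure_Times[of "space \<rho>" \<rho> "{g}"]
    by (simp add: \<rho>.emeasure_space_1)
  then have "integrable P (indicator ?A :: _ \<Rightarrow> real)"
    using A by simp
  moreover have "integrable P (\<lambda>x. (cmod (indicator {g} (snd x)))\<^sup>2) \<longleftrightarrow> integrable P (indicator ?A :: _ \<Rightarrow> real)"
    by (intro Bochner_Integration.integrable_cong) (auto simp: space_pair_measure split: split_indicator)
  ultimately have "(\<lambda>x. indicator {g} (snd x)) \<in> l2_functions P"
    by (intro l2_functionsI) auto
  then show ?thesis
    unfolding elem_fun_def by (rule l2_weighted_comp[OF Linfty_fst[OF b] preserves_measure_id])
qed

lemma elem_vec_in_vecs: "b \<in> Linfty \<rho> \<Longrightarrow> g \<in> carrier G \<Longrightarrow> elem_vec b g \<in> vecs (L2 P)"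
  unfolding elem_vec_def using elem_fun_l2 by blast

text \<open>These are the spaces V_E. The set E need not lie in the carrier, so the orthogonal
  complement of a layer is written with \<open>- E\<close>.\<close>

abbreviation "layer E \<equiv> supp_space P (snd -` E)"

lemma pred_layer [measurable]: "Measurable.pred P (\<lambda>x. x \<in> snd -` E)"
  using measurable_snd_pred[of "\<lambda>h. h \<in> E"] by simp

lemma layerI:
  assumes u: "u \<in> vecs (L2 P)" and "AE p in \<rho>. \<forall>h\<in>carrier G. h \<notin> E \<longrightarrow> l2_rep u (p, h) = 0"
  shows "u \<in> layer E"
proof -
  have [measurable]: "l2_rep u \<in> borel_measurable P" by (rule l2_functionsD(1)[OF vecs_rep(1)[OF u]])
  have "AE x in P. x \<notin> snd -` E \<longrightarrow> l2_rep u x = 0"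
    using assms(2) by (intro AE_productI) auto
  then show ?thesis using u by (simp add: supp_space_def)
qed

lemma elem_vec_in_layer:
  assumes "b \<in> Linfty \<rho>" "g \<in> carrier G" "g \<in> E"
  shows "elem_vec b g \<in> layer E"
  unfolding elem_vec_def using assms
  by (intro class_in_supp_space elem_fun_l2) (auto simp: elem_fun_def split: split_indicator)

text \<open>The working form of density: statements about \<open>U\<close>, \<open>J\<close>, the
  closure of F\<Omega> and the closed span of the modules are all reduced to elementary vectors
  through a suitable closed subspace W.\<close>

lemma layer_spanned:
  assumes W: "closed_subspace (L2 P) W"
    and elem: "\<And>b g. b \<in> Linfty \<rho> \<Longrightarrow> g \<in> carrier G \<Longrightarrow> g \<in> E \<Longrightarrow> elem_vec b g \<in> W"
  shows "layer E \<subseteq> W"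
proof
  have lin: "lin_subspace (L2 P) W" using W by (simp add: closed_subspace_def)
  fix u assume "u \<in> layer E"
  then have u: "u \<in> vecs (L2 P)" "AE x in P. snd x \<notin> E \<longrightarrow> l2_rep u x = 0"
    by (auto simp: supp_space_def)
  let ?f = "l2_rep u" and ?i = "to_nat_on (carrier G)"
  note f = vecs_rep(1)[OF u(1)]
  have [measurable]: "?f \<in> borel_measurable P" by (rule l2_functionsD(1)[OF f])
  let ?m = "\<lambda>z. nat \<lfloor>cmod z\<rfloor>"
  \<comment> \<open>On each level set of \<open>lab\<close> the group coordinate is constant and \<open>?f\<close> is bounded.\<close>
  define lab where "lab x = prod_encode (?i (snd x), ?m (?f x))" for x
  have lab_iff: "lab x = n \<longleftrightarrow> ?i (snd x) = fst (prod_decode n) \<and> ?m (?f x) = snd (prod_decode n)"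
    for x n
    unfolding lab_def by (metis prod_decode_inverse prod_encode_inverse fst_conv snd_conv prod.collapse)
  have "l2_class P ?f \<in> W"
  proof (rule closed_subspace_level_sets[OF W f])
    show "lab \<in> measurable P (count_space UNIV)"
    proof (rule measurable_count_space_eq_countable[THEN iffD2])
      have "lab -` {n} \<inter> space P \<in> sets P" for n
      proof -
        have "Measurable.pred P (\<lambda>x. ?i (snd x) = fst (prod_decode n) \<and> ?m (?f x) = snd (prod_decode n))"
          by measurable
        moreover have "lab -` {n} \<inter> space P
            = {x \<in> space P. ?i (snd x) = fst (prod_decode n) \<and> ?m (?f x) = snd (prod_decode n)}"
          using lab_iff[of _ n] by blast
        ultimately show ?thesis by (simp add: pred_def)
      qed
      then show "lab \<in> space P \<rightarrow> UNIV \<and> (\<forall>n\<in>UNIV. lab -` {n} \<inter> space P \<in> sets P)" by simp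
    qed simp
    fix n
    obtain i m where n: "prod_decode n = (i, m)" by (cases "prod_decode n")
    show "l2_class P (\<lambda>x. ?f x * of_bool (lab x = n)) \<in> W"
    proof (cases "\<exists>g\<in>carrier G. g \<in> E \<and> ?i g = i")
      case True
      then obtain g where g: "g \<in> carrier G" "g \<in> E" "?i g = i" by blast
      \<comment> \<open>The section of the vector over g, kept only where its modulus has integer
        part m, and therefore bounded by m + 1.\<close>
      define b where "b p = ?f (p, g) * of_bool (?m (?f (p, g)) = m)" for p
      have [measurable]: "(\<lambda>p. ?f (p, g)) \<in> borel_measurable \<rho>"
        by (rule measurable_compose[OF measurable_Pair2' \<open>?f \<in> borel_measurable P\<close>])
          (use g in simp)
      have b: "b \<in> Linfty \<rho>"
      proof -
        have "cmod (b p) \<le> real m + 1" for p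
          unfolding b_def using real_of_int_floor_add_one_ge[of "cmod (?f (p, g))"] by auto
        moreover have "b \<in> borel_measurable \<rho>" unfolding b_def by measurable
        ultimately show ?thesis by (auto simp: Linfty_def)
      qed
      have "l2_class P (\<lambda>x. ?f x * of_bool (lab x = n)) = elem_vec b g"
        unfolding elem_vec_def
      proof (rule l2_class_cong_AE, rule AE_I2)
        fix x assume "x \<in> space P"
        then have "snd x \<in> carrier G" by (auto simp: space_pair_measure)
        then have "?i (snd x) = i \<longleftrightarrow> snd x = g"
          using inj_on_to_nat_on[OF countable_carrier] g by (auto simp: inj_on_def)
        then show "?f x * of_bool (lab x = n) = elem_fun b g x"
          by (cases x) (auto simp: lab_iff n elem_fun_def b_def split: split_indicator)
      qed
      then show ?thesis using elem[OF b g(1,2)] by simp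
    next
      \<comment> \<open>A point with label n now has its group coordinate outside E, where the
        vector vanishes almost everywhere.\<close>
      case False
      have "AE x in P. ?f x * of_bool (lab x = n) = 0"
        using u(2) AE_space
      proof eventually_elim
        case (elim x)
        then have "snd x \<in> carrier G" by (auto simp: space_pair_measure)
        then show ?case using False elim by (auto simp: lab_iff n)
      qed
      then have "l2_class P (\<lambda>x. ?f x * of_bool (lab x = n)) = l2_class P (\<lambda>x. 0)"
        by (rule l2_class_cong_AE)
      then show ?thesis using zero_in_subspace[OF lin] by simp
    qed
  qed
  then show "u \<in> W" using vecs_rep(2)[OF u(1)] by simp
qed

lemma elem_vec_add:
  assumes "b \<in> Linfty \<rho>" "b' \<in> Linfty \<rho>" "g \<in> carrier G"
  shows "vadd (L2 P) (elem_vec b g) (elem_vec b' g) = elem_vec (\<lambda>p. b p + b' p) g"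
  unfolding elem_vec_def vadd_class[OF elem_fun_l2[OF assms(1,3)] elem_fun_l2[OF assms(2,3)]]
  by (simp add: elem_fun_def distrib_right)

lemma elem_vec_scale:
  assumes "b \<in> Linfty \<rho>" "g \<in> carrier G"
  shows "vscale (L2 P) c (elem_vec b g) = elem_vec (\<lambda>p. c * b p) g"
  unfolding elem_vec_def vscale_class[OF elem_fun_l2[OF assms]]
  by (simp add: elem_fun_def mult.assoc)

section \<open>Elementary tensors, the operators b \<otimes> l(g) and the two algebras\<close>

lemma tensor_vec_class:
  assumes f: "f \<in> l2_functions \<rho>" and g: "g \<in> l2_functions N"
  shows "tensor_vec \<rho> N (l2_class \<rho> f) (l2_class N g) = l2_class P (\<lambda>x. f (fst x) * g (snd x))"
  unfolding tensor_vec_def case_prod_unfold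
proof (rule l2_class_cong_AE, rule AE_productI)
  note f' = l2_rep_class[OF f] and g' = l2_rep_class[OF g]
  note [measurable] = l2_functionsD(1)[OF f] l2_functionsD(1)[OF g]
    l2_functionsD(1)[OF f'(1)] l2_functionsD(1)[OF g'(1)]
  show "Measurable.pred P (\<lambda>x. l2_rep (l2_class \<rho> f) (fst x) * l2_rep (l2_class N g) (snd x)
      = f (fst x) * g (snd x))"
    by measurable
  show "AE p in \<rho>. \<forall>h\<in>carrier G. l2_rep (l2_class \<rho> f) (fst (p, h)) * l2_rep (l2_class N g) (snd (p, h))
      = f (fst (p, h)) * g (snd (p, h))"
    using f'(2) by eventually_elim (use g'(2) in \<open>auto simp: AE_count_space\<close>)
qed

abbreviation "\<Omega> \<equiv> tensor_vec \<rho> N (l2_class \<rho> (\<lambda>_. 1)) (delta G \<one>)"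

lemma const_l2: "(\<lambda>_. c) \<in> l2_functions \<rho>"
  by (intro l2_functionsI) auto

lemma Linfty_l2: "b \<in> Linfty \<rho> \<Longrightarrow> b \<in> l2_functions \<rho>"
  using l2_weighted_comp[OF _ preserves_measure_id const_l2[of 1], of b] by simp

lemma Omega_eq: "\<Omega> = elem_vec (\<lambda>_. 1) \<one>"
  unfolding delta_def elem_vec_def elem_fun_def
  by (rule tensor_vec_class[OF const_l2 count_space_indicator_l2]) simp

text \<open>The operator b \<otimes> l(g) as a weighted composition operator;
  \<open>btrans_op_tensor_vec\<close> confirms this on elementary tensors.\<close>

definition btrans_op :: "('x \<Rightarrow> complex) \<Rightarrow> 'g \<Rightarrow> ('x \<times> 'g \<Rightarrow> complex) set \<Rightarrow> ('x \<times> 'g \<Rightarrow> complex) set" where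
  "btrans_op b g = comp_op P (\<lambda>x. b (fst x)) (\<lambda>x. (fst x, inv g \<otimes> snd x))"

lemma pm_btrans: "g \<in> carrier G \<Longrightarrow> preserves_measure P (\<lambda>x. (fst x, inv g \<otimes> snd x))"
  by (rule preserves_measure_product[OF bij_translation])

lemma btrans_op_bounded: "b \<in> Linfty \<rho> \<Longrightarrow> g \<in> carrier G \<Longrightarrow> btrans_op b g \<in> bounded_ops (L2 P)"
  unfolding btrans_op_def by (intro comp_op_bounded Linfty_fst pm_btrans)

lemma btrans_op_one: "btrans_op b \<one> = mult_op P (\<lambda>x. b (fst x))"
  unfolding btrans_op_def mult_op_eq_comp_op
  by (rule comp_op_cong[OF pm_btrans]) (auto simp: space_pair_measure)

lemma btrans_op_elem_vec:
  assumes b: "b \<in> Linfty \<rho>" and b': "b' \<in> Linfty \<rho>" and g: "g \<in> carrier G" and h: "h \<in> carrier G"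
  shows "btrans_op b g (elem_vec b' h) = elem_vec (\<lambda>p. b p * b' p) (g \<otimes> h)"
  unfolding btrans_op_def elem_vec_def comp_op_class[OF Linfty_fst[OF b] pm_btrans[OF g] elem_fun_l2[OF b' h]]
proof (rule l2_class_cong_AE, rule AE_I2)
  fix x assume "x \<in> space P"
  then have x: "snd x \<in> carrier G" by (auto simp: space_pair_measure)
  have "inv g \<otimes> snd x = h \<longleftrightarrow> snd x = g \<otimes> h"
    using inv_solve_left[of h g "snd x"] g h x by (auto simp: eq_commute)
  then show "b (fst x) * elem_fun b' h (fst x, inv g \<otimes> snd x)
      = elem_fun (\<lambda>p. b p * b' p) (g \<otimes> h) x"
    by (auto simp: elem_fun_def split: split_indicator)
qed

lemma btrans_op_Omega:
  assumes "b \<in> Linfty \<rho>" "g \<in> carrier G"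
  shows "btrans_op b g \<Omega> = elem_vec b g"
  unfolding Omega_eq using btrans_op_elem_vec[OF assms(1) Linfty_const assms(2) one_closed, of 1] assms
  by simp

lemma op_adj_btrans_op:
  assumes b: "b \<in> Linfty \<rho>" and g: "g \<in> carrier G"
  shows "op_adj (L2 P) (btrans_op b g) = btrans_op (\<lambda>p. cnj (b p)) (inv g)"
  unfolding btrans_op_def
proof (subst op_adj_comp_op[OF Linfty_fst[OF b] pm_btrans[OF g] pm_btrans[OF inv_closed[OF g]]])
  fix x assume "x \<in> space P"
  then show "(fst (fst x, inv g \<otimes> snd x), inv (inv g) \<otimes> snd (fst x, inv g \<otimes> snd x)) = x"
    using g by (cases x) (auto simp: space_pair_measure m_assoc[symmetric])
qed simp

lemma btrans_op_tensor_vec: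
  assumes b: "b \<in> Linfty \<rho>" and g: "g \<in> carrier G"
    and u: "u \<in> vecs (L2 \<rho>)" and v: "v \<in> vecs (L2 N)"
  shows "btrans_op b g (tensor_vec \<rho> N u v) = tensor_vec \<rho> N (mult_op \<rho> b u) (trans_op 1 g v)"
proof -
  have l2: "(\<lambda>x. l2_rep u (fst x) * l2_rep v (snd x)) \<in> l2_functions P"
  proof (rule l2_functionsI)
    note [measurable] = l2_functionsD(1)[OF vecs_rep(1)[OF u]] l2_functionsD(1)[OF vecs_rep(1)[OF v]]
    show "(\<lambda>x. l2_rep u (fst x) * l2_rep v (snd x)) \<in> borel_measurable P" by measurable
    have uv: "integrable \<rho> (\<lambda>x. (cmod (l2_rep u x))\<^sup>2)" "integrable N (\<lambda>x. (cmod (l2_rep v x))\<^sup>2)"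
      using u v by (simp_all add: l2_functionsD(2) vecs_rep)
    have "integrable P (\<lambda>(x, y). (cmod (l2_rep u x))\<^sup>2 * (cmod (l2_rep v y))\<^sup>2)"
      by (rule pair.Fubini_integrable) (use uv in \<open>simp_all add: norm_mult\<close>)
    then show "integrable P (\<lambda>x. (cmod (l2_rep u (fst x) * l2_rep v (snd x)))\<^sup>2)"
      by (simp add: case_prod_unfold norm_mult power_mult_distrib)
  qed
  note l2u = l2_weighted_comp[OF b preserves_measure_id vecs_rep(1)[OF u]]
  note l2v = l2_functions_comp[OF pm_translation[OF g] vecs_rep(1)[OF v]]
  have "tensor_vec \<rho> N u v = l2_class P (\<lambda>x. l2_rep u (fst x) * l2_rep v (snd x))"
    by (simp add: tensor_vec_def case_prod_unfold)
  then have "btrans_op b g (tensor_vec \<rho> N u v)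
      = l2_class P (\<lambda>x. b (fst x) * (l2_rep u (fst x) * l2_rep v (inv g \<otimes> snd x)))"
    unfolding btrans_op_def using comp_op_class[OF Linfty_fst[OF b] pm_btrans[OF g] l2] by simp
  also have "\<dots> = tensor_vec \<rho> N (mult_op \<rho> b u) (trans_op 1 g v)"
    using tensor_vec_class[OF l2u l2v] u v
    by (simp add: mult_op_def trans_op_def comp_op_def mult.assoc)
  finally show ?thesis .
qed

lemma Linfty_algebra_eq: "Linfty_algebra \<rho> = mult_op \<rho> ` Linfty \<rho>"
  by (auto simp: Linfty_algebra_def Linfty_def)

abbreviation "\<F> \<equiv> tensor_ops \<rho> N (Linfty_algebra \<rho>) {\<lambda>v\<in>vecs (L2 N). v}"
abbreviation "\<A> \<equiv> vn_tensor \<rho> N (Linfty_algebra \<rho>) (group_vn G)"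

lemma btrans_op_in_A:
  assumes "b \<in> Linfty \<rho>" "g \<in> carrier G"
  shows "btrans_op b g \<in> \<A>"
proof -
  have "btrans_op b g \<in> tensor_ops \<rho> N (Linfty_algebra \<rho>) (group_vn G)"
    unfolding tensor_ops_def
  proof (intro CollectI conjI bexI ballI)
    show "btrans_op b g \<in> bounded_ops (L2 P)" by (rule btrans_op_bounded[OF assms])
    show "mult_op \<rho> b \<in> Linfty_algebra \<rho>" unfolding Linfty_algebra_eq using assms(1) by (rule imageI)
    show "trans_op 1 g \<in> group_vn G" by (rule trans_op_in_group_vn[OF assms(2)])
    show "btrans_op b g (tensor_vec \<rho> N u v) = tensor_vec \<rho> N (mult_op \<rho> b u) (trans_op 1 g v)"
      if "u \<in> vecs (L2 \<rho>)" "v \<in> vecs (L2 N)" for u v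
      by (rule btrans_op_tensor_vec[OF assms that])
  qed
  then show ?thesis unfolding vn_tensor_def using vn_generated_superset by blast
qed

text \<open>An element of \<open>tensor_ops\<close> is prescribed on elementary tensors only, where
  it agrees with b \<otimes> l(1). The equalizer of the two bounded operators is a closed subspace
  containing all elementary vectors, hence everything.\<close>

lemma F_eq: "\<F> = (\<lambda>b. btrans_op b \<one>) ` Linfty \<rho>"
proof
  have id: "trans_op 1 \<one> v = v" if "v \<in> vecs (L2 N)" for v
  proof -
    have "trans_op 1 \<one> = comp_op N (\<lambda>_. 1) (\<lambda>h. h)"
      unfolding trans_op_def by (rule comp_op_cong[OF pm_translation]) auto
    then show ?thesis using comp_op_one_id[OF that] by simp
  qed
  show "(\<lambda>b. btrans_op b \<one>) ` Linfty \<rho> \<subseteq> \<F>"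
  proof
    fix a assume "a \<in> (\<lambda>b. btrans_op b \<one>) ` Linfty \<rho>"
    then obtain b where b: "b \<in> Linfty \<rho>" and a: "a = btrans_op b \<one>" by blast
    show "a \<in> \<F>"
      unfolding tensor_ops_def
    proof (intro CollectI conjI bexI ballI)
      show "a \<in> bounded_ops (L2 P)" unfolding a by (rule btrans_op_bounded[OF b one_closed])
      show "mult_op \<rho> b \<in> Linfty_algebra \<rho>" unfolding Linfty_algebra_eq using b by (rule imageI)
      show "(\<lambda>v\<in>vecs (L2 N). v) \<in> {\<lambda>v\<in>vecs (L2 N). v}" by simp
      show "a (tensor_vec \<rho> N u v) = tensor_vec \<rho> N (mult_op \<rho> b u) ((\<lambda>v\<in>vecs (L2 N). v) v)"
        if "u \<in> vecs (L2 \<rho>)" "v \<in> vecs (L2 N)" for u v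
        using btrans_op_tensor_vec[OF b one_closed that] id[OF that(2)] that(2) by (simp add: a)
    qed
  qed
  show "\<F> \<subseteq> (\<lambda>b. btrans_op b \<one>) ` Linfty \<rho>"
  proof
    fix a assume "a \<in> \<F>"
    then obtain b where aB: "a \<in> bounded_ops (L2 P)" and b: "b \<in> Linfty \<rho>"
      and t: "\<And>u v. u \<in> vecs (L2 \<rho>) \<Longrightarrow> v \<in> vecs (L2 N)
        \<Longrightarrow> a (tensor_vec \<rho> N u v) = tensor_vec \<rho> N (mult_op \<rho> b u) v"
      unfolding tensor_ops_def Linfty_algebra_eq by auto
    let ?t = "btrans_op b \<one>"
    have tB: "?t \<in> bounded_ops (L2 P)" by (rule btrans_op_bounded[OF b one_closed])
    \<comment> \<open>For \<open>UNIV\<close> the support condition is void, so this layer is the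
      whole space.\<close>
    have "layer UNIV \<subseteq> {x \<in> vecs (L2 P). a x = ?t x}"
    proof (rule layer_spanned[OF closed_subspace_equalizer[OF aB tB]])
      fix b' g assume b': "b' \<in> Linfty \<rho>" and g: "g \<in> carrier G"
      let ?u = "l2_class \<rho> b'" and ?v = "l2_class N (indicator {g})"
      have uv: "?u \<in> vecs (L2 \<rho>)" "?v \<in> vecs (L2 N)"
        using Linfty_l2[OF b'] count_space_indicator_l2[OF g] by blast+
      have e: "elem_vec b' g = tensor_vec \<rho> N ?u ?v"
        unfolding elem_vec_def elem_fun_def
        by (rule tensor_vec_class[symmetric, OF Linfty_l2[OF b'] count_space_indicator_l2[OF g]])
      show "elem_vec b' g \<in> {x \<in> vecs (L2 P). a x = ?t x}"
        using elem_vec_in_vecs[OF b' g] t[OF uv] btrans_op_tensor_vec[OF b one_closed uv] id[OF uv(2)]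
        by (simp add: e)
    qed
    then have "a x = ?t x" if "x \<in> vecs (L2 P)" for x
      using that by (auto simp: supp_space_def)
    then have "a = ?t"
      by (rule op_eqI[OF bounded_opsD(1)[OF aB] bounded_opsD(1)[OF tB]])
    then show "a \<in> (\<lambda>b. btrans_op b \<one>) ` Linfty \<rho>" using b by blast
  qed
qed

lemma sub_space_eq: "sub_space (L2 P) \<Omega> \<F> = layer {\<one>}"
proof -
  let ?S = "(\<lambda>a. a \<Omega>) ` \<F>"
  have S: "?S = (\<lambda>b. elem_vec b \<one>) ` Linfty \<rho>"
    unfolding F_eq image_image using btrans_op_Omega[OF _ one_closed] by (intro image_cong) auto
  have "lin_subspace (L2 P) ?S"
    unfolding S lin_subspace_def
  proof (intro conjI ballI allI)
    show "(\<lambda>b. elem_vec b \<one>) ` Linfty \<rho> \<subseteq> vecs (L2 P)" using elem_vec_in_vecs by auto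
    show "(\<lambda>b. elem_vec b \<one>) ` Linfty \<rho> \<noteq> {}" using Linfty_const by blast
    show "vadd (L2 P) x y \<in> (\<lambda>b. elem_vec b \<one>) ` Linfty \<rho>"
      if "x \<in> (\<lambda>b. elem_vec b \<one>) ` Linfty \<rho>" "y \<in> (\<lambda>b. elem_vec b \<one>) ` Linfty \<rho>" for x y
      using that by (auto simp: elem_vec_add intro!: imageI Linfty_add)
    show "vscale (L2 P) c x \<in> (\<lambda>b. elem_vec b \<one>) ` Linfty \<rho>"
      if "x \<in> (\<lambda>b. elem_vec b \<one>) ` Linfty \<rho>" for c x
      using that by (auto simp: elem_vec_scale intro!: imageI Linfty_mult)
  qed
  then have cl: "closed_subspace (L2 P) (vclosure (L2 P) ?S)" by (rule closed_subspace_vclosure)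
  have "?S \<subseteq> vecs (L2 P)" unfolding S using elem_vec_in_vecs by auto
  note S_cl = subset_vclosure[OF this]
  have "layer {\<one>} \<subseteq> vclosure (L2 P) ?S"
  proof (rule layer_spanned[OF cl])
    fix b g assume "b \<in> Linfty \<rho>" "g \<in> {\<one>}"
    then have "elem_vec b g \<in> ?S" unfolding S by simp
    then show "elem_vec b g \<in> vclosure (L2 P) ?S" using S_cl by (rule subsetD[rotated])
  qed
  moreover have "vclosure (L2 P) ?S \<subseteq> layer {\<one>}"
  proof -
    have "?S \<subseteq> layer {\<one>}" unfolding S using elem_vec_in_layer by auto
    then have "vclosure (L2 P) ?S \<subseteq> vclosure (L2 P) (layer {\<one>})"
      by (rule vclosure_mono)
    then show ?thesis
      using closed_subspace_supp_space[OF pred_layer] by (simp add: closed_subspace_def)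
  qed
  ultimately show ?thesis by (simp add: sub_space_def)
qed

lemma layer_Compl: "supp_space P (- snd -` E) = layer (- E)"
  by (simp add: vimage_Compl)

lemma orth_compl_sub_space: "orth_compl (L2 P) (sub_space (L2 P) \<Omega> \<F>) = layer (- {\<one>})"
  unfolding sub_space_eq orth_compl_supp_space[OF pred_layer] layer_Compl ..

lemma sub_proj_eq: "sub_proj (L2 P) \<Omega> \<F> = mult_op P (indicator (snd -` {\<one>}))"
  unfolding sub_proj_def sub_space_eq by (rule orth_proj_supp_space[OF pred_layer])

section \<open>The implementing unitary and the modular conjugation\<close>

text \<open>By Fubini almost every fibre is square-integrable. Otherwise \<open>fiber N z p\<close>
  would be the empty class and would say nothing about the values of z over p.\<close>

lemma fiber_l2:
  assumes z: "z \<in> vecs (L2 P)"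
  shows "AE p in \<rho>. (\<lambda>h. l2_rep z (p, h)) \<in> l2_functions N"
proof -
  have "AE p in \<rho>. integrable N (\<lambda>h. (cmod (l2_rep z (p, h)))\<^sup>2)"
    by (rule pair.AE_integrable_fst'[OF l2_functionsD(2)[OF vecs_rep(1)[OF z]]])
  then show ?thesis by eventually_elim (simp add: l2_functions_def)
qed

text \<open>The action of \<alpha> is described on operators that come with a field, and this
  supplies the field of b \<otimes> l(g). Its uniform bound is the essential bound of b times a
  bound for l(g).\<close>

lemma represented_by_btrans_op:
  assumes b: "b \<in> Linfty \<rho>" and g: "g \<in> carrier G"
  shows "represented_by \<rho> N (group_vn G) (btrans_op b g) (\<lambda>p. trans_op (b p) g)"
  unfolding represented_by_def
proof (intro conjI ballI)
  show "btrans_op b g \<in> bounded_ops (L2 P)" by (rule btrans_op_bounded[OF b g])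
  show "trans_op (b p) g \<in> group_vn G" for p by (rule trans_op_in_group_vn[OF g])
  have sc: "trans_op z g v = vscale (L2 N) z (trans_op 1 g v)" if "v \<in> vecs (L2 N)" for z v
    using trans_op_scale[OF g, of z] that by (simp add: op_scale_def)
  note tv = bounded_opsD(2)[OF trans_op_bounded[OF g, of 1]]
  show "(\<lambda>p. vinner (L2 N) u (trans_op (b p) g v)) \<in> borel_measurable \<rho>"
    if "u \<in> vecs (L2 N)" "v \<in> vecs (L2 N)" for u v
  proof -
    have [measurable]: "b \<in> borel_measurable \<rho>" using b by (simp add: Linfty_def)
    have eq: "(\<lambda>p. vinner (L2 N) u (trans_op (b p) g v)) = (\<lambda>p. b p * vinner (L2 N) u (trans_op 1 g v))"
      unfolding sc[OF that(2), of "b p" for p] vinner_vscale_right[OF that(1) tv[OF that(2)]] ..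
    show ?thesis unfolding eq by measurable
  qed
  show "\<exists>K. AE p in \<rho>. \<forall>u\<in>vecs (L2 N). vnorm (L2 N) (trans_op (b p) g u) \<le> K * vnorm (L2 N) u"
  proof -
    obtain L where L: "L > 0"
      "\<And>u. u \<in> vecs (L2 N) \<Longrightarrow> vnorm (L2 N) (trans_op 1 g u) \<le> L * vnorm (L2 N) u"
      using bounded_ops_bound[OF trans_op_bounded[OF g, of 1]] by blast
    obtain K where "AE p in \<rho>. cmod (b p) \<le> K" using b by (auto simp: Linfty_def)
    then have "AE p in \<rho>. \<forall>u\<in>vecs (L2 N). vnorm (L2 N) (trans_op (b p) g u) \<le> K * L * vnorm (L2 N) u"
    proof eventually_elim
      case (elim p)
      show ?case
      proof
        fix u assume u: "u \<in> vecs (L2 N)"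
        have "vnorm (L2 N) (trans_op (b p) g u) = cmod (b p) * vnorm (L2 N) (trans_op 1 g u)"
          unfolding sc[OF u, of "b p"] by (rule vnorm_vscale[OF tv[OF u]])
        also have "\<dots> \<le> K * (L * vnorm (L2 N) u)"
          using elim L(2)[OF u] vnorm_nonneg order_trans[OF norm_ge_zero elim]
          by (intro mult_mono) auto
        finally show "vnorm (L2 N) (trans_op (b p) g u) \<le> K * L * vnorm (L2 N) u"
          by (simp add: mult.assoc)
      qed
    qed
    then show ?thesis by blast
  qed
  fix z assume z: "z \<in> vecs (L2 P)"
  have "AE x in P. l2_rep (btrans_op b g z) x = b (fst x) * l2_rep z (fst x, inv g \<otimes> snd x)"
    unfolding btrans_op_def by (rule rep_comp_op[OF Linfty_fst[OF b] pm_btrans[OF g] z])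
  from AE_fiber[OF this] fiber_l2[OF z]
  show "AE p in \<rho>. fiber N (btrans_op b g z) p = trans_op (b p) g (fiber N z p)"
  proof eventually_elim
    case (elim p)
    have "fiber N (btrans_op b g z) p = l2_class N (\<lambda>h. b p * l2_rep z (p, inv g \<otimes> h))"
      unfolding fiber_def using elim(1) by (intro l2_class_cong_AE) (simp add: AE_count_space)
    also have "\<dots> = trans_op (b p) g (fiber N z p)"
      unfolding fiber_def trans_op_def
      by (rule comp_op_class[symmetric, OF Linfty_const pm_translation[OF g] elim(2)])
    finally show ?case .
  qed
qed

lemma fiber_Omega: "AE p in \<rho>. fiber N \<Omega> p = l2_class N (indicator {\<one>})"
proof -
  have "AE x in P. l2_rep \<Omega> x = elem_fun (\<lambda>_. 1) \<one> x"
    unfolding Omega_eq elem_vec_def by (rule l2_rep_class(2)[OF elem_fun_l2]) auto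
  from AE_fiber[OF this] show ?thesis
    by eventually_elim (auto simp: fiber_def elem_fun_def AE_count_space intro!: l2_class_cong_AE)
qed

lemma implementing_unitary_elem_vec:
  assumes rep: "\<And>a c. a \<in> \<A> \<Longrightarrow> represented_by \<rho> N (group_vn G) a c \<Longrightarrow>
      represented_by \<rho> N (group_vn G) (\<alpha> a) (\<lambda>p. int_pow_on (group_vn G) (gamma G T) (k p) (c (S p)))"
    and U: "implementing_unitary (L2 P) \<Omega> \<A> \<alpha> U"
    and E: "T_invariant E" and b: "b \<in> Linfty \<rho>" and g: "g \<in> carrier G" "g \<in> E"
  shows "U (elem_vec b g) \<in> layer E"
proof -
  let ?a = "btrans_op b g"
  have a: "?a \<in> \<A>" by (rule btrans_op_in_A[OF b g(1)])
  have r: "represented_by \<rho> N (group_vn G) (\<alpha> ?a)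
      (\<lambda>p. int_pow_on (group_vn G) (gamma G T) (k p) (trans_op (b (S p)) g))"
    by (rule rep[OF a represented_by_btrans_op[OF b g(1)]])
  have \<Omega>v: "\<Omega> \<in> vecs (L2 P)" unfolding Omega_eq by (rule elem_vec_in_vecs) auto
  let ?w = "\<alpha> ?a \<Omega>"
  have w: "?w \<in> vecs (L2 P)"
    using r bounded_opsD(2)[OF _ \<Omega>v] by (simp add: represented_by_def)
  have "AE p in \<rho>. fiber N ?w p
      = int_pow_on (group_vn G) (gamma G T) (k p) (trans_op (b (S p)) g) (fiber N \<Omega> p)"
    using r \<Omega>v by (simp add: represented_by_def)
  then have "AE p in \<rho>. \<forall>h\<in>carrier G. h \<notin> E \<longrightarrow> l2_rep ?w (p, h) = 0"
    using fiber_Omega fiber_l2[OF w]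
  proof eventually_elim
    case (elim p)
    \<comment> \<open>The power depends on p; invariance of E under all integer powers keeps
      \<open>g'\<close> in E whatever the value of k(p).\<close>
    define g' where "g' = int_pow_on (carrier G) T (- k p) g"
    have g': "g' \<in> carrier G" "g' \<in> E"
      using int_pow_T_closed[OF g(1)] T_invariant_int_pow[OF E g(1)] g(2) by (simp_all add: g'_def)
    have \<delta>: "(indicator {\<one>} :: _ \<Rightarrow> complex) \<in> l2_functions N" by (rule count_space_indicator_l2) simp
    let ?d = "\<lambda>h. b (S p) * indicator {\<one>} (inv g' \<otimes> h)"
    have "fiber N ?w p = trans_op (b (S p)) g' (l2_class N (indicator {\<one>}))"
      using elim(1) unfolding elim(2) int_pow_gamma_trans_op[OF g(1)] g'_def .
    then have "l2_class N (\<lambda>h. l2_rep ?w (p, h)) = trans_op (b (S p)) g' (l2_class N (indicator {\<one>}))"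
      unfolding fiber_def .
    also have "\<dots> = l2_class N ?d"
      unfolding trans_op_def by (rule comp_op_class[OF Linfty_const pm_translation[OF g'(1)] \<delta>])
    \<comment> \<open>Over counting measure, equality of classes is equality at every point once
      both functions are square-integrable, which \<open>fiber_l2\<close> provides for the left
      one.\<close>
    finally have "\<forall>h\<in>carrier G. l2_rep ?w (p, h) = ?d h"
      using count_space_class_eq_iff[OF elim(3) l2_weighted_comp[OF Linfty_const pm_translation[OF g'(1)] \<delta>]]
      by simp
    moreover have "inv g' \<otimes> h \<noteq> \<one>" if "h \<in> carrier G" "h \<notin> E" for h
    proof
      assume "inv g' \<otimes> h = \<one>"
      then have "h = g'" using inv_solve_left[of \<one> g' h] that g'(1) by auto
      then show False using that g' by simp
    qed
    ultimately show ?case by simp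
  qed
  then have "?w \<in> layer E" by (rule layerI[OF w])
  moreover have "U (?a \<Omega>) = ?w" using U a by (simp add: implementing_unitary_def)
  ultimately show ?thesis unfolding btrans_op_Omega[OF b g(1)] by simp
qed

text \<open>The generators show only that \<open>U\<close> maps a layer into itself, for E and for
  its complement. Surjectivity follows by orthogonality: if U x lies in V_E and y in the
  complementary layer, then U y lies there too, so \<langle>x, y\<rangle> = \<langle>U x, U
  y\<rangle> = 0.\<close>

lemma implementing_unitary_layer:
  assumes rep: "\<And>a c. a \<in> \<A> \<Longrightarrow> represented_by \<rho> N (group_vn G) a c \<Longrightarrow>
      represented_by \<rho> N (group_vn G) (\<alpha> a) (\<lambda>p. int_pow_on (group_vn G) (gamma G T) (k p) (c (S p)))"
    and U: "implementing_unitary (L2 P) \<Omega> \<A> \<alpha> U"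
    and E: "T_invariant E"
  shows "U ` layer E = layer E"
proof -
  have uni: "unitary_op (L2 P) U" using U by (simp add: implementing_unitary_def)
  then have Uv: "\<And>x. x \<in> vecs (L2 P) \<Longrightarrow> U x \<in> vecs (L2 P)" and Usurj: "U ` vecs (L2 P) = vecs (L2 P)"
    and Uin: "\<And>x y. x \<in> vecs (L2 P) \<Longrightarrow> y \<in> vecs (L2 P) \<Longrightarrow> vinner (L2 P) (U x) (U y) = vinner (L2 P) x y"
    and Uadd: "\<And>x y. x \<in> vecs (L2 P) \<Longrightarrow> y \<in> vecs (L2 P) \<Longrightarrow> U (vadd (L2 P) x y) = vadd (L2 P) (U x) (U y)"
    and Usc: "\<And>c x. x \<in> vecs (L2 P) \<Longrightarrow> U (vscale (L2 P) c x) = vscale (L2 P) c (U x)"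
    by (auto simp: unitary_op_def linear_op_def)
  have sub: "U x \<in> layer E" if "T_invariant E" "x \<in> layer E" for E x
  proof -
    have "closed_subspace (L2 P) {x \<in> vecs (L2 P). U x \<in> layer E}"
      by (rule closed_subspace_preimage[where \<kappa> = "\<lambda>c. c" and K = 1])
        (use Uv Uadd Usc Uin closed_subspace_supp_space[OF pred_layer] in \<open>auto simp: vnorm_def\<close>)
    then have "layer E \<subseteq> {x \<in> vecs (L2 P). U x \<in> layer E}"
    proof (rule layer_spanned)
      fix b g assume *: "b \<in> Linfty \<rho>" "g \<in> carrier G" "g \<in> E"
      show "elem_vec b g \<in> {x \<in> vecs (L2 P). U x \<in> layer E}"
        using implementing_unitary_elem_vec[of \<alpha> k S, OF rep U \<open>T_invariant E\<close> *] elem_vec_in_vecs[OF *(1,2)]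
        by simp
    qed
    then show ?thesis using that by auto
  qed
  show ?thesis
  proof (intro equalityI subsetI)
    fix w assume "w \<in> U ` layer E"
    then show "w \<in> layer E" using sub[OF E] by auto
  next
    fix w assume w: "w \<in> layer E"
    then have "w \<in> vecs (L2 P)" by (simp add: supp_space_def)
    then obtain x where x: "x \<in> vecs (L2 P)" "w = U x" using Usurj by blast
    have "x \<in> supp_space P (- snd -` (- E))"
    proof (rule orth_supp_spaceD[OF pred_layer x(1)])
      fix y assume y: "y \<in> layer (- E)"
      then have yv: "y \<in> vecs (L2 P)" by (simp add: supp_space_def)
      have "vinner (L2 P) w (U y) = 0"
        using sub[OF T_invariant_Compl[OF E] y] w
        by (intro supp_space_disjoint_orth[of w P "snd -` E"]) (simp_all add: layer_Compl)
      then have "vinner (L2 P) x y = 0" using Uin[OF x(1) yv] x(2) by simp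
      then show "vinner (L2 P) y x = 0" using vinner_cnj[of P y x] by simp
    qed
    then have "x \<in> layer E" by (simp add: vimage_Compl)
    then show "w \<in> U ` layer E" using x(2) by blast
  qed
qed

text \<open>\<open>J\<close> sends (b \<otimes> l(g))\<Omega> to the adjoint operator applied to
  \<Omega>, an elementary vector at g^{-1}. E' may be any set containing the inverses, so the lemma
  serves both from E to the inverse set and back.\<close>

lemma modular_conjugation_layer:
  assumes J: "modular_conjugation (L2 P) \<Omega> \<A> J"
    and x: "x \<in> layer E" and E': "\<And>g. g \<in> carrier G \<Longrightarrow> g \<in> E \<Longrightarrow> inv g \<in> E'"
  shows "J x \<in> layer E'"
proof -
  have anti: "antiunitary_op (L2 P) J" using J by (simp add: modular_conjugation_def)
  then have Jv: "\<And>x. x \<in> vecs (L2 P) \<Longrightarrow> J x \<in> vecs (L2 P)"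
    and Jin: "\<And>x y. x \<in> vecs (L2 P) \<Longrightarrow> y \<in> vecs (L2 P) \<Longrightarrow> vinner (L2 P) (J x) (J y) = vinner (L2 P) y x"
    and Jadd: "\<And>x y. x \<in> vecs (L2 P) \<Longrightarrow> y \<in> vecs (L2 P) \<Longrightarrow> J (vadd (L2 P) x y) = vadd (L2 P) (J x) (J y)"
    and Jsc: "\<And>c x. x \<in> vecs (L2 P) \<Longrightarrow> J (vscale (L2 P) c x) = vscale (L2 P) (cnj c) (J x)"
    by (auto simp: antiunitary_op_def)
  have "closed_subspace (L2 P) {x \<in> vecs (L2 P). J x \<in> layer E'}"
    by (rule closed_subspace_preimage[where \<kappa> = cnj and K = 1])
      (use Jv Jadd Jsc Jin closed_subspace_supp_space[OF pred_layer] in \<open>auto simp: vnorm_def\<close>)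
  then have "layer E \<subseteq> {x \<in> vecs (L2 P). J x \<in> layer E'}"
  proof (rule layer_spanned)
    fix b g assume b: "b \<in> Linfty \<rho>" and g: "g \<in> carrier G" "g \<in> E"
    have b': "(\<lambda>p. cnj (b p)) \<in> Linfty \<rho>" by (rule Linfty_cnj[OF b])
    have "J (btrans_op b g \<Omega>) = op_adj (L2 P) (btrans_op b g) \<Omega>"
      using J btrans_op_in_A[OF b g(1)] by (simp add: modular_conjugation_def)
    then have "J (elem_vec b g) = elem_vec (\<lambda>p. cnj (b p)) (inv g)"
      using btrans_op_Omega[OF b g(1)] btrans_op_Omega[OF b' inv_closed[OF g(1)]]
        op_adj_btrans_op[OF b g(1)] by simp
    then show "elem_vec b g \<in> {x \<in> vecs (L2 P). J x \<in> layer E'}"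
      using elem_vec_in_vecs[OF b g(1)] elem_vec_in_layer[OF b' inv_closed[OF g(1)] E'[OF g]] by simp
  qed
  then show ?thesis using x by auto
qed

text \<open>The right action of B is \<open>J\<close>, then multiplication by a function of p alone,
  then \<open>J\<close>. The multiplication keeps every layer, and the two applications of
  \<open>J\<close> invert the group coordinate twice.\<close>

lemma right_submodule_layer:
  assumes J: "modular_conjugation (L2 P) \<Omega> \<A> J"
  shows "right_submodule (L2 P) J \<F> (layer E)"
  unfolding right_submodule_def
proof (intro conjI ballI)
  show "closed_subspace (L2 P) (layer E)" by (rule closed_subspace_supp_space[OF pred_layer])
  fix x a assume x: "x \<in> layer E" and "a \<in> \<F>"
  then obtain b where b: "b \<in> Linfty \<rho>" and a: "a = btrans_op b \<one>" unfolding F_eq by blast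
  let ?b = "\<lambda>x. cnj (b (fst x))" and ?E' = "{h. inv h \<in> E}"
  have b': "?b \<in> Linfty P" by (rule Linfty_fst[OF Linfty_cnj[OF b]])
  have adj: "op_adj (L2 P) a = mult_op P ?b"
    unfolding a op_adj_btrans_op[OF b one_closed] unfolding inv_one btrans_op_one ..
  have Jx: "J x \<in> layer ?E'"
    by (rule modular_conjugation_layer[OF J x]) simp
  then have Jxv: "J x \<in> vecs (L2 P)" "AE y in P. y \<notin> snd -` ?E' \<longrightarrow> l2_rep (J x) y = 0"
    by (auto simp: supp_space_def)
  have "AE y in P. y \<notin> snd -` ?E' \<longrightarrow> l2_rep (mult_op P ?b (J x)) y = 0"
    using Jxv(2) rep_comp_op[OF b' preserves_measure_id Jxv(1), folded mult_op_eq_comp_op]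
    by eventually_elim simp
  then have "mult_op P ?b (J x) \<in> layer ?E'"
    using comp_op_vecs[OF b' preserves_measure_id Jxv(1)] by (simp add: supp_space_def mult_op_eq_comp_op)
  then have "J (mult_op P ?b (J x)) \<in> layer E"
    by (rule modular_conjugation_layer[OF J]) simp
  moreover have "x \<in> vecs (L2 P)" using x by (simp add: supp_space_def)
  ultimately show "op_mult (L2 P) J (op_mult (L2 P) (op_adj (L2 P) a) J) x \<in> layer E"
    by (simp add: op_mult_def adj)
qed

section \<open>The trace of the projection onto a finite set of layers\<close>

text \<open>Conjugation by l(g) translates the set of a multiplication by an indicator, here from
  the slice over 1 to the slice over g; the adjoint of l(g) is written as l(g^{-1}).\<close>

lemma translate_sub_proj:
  assumes g: "g \<in> carrier G"
  shows "op_mult (L2 P) (btrans_op (\<lambda>_. 1) g)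
      (op_mult (L2 P) (sub_proj (L2 P) \<Omega> \<F>) (btrans_op (\<lambda>_. 1) (inv g)))
    = mult_op P (indicator (snd -` {g}))"
proof -
  let ?\<phi> = "\<lambda>g x. (fst x :: 'x, inv g \<otimes> snd x)"
  note pm = pm_btrans[OF g] and pm' = pm_btrans[OF inv_closed[OF g]]
  have e: "(indicator (snd -` {\<one>}) :: 'x \<times> 'g \<Rightarrow> complex) \<in> Linfty P"
    by (rule Linfty_indicator[OF pred_layer])
  have "op_mult (L2 P) (sub_proj (L2 P) \<Omega> \<F>) (btrans_op (\<lambda>_. 1) (inv g))
      = comp_op P (indicator (snd -` {\<one>})) (?\<phi> (inv g))"
    unfolding sub_proj_eq mult_op_eq_comp_op btrans_op_def
    by (simp add: op_mult_comp_op[OF e preserves_measure_id Linfty_const pm'])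
  then have "op_mult (L2 P) (btrans_op (\<lambda>_. 1) g)
      (op_mult (L2 P) (sub_proj (L2 P) \<Omega> \<F>) (btrans_op (\<lambda>_. 1) (inv g)))
      = comp_op P (\<lambda>x. 1 * indicator (snd -` {\<one>}) (?\<phi> g x)) (\<lambda>x. ?\<phi> (inv g) (?\<phi> g x))"
    unfolding btrans_op_def[of _ g]
    by (simp only: op_mult_comp_op[OF Linfty_const pm e pm'])
  also have "\<dots> = comp_op P (indicator (snd -` {g})) (\<lambda>x. x)"
  proof (rule comp_op_cong[OF preserves_measure_comp[OF pm' pm]])
    show "AE x in P. 1 * indicator (snd -` {\<one>}) (?\<phi> g x) = (indicator (snd -` {g}) x :: complex)"
    proof (rule AE_I2)
      fix x :: "'x \<times> 'g" assume "x \<in> space P"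
      then have "snd x \<in> carrier G" by (auto simp: space_pair_measure)
      then have "inv g \<otimes> snd x = \<one> \<longleftrightarrow> snd x = g"
        using inv_solve_left[of \<one> g "snd x"] g by auto
      then show "1 * indicator (snd -` {\<one>}) (?\<phi> g x) = (indicator (snd -` {g}) x :: complex)"
        by (simp add: indicator_def)
    qed
    show "?\<phi> (inv g) (?\<phi> g x) = x" if "x \<in> space P" for x
      using that g by (cases x) (auto simp: space_pair_measure m_assoc[symmetric])
  qed
  finally show ?thesis by (simp add: mult_op_eq_comp_op)
qed

abbreviation "layer_pairs gs \<equiv> map (\<lambda>g. (btrans_op (\<lambda>_. 1) g, btrans_op (\<lambda>_. 1) (inv g))) gs"

lemma sum_aeb_Cons:
  "sum_aeb H e ((a, b) # ps) = op_add H (op_mult H a (op_mult H e b)) (sum_aeb H e ps)"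
  by (simp add: sum_aeb_def)

text \<open>Each summand cuts off to one slice, and for distinct group elements the indicators add
  up to the indicator of the union.\<close>

lemma sum_aeb_layers:
  assumes "distinct gs" "set gs \<subseteq> carrier G"
  shows "sum_aeb (L2 P) (sub_proj (L2 P) \<Omega> \<F>) (layer_pairs gs) = orth_proj (L2 P) (layer (set gs))"
  unfolding orth_proj_supp_space[OF pred_layer]
  using assms
proof (induction gs)
  case Nil
  show ?case by (simp add: sum_aeb_def op_zero_def mult_op_def L2_def)
next
  case (Cons g gs)
  have g: "g \<in> carrier G" using Cons.prems by simp
  let ?i = "\<lambda>E. indicator (snd -` E) :: 'x \<times> 'g \<Rightarrow> complex"
  have "sum_aeb (L2 P) (sub_proj (L2 P) \<Omega> \<F>) (layer_pairs (g # gs))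
      = op_add (L2 P) (mult_op P (?i {g})) (mult_op P (?i (set gs)))"
    using Cons.IH Cons.prems by (simp only: list.map sum_aeb_Cons translate_sub_proj[OF g] distinct.simps
        list.set insert_subset simp_thms)
  also have "\<dots> = mult_op P (\<lambda>x. ?i {g} x + ?i (set gs) x)"
    by (rule op_add_mult_op[OF Linfty_indicator[OF pred_layer] Linfty_indicator[OF pred_layer]])
  also have "(\<lambda>x. ?i {g} x + ?i (set gs) x) = ?i (set (g # gs))"
    using Cons.prems(1) by (auto simp: indicator_def fun_eq_iff)
  finally show ?case .
qed

lemma sum_aeb_in_basic_construction:
  assumes "set gs \<subseteq> carrier G"
  shows "sum_aeb (L2 P) (sub_proj (L2 P) \<Omega> \<F>) (layer_pairs gs) \<in> basic_construction (L2 P) \<Omega> \<A> \<F>"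
  using assms
proof (induction gs)
  case Nil
  have "sub_proj (L2 P) \<Omega> \<F> \<in> basic_construction (L2 P) \<Omega> \<A> \<F>"
    unfolding basic_construction_def using vn_generated_superset by blast
  then show ?case
    unfolding basic_construction_def using vn_generated_closed(4) by (simp add: sum_aeb_def)
next
  case (Cons g gs)
  let ?M = "basic_construction (L2 P) \<Omega> \<A> \<F>" and ?e = "sub_proj (L2 P) \<Omega> \<F>"
  let ?a = "btrans_op (\<lambda>_. 1) g" and ?b = "btrans_op (\<lambda>_. 1) (inv g)"
  have "?a \<in> \<A>" "?b \<in> \<A>"
    using Cons.prems by (auto intro: btrans_op_in_A)
  then have "?a \<in> ?M" "?b \<in> ?M" "?e \<in> ?M"
    unfolding basic_construction_def using vn_generated_superset[of "insert ?e \<A>"] by auto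
  then have "op_mult (L2 P) ?a (op_mult (L2 P) ?e ?b) \<in> ?M"
    unfolding basic_construction_def by (intro vn_generated_closed(1))
  moreover have "sum_aeb (L2 P) ?e (layer_pairs gs) \<in> ?M"
    using Cons.prems by (intro Cons.IH) simp
  ultimately show ?case
    unfolding basic_construction_def list.map sum_aeb_Cons by (rule vn_generated_closed(2))
qed

text \<open>Finiteness is read off from the clause of \<open>canonical_trace\<close> on sums of a e
  b. The clause concerns positive elements of the basic construction, hence the check that
  \<langle>x, Q x\<rangle> is the squared norm of Q x for the projection Q.\<close>

lemma trace_layer_finite:
  assumes \<tau>: "canonical_trace (L2 P) \<Omega> \<A> (vector_state (L2 P) \<Omega>) \<F> \<tau>"
    and E: "finite E" "E \<subseteq> carrier G"
  shows "\<tau> (orth_proj (L2 P) (layer E)) < \<infinity>"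
proof -
  obtain gs where gs: "set gs = E" "distinct gs" using finite_distinct_list[OF E(1)] by blast
  let ?s = "sum_aeb (L2 P) (sub_proj (L2 P) \<Omega> \<F>) (layer_pairs gs)"
  have s: "?s = orth_proj (L2 P) (layer E)" using sum_aeb_layers[of gs] gs E by simp
  have "?s \<in> pos_part (L2 P) (basic_construction (L2 P) \<Omega> \<A> \<F>)"
    unfolding pos_part_def
  proof (intro CollectI conjI ballI)
    show "?s \<in> basic_construction (L2 P) \<Omega> \<A> \<F>"
      using sum_aeb_in_basic_construction gs E by simp
    fix x assume x: "x \<in> vecs (L2 P)"
    let ?w = "mult_op P (indicator (snd -` E)) x"
    have "vinner (L2 P) x (?s x) = vinner (L2 P) ?w ?w"
      unfolding s orth_proj_supp_space[OF pred_layer]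
      using vinner_mult_op_indicator[OF pred_layer x] vinner_cnj[of P x ?w] by (simp add: vinner_self)
    then show "vinner (L2 P) x (?s x) \<in> \<real>" "0 \<le> Re (vinner (L2 P) x (?s x))"
      by (simp_all add: vinner_self)
  qed
  moreover have "set (layer_pairs gs) \<subseteq> \<A> \<times> \<A>"
    using gs E by (auto intro!: btrans_op_in_A)
  ultimately have "\<tau> ?s < \<infinity>"
    using \<tau> by (simp add: canonical_trace_def Let_def)
  then show ?thesis by (simp add: s)
qed

section \<open>Exhaustion of the complement by orbit layers\<close>

lemma relative_discrete_spectrum_fibered:
  assumes rep: "\<And>a c. a \<in> \<A> \<Longrightarrow> represented_by \<rho> N (group_vn G) a c \<Longrightarrow>
      represented_by \<rho> N (group_vn G) (\<alpha> a) (\<lambda>p. int_pow_on (group_vn G) (gamma G T) (k p) (c (S p)))"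
    and U: "implementing_unitary (L2 P) \<Omega> \<A> \<alpha> U"
    and J: "modular_conjugation (L2 P) \<Omega> \<A> J"
    and \<tau>: "canonical_trace (L2 P) \<Omega> \<A> (vector_state (L2 P) \<Omega>) \<F> \<tau>"
    and orbits: "\<And>g. g \<in> carrier G \<Longrightarrow> finite (T_orbit g)"
  shows "relative_discrete_spectrum (L2 P) \<Omega> \<F> U J \<tau>"
  unfolding relative_discrete_spectrum_def discrete_part_def orth_compl_sub_space
proof
  let ?V = "\<Union> {V. U_trace_module (L2 P) \<Omega> \<F> U J \<tau> V}"
  have "?V \<subseteq> layer (- {\<one>})"
    by (auto simp: U_trace_module_def orth_compl_sub_space)
  \<comment> \<open>The complement is a layer, hence closed, and so is one of the subspaces whose
    intersection is the closed span.\<close>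
  then show "closed_span (L2 P) ?V \<subseteq> layer (- {\<one>})"
    unfolding closed_span_def using closed_subspace_supp_space[OF pred_layer] by (intro Inter_lower) simp
  show "layer (- {\<one>}) \<subseteq> closed_span (L2 P) ?V"
    unfolding closed_span_def
  proof (rule Inter_greatest)
    fix W assume "W \<in> {V. closed_subspace (L2 P) V \<and> ?V \<subseteq> V}"
    then have W: "closed_subspace (L2 P) W" "?V \<subseteq> W" by auto
    show "layer (- {\<one>}) \<subseteq> W"
    proof (rule layer_spanned[OF W(1)])
      fix b g assume b: "b \<in> Linfty \<rho>" and g: "g \<in> carrier G" "g \<in> - {\<one>}"
      let ?O = "T_orbit g"
      \<comment> \<open>T fixes the identity, so the complement of {1} is invariant and contains the
        orbit of every g other than 1.\<close>
      have "?O \<subseteq> - {\<one>}"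
        unfolding T_orbit_def
        using T_invariant_int_pow[OF T_invariant_Compl[OF T_invariant_one] g(1)] g(2)
        by (intro image_subsetI) blast
      then have "layer ?O \<subseteq> layer (- {\<one>})"
        unfolding supp_space_def by (auto elim: eventually_mono)
      then have "U_trace_module (L2 P) \<Omega> \<F> U J \<tau> (layer ?O)"
        unfolding U_trace_module_def orth_compl_sub_space
        using right_submodule_layer[OF J, of ?O] trace_layer_finite[OF \<tau> orbits[OF g(1)] T_orbit_carrier[OF g(1)]]
          implementing_unitary_layer[of \<alpha> k S, OF rep U T_invariant_orbit[OF g(1)]]
        by (intro conjI)
      moreover have "elem_vec b g \<in> layer ?O" by (rule elem_vec_in_layer[OF b g(1) T_orbit_self])
      ultimately show "elem_vec b g \<in> W" using W(2) by blast
    qed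
  qed
qed

end

theorem proposition4p4:
  fixes G :: "('g, 'm) monoid_scheme" and T :: "'g \<Rightarrow> 'g"
    and X :: "'x topology" and \<rho> :: "'x measure" and S :: "'x \<Rightarrow> 'x" and k :: "'x \<Rightarrow> int"
    and \<alpha> :: "(('x \<times> 'g \<Rightarrow> complex) set \<Rightarrow> ('x \<times> 'g \<Rightarrow> complex) set)
      \<Rightarrow> (('x \<times> 'g \<Rightarrow> complex) set \<Rightarrow> ('x \<times> 'g \<Rightarrow> complex) set)"
    and U J :: "('x \<times> 'g \<Rightarrow> complex) set \<Rightarrow> ('x \<times> 'g \<Rightarrow> complex) set"
    and \<tau> :: "(('x \<times> 'g \<Rightarrow> complex) set \<Rightarrow> ('x \<times> 'g \<Rightarrow> complex) set) \<Rightarrow> ennreal"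
  defines "N \<equiv> group_measure G"
    and "H \<equiv> L2 (\<rho> \<Otimes>\<^sub>M group_measure G)"
    and "C \<equiv> group_vn G"
    and "A \<equiv> vn_tensor \<rho> (group_measure G) (Linfty_algebra \<rho>) (group_vn G)"
    and "F \<equiv> tensor_ops \<rho> (group_measure G) (Linfty_algebra \<rho>)
               {\<lambda>v\<in>vecs (L2 (group_measure G)). v}"
    and "\<Omega> \<equiv> tensor_vec \<rho> (group_measure G) (l2_class \<rho> (\<lambda>_. 1)) (delta G \<one>\<^bsub>G\<^esub>)"
  assumes "group G" and "countable (carrier G)"
    and "T \<in> iso G G"
    and "\<And>g. g \<in> carrier G \<Longrightarrow> finite (range (\<lambda>n. int_pow_on (carrier G) T n g))"
    and "compact_space X" and "Hausdorff_space X"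
    and "space \<rho> = topspace X" and "sets \<rho> = borel_sets_of X"
    and "prob_space \<rho>" and "standard_borel \<rho>"
    and "measure_automorphism \<rho> S"
    and "k \<in> measurable \<rho> (count_space UNIV)"
    and "star_automorphism H A \<alpha>"
    and "\<And>a c. a \<in> A \<Longrightarrow> represented_by \<rho> N C a c \<Longrightarrow>
           represented_by \<rho> N C (\<alpha> a) (\<lambda>p. int_pow_on C (gamma G T) (k p) (c (S p)))"
    and "implementing_unitary H \<Omega> A \<alpha> U"
    and "modular_conjugation H \<Omega> A J"
    and "canonical_trace H \<Omega> A (vector_state H \<Omega>) F \<tau>"
  shows "relative_discrete_spectrum H \<Omega> F U J \<tau>"
proof -
  interpret group G by fact
  interpret prob_space \<rho> by fact
  interpret fibered_group_system G T \<rho>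
    by unfold_locales (fact assms)+
  have orbits: "finite (T_orbit g)" if "g \<in> carrier G" for g
    unfolding T_orbit_def using assms(10)[OF that] .
  note defs = N_def H_def C_def A_def F_def \<Omega>_def
  show ?thesis
    unfolding defs
    by (rule relative_discrete_spectrum_fibered[of \<alpha> k S, OF assms(20)[unfolded defs]
          assms(21)[unfolded defs] assms(22)[unfolded defs] assms(23)[unfolded defs] orbits])
qed

end
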